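(* Let $s,u$ be positive integers and let $x,y$ be nonempty finite tuples of variables with $(|x|,s)\ne(1,1)$. Assume that $E(x,y)\subseteq\mathbb{R}^{|x|}\times\mathbb{R}^{|y|}$ is a relation given by a boolean combination of exponential-polynomial (in)equalities, and the graph $E(x,y)$ does not contain $K_{s,u}$. Then for every $\varepsilon>0$ there is a constant $\alpha=\alpha(E,s,u,\varepsilon)$ such that for any finite $P\subseteq\mathbb{R}^{|x|}$, $Q\subseteq\mathbb{R}^{|y|}$ with $|P|=m$, $|Q|=n$, we have $$|E(P,Q)|\le\alpha\left(m^{\frac{(2|x|-2)s}{(2|x|-1)s-1}}n^{\frac{(2|x|-1)(s-1)}{(2|x|-1)s-1}+\varepsilon}+m+n\right).$$
   Context: An exponential polynomial is a function $\mathbb{R}^N\to\mathbb{R}$ belonging to $\mathbb{Z}[x_1,\dots,x_N,e^{x_1},\dots,e^{x_N}]$; an exponential-polynomial (in)equality is an equality or inequality between two such functions (here in the variables $(x,y)$, $N=|x|+|y|$). $E(P,Q)=E\cap(P\times Q)$. A relation $E\subseteq X\times Y$ is viewed as a bipartite graph with parts $X,Y$; it contains $K_{s,u}$ if there are $A\subseteq X$ with $|A|=s$ and $B\subseteq Y$ with $|B|=u$ such that $A\times B\subseteq E$. *)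

theory Defs
  imports "HOL-Analysis.Analysis"
begin

text \<open>The ring \<open>\<int>[x\<^sub>1, \<dots>, x\<^sub>N, e\<^bsup>x\<^sub>1\<^esup>, \<dots>, e\<^bsup>x\<^sub>N\<^esup>]\<close> as a ring of functions, the
  coordinates being indexed by \<open>'n\<close>, so that \<open>N = CARD('n)\<close>. Negation and subtraction come from
  the integer constants.\<close>

inductive exp_polynomial :: "(real ^ 'n \<Rightarrow> real) \<Rightarrow> bool" where
  const: "exp_polynomial (\<lambda>z. of_int c)"
| coord: "exp_polynomial (\<lambda>z. z $ i)"
| exp_coord: "exp_polynomial (\<lambda>z. exp (z $ i))"
| add: "exp_polynomial f \<Longrightarrow> exp_polynomial g \<Longrightarrow> exp_polynomial (\<lambda>z. f z + g z)"
| mult: "exp_polynomial f \<Longrightarrow> exp_polynomial g \<Longrightarrow> exp_polynomial (\<lambda>z. f z * g z)"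

inductive exp_bool_comb :: "(real ^ 'n) set \<Rightarrow> bool" where
  eq: "exp_polynomial f \<Longrightarrow> exp_polynomial g \<Longrightarrow> exp_bool_comb {z. f z = g z}"
| less: "exp_polynomial f \<Longrightarrow> exp_polynomial g \<Longrightarrow> exp_bool_comb {z. f z < g z}"
| le: "exp_polynomial f \<Longrightarrow> exp_polynomial g \<Longrightarrow> exp_bool_comb {z. f z \<le> g z}"
| compl: "exp_bool_comb S \<Longrightarrow> exp_bool_comb (- S)"
| inter: "exp_bool_comb S \<Longrightarrow> exp_bool_comb T \<Longrightarrow> exp_bool_comb (S \<inter> T)"
| union: "exp_bool_comb S \<Longrightarrow> exp_bool_comb T \<Longrightarrow> exp_bool_comb (S \<union> T)"

definition concat_vec :: "real ^ 'a \<Rightarrow> real ^ 'b \<Rightarrow> real ^ ('a + 'b)" where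
  "concat_vec x y = (\<chi> i. case i of Inl j \<Rightarrow> x $ j | Inr k \<Rightarrow> y $ k)"

definition exp_relation :: "((real ^ 'a) \<times> (real ^ 'b)) set \<Rightarrow> bool" where
  "exp_relation E \<longleftrightarrow> (\<exists>S. exp_bool_comb S \<and> E = {(x, y). concat_vec x y \<in> S})"

definition contains_K :: "('a \<times> 'b) set \<Rightarrow> nat \<Rightarrow> nat \<Rightarrow> bool" where
  "contains_K E s u \<longleftrightarrow>
    (\<exists>A B. finite A \<and> card A = s \<and> finite B \<and> card B = u \<and> A \<times> B \<subseteq> E)"

end

theory Submission
  imports Defs
begin

text \<open>No o-minimality is used. A fibre of the relation is a boolean combination of boundedly many
  existential sets, that is projections of zero sets of exponential polynomials of bounded degree in a
  bounded number of variables. On a finite set of points an existential set agrees with the projection of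
  a generic coercive sublevel set, which changes along a coordinate line only at the projections of
  fibrewise critical points. Khovanskii's fewnomial argument (replacing one exponential at a time by
  Rolle's theorem) bounds their number, and they again form an existential set. Sorting the points on
  each line by two such finite fibres and inducting on the dimension gives, for \<open>n\<close> parameters and
  \<open>d = |x|\<close>, a covering of the points by \<open>O(n\<^bsup>2d-1\<^esup>)\<close> uncrossed cells that come from a family of
  polynomial size. A greedy hitting set turns this into cuttings, at the price of a logarithm, which
  is absorbed by \<open>n\<^bsup>\<epsilon>\<^esup>\<close>. Finally the Kovari--Sos--Turan bound is applied in each cell of a
  cutting; the points in cells with fewer than \<open>s\<close> points are at most half of all points, and the
  argument is iterated on them.\<close>

section \<open>Polynomials in generating functions\<close>

text \<open>Existential sets are closed under unions, intersections and projections, but closure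
  under complements is not at hand, and this shapes the cells: all information about a fibre is put
  into statements of the form "at least so many points", and exact counts are recovered only by
  comparing two lines whose fibres have equal size. Complements of the given sets themselves do no
  harm, since crossing does not distinguish a set from its complement. All perturbations are chosen
  after the finite set of points. Only degrees, numbers of variables and numbers of fibre points
  have to be bounded uniformly, and these are the quantities that the statements carry along. The
  exponent 2d - 1 is 1 on the line and 2 more for each further coordinate, one for each of the two
  parameters that bound a cell from below and from above. That the loss is a power of n and not of m
  comes from a preliminary reduction to m = O(n^(2d-1)) points, after which log m = O(log
  n).\<close>

inductive bdpoly :: "('x \<Rightarrow> real) set \<Rightarrow> nat \<Rightarrow> ('x \<Rightarrow> real) \<Rightarrow> bool" for G where
  const: "bdpoly G D (\<lambda>x. c)"
| gen: "g \<in> G \<Longrightarrow> 1 \<le> D \<Longrightarrow> bdpoly G D g"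
| add: "bdpoly G D f \<Longrightarrow> bdpoly G D g \<Longrightarrow> bdpoly G D (\<lambda>x. f x + g x)"
| mult: "bdpoly G D f \<Longrightarrow> bdpoly G E g \<Longrightarrow> bdpoly G (D + E) (\<lambda>x. f x * g x)"

lemma bdpoly_mono:
  assumes "bdpoly G D f" "D \<le> E"
  shows "bdpoly G E f"
  using assms
proof (induction arbitrary: E rule: bdpoly.induct)
  case (mult D f D' g)
  have "bdpoly G (D + (E - D)) (\<lambda>x. f x * g x)"
    using mult by (intro bdpoly.mult) auto
  then show ?case using mult by simp
qed (auto intro: bdpoly.intros)

lemma bdpoly_mult_le: "bdpoly G D f \<Longrightarrow> bdpoly G E g \<Longrightarrow> D + E \<le> F \<Longrightarrow> bdpoly G F (\<lambda>x. f x * g x)"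
  using bdpoly.mult bdpoly_mono by blast

lemma bdpoly_cmult: "bdpoly G D f \<Longrightarrow> bdpoly G D (\<lambda>x. c * f x)"
  by (rule bdpoly_mult_le[OF bdpoly.const[of G 0 c]]) auto

lemma bdpoly_minus: "bdpoly G D f \<Longrightarrow> bdpoly G D (\<lambda>x. - f x)"
  using bdpoly_cmult[of G D f "-1"] by simp

lemma bdpoly_diff: "bdpoly G D f \<Longrightarrow> bdpoly G D g \<Longrightarrow> bdpoly G D (\<lambda>x. f x - g x)"
  using bdpoly.add[OF _ bdpoly_minus] by force

lemma bdpoly_sum: "(\<And>i. i \<in> I \<Longrightarrow> bdpoly G D (f i)) \<Longrightarrow> bdpoly G D (\<lambda>x. \<Sum>i\<in>I. f i x)"
  by (induction I rule: infinite_finite_induct) (auto intro: bdpoly.intros)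

lemma bdpoly_prod:
  "(\<And>i. i \<in> I \<Longrightarrow> bdpoly G D (f i)) \<Longrightarrow> bdpoly G (card I * D) (\<lambda>x. \<Prod>i\<in>I. f i x)"
  by (induction I rule: infinite_finite_induct) (auto intro: bdpoly.intros)

lemma bdpoly_power: "bdpoly G D f \<Longrightarrow> bdpoly G (n * D) (\<lambda>x. f x ^ n)"
  by (induction n) (auto intro: bdpoly.intros)

lemma bdpoly_det:
  fixes A :: "'x \<Rightarrow> real^'n^'n"
  assumes "\<And>i j. bdpoly G D (\<lambda>x. A x $ i $ j)"
  shows "bdpoly G (CARD('n) * D) (\<lambda>x. det (A x))"
  unfolding det_def
  by (intro bdpoly_sum bdpoly_cmult bdpoly_prod assms)

text \<open>In the application \<open>R x y\<close> says that \<open>y\<close> lists the values of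
  the generators at \<open>x\<close>. An exponential polynomial in \<open>x\<close> thus becomes a
  genuine polynomial in new coordinates, without raising the degree.\<close>

lemma bdpoly_factor:
  assumes "bdpoly G D f"
    and "\<And>g. g \<in> G \<Longrightarrow> \<exists>p. bdpoly G' 1 p \<and> (\<forall>x y. R x y \<longrightarrow> g x = p y)"
  shows "\<exists>p. bdpoly G' D p \<and> (\<forall>x y. R x y \<longrightarrow> f x = p y)"
  using assms(1)
proof (induction rule: bdpoly.induct)
  case (const D c) then show ?case by (auto intro!: exI[of _ "\<lambda>x. c"] bdpoly.const)
next
  case (gen g D) then show ?case using assms(2)[of g] bdpoly_mono by blast
next
  case (add D f g)
  then obtain p q where "bdpoly G' D p" "bdpoly G' D q"
    "\<forall>x y. R x y \<longrightarrow> f x = p y" "\<forall>x y. R x y \<longrightarrow> g x = q y"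
    by blast
  then show ?case by (intro exI[of _ "\<lambda>x. p x + q x"]) (auto intro: bdpoly.add)
next
  case (mult D f E g)
  then obtain p q where "bdpoly G' D p" "bdpoly G' E q"
    "\<forall>x y. R x y \<longrightarrow> f x = p y" "\<forall>x y. R x y \<longrightarrow> g x = q y"
    by blast
  then show ?case by (intro exI[of _ "\<lambda>x. p x * q x"]) (auto intro: bdpoly.mult)
qed

lemma bdpoly_comp:
  assumes "bdpoly G D f" and "\<And>g. g \<in> G \<Longrightarrow> bdpoly G' 1 (\<lambda>x. g (h x))"
  shows "bdpoly G' D (\<lambda>x. f (h x))"
  using assms(1)
  by (induction rule: bdpoly.induct) (use assms(2) bdpoly_mono in \<open>blast intro: bdpoly.intros\<close>)+

section \<open>Gradients of polynomials in the generators\<close>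

definition has_grad :: "(real^'n \<Rightarrow> real) \<Rightarrow> (real^'n \<Rightarrow> real^'n) \<Rightarrow> bool" where
  "has_grad f df \<longleftrightarrow> (\<forall>x. (f has_derivative (\<lambda>h. df x \<bullet> h)) (at x))"

text \<open>The degree bound survives differentiation as soon as the gradients of the generators
  have degree at most 1. For coordinates they are constant, and exponentials reproduce
  themselves.\<close>

lemma bdpoly_grad:
  fixes f :: "real^'n \<Rightarrow> real"
  assumes "bdpoly G D f"
    and "\<And>g. g \<in> G \<Longrightarrow> \<exists>dg. (\<forall>i. bdpoly G 1 (\<lambda>x. dg x $ i)) \<and> has_grad g dg"
  shows "\<exists>df. (\<forall>i. bdpoly G D (\<lambda>x. df x $ i)) \<and> has_grad f df"
  using assms(1)
proof (induction rule: bdpoly.induct)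
  case (const D c)
  then show ?case
    by (intro exI[of _ "\<lambda>x. 0"]) (auto simp: has_grad_def intro: bdpoly.const)
next
  case (gen g D) then show ?case using assms(2)[of g] bdpoly_mono by blast
next
  case (add D f g)
  then obtain p q where "\<forall>i. bdpoly G D (\<lambda>x. p x $ i)" "\<forall>i. bdpoly G D (\<lambda>x. q x $ i)"
    "has_grad f p" "has_grad g q"
    by blast
  then show ?case
    by (intro exI[of _ "\<lambda>x. p x + q x"])
      (auto simp: has_grad_def inner_add_left intro!: bdpoly.add has_derivative_add)
next
  case (mult D f E g)
  then obtain p q where "\<forall>i. bdpoly G D (\<lambda>x. p x $ i)" "\<forall>i. bdpoly G E (\<lambda>x. q x $ i)"
    "has_grad f p" "has_grad g q"
    by blast
  then show ?case
    by (intro exI[of _ "\<lambda>x. f x *\<^sub>R q x + g x *\<^sub>R p x"] conjI allI)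
      (auto simp: has_grad_def inner_add_left intro!: bdpoly.add bdpoly_mult_le mult.hyps
        derivative_eq_intros)
qed

definition coords :: "(real^'n \<Rightarrow> real) set" where
  "coords = range (\<lambda>i x. x $ i)"

definition expcoords :: "(real^'n \<Rightarrow> real) set" where
  "expcoords = coords \<union> range (\<lambda>i x. exp (x $ i))"

lemma grad_coords:
  "g \<in> coords \<Longrightarrow> \<exists>dg. (\<forall>i. bdpoly coords 1 (\<lambda>x. dg x $ i)) \<and> has_grad g dg"
proof -
  assume "g \<in> coords"
  then obtain k where g: "g = (\<lambda>x. x $ k)" unfolding coords_def by auto
  show ?thesis unfolding g
    by (rule exI[of _ "\<lambda>x. axis k 1"])
      (auto simp: has_grad_def inner_axis' intro: bdpoly.const
        intro!: bounded_linear_imp_has_derivative bounded_linear_vec_nth)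
qed

lemma grad_expcoords:
  fixes g :: "real^'n \<Rightarrow> real"
  assumes "g \<in> expcoords"
  shows "\<exists>dg. (\<forall>i. bdpoly expcoords 1 (\<lambda>x. dg x $ i)) \<and> has_grad g dg"
proof (cases "g \<in> coords")
  case True
  from grad_coords[OF this] obtain dg where dg: "\<forall>i. bdpoly coords 1 (\<lambda>x. dg x $ i)" "has_grad g dg"
    by blast
  have "bdpoly expcoords 1 (\<lambda>x. dg x $ i)" for i
    by (rule bdpoly_comp[of coords 1 "\<lambda>x. dg x $ i" expcoords "\<lambda>x. x"])
      (use dg(1) in \<open>auto simp: expcoords_def intro: bdpoly.gen\<close>)
  then show ?thesis using dg by blast
next
  case False
  then obtain k where g: "g = (\<lambda>x. exp (x $ k))" using assms unfolding expcoords_def by auto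
  have "bdpoly expcoords 1 (\<lambda>x. (exp (x $ k) *\<^sub>R axis k 1 :: real^'n) $ i)" for i
  proof (cases "i = k")
    case True then show ?thesis by (auto simp: expcoords_def intro!: bdpoly.gen)
  next
    case False then show ?thesis by (auto simp: axis_def intro: bdpoly.const)
  qed
  moreover have "has_grad g (\<lambda>x. exp (x $ k) *\<^sub>R axis k 1)"
    unfolding g has_grad_def
    by (auto simp: inner_axis' intro!: derivative_eq_intros bounded_linear_imp_has_derivative
        bounded_linear_vec_nth)
  ultimately show ?thesis
    by (intro exI[of _ "\<lambda>x. exp (x $ k) *\<^sub>R axis k 1"] conjI allI)
qed

lemma has_grad_continuous: "has_grad f df \<Longrightarrow> continuous_on S f"
  unfolding has_grad_def
  by (meson continuous_at_imp_continuous_on has_derivative_continuous)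

lemma bdpoly_coords_continuous: "bdpoly coords D f \<Longrightarrow> continuous_on S f"
  using bdpoly_grad[OF _ grad_coords] has_grad_continuous by blast

lemma bdpoly_expcoords_continuous: "bdpoly expcoords D f \<Longrightarrow> continuous_on S f"
  using bdpoly_grad[OF _ grad_expcoords] has_grad_continuous by blast

section \<open>The Khovanskii--Rolle theorem\<close>

definition C1_map :: "(real^'n \<Rightarrow> real^'n) \<Rightarrow> (real^'n \<Rightarrow> real^'n^'n) \<Rightarrow> bool" where
  "C1_map \<Phi> d\<Phi> \<longleftrightarrow> (\<forall>k. has_grad (\<lambda>x. \<Phi> x $ k) (\<lambda>x. d\<Phi> x $ k)) \<and> continuous_on UNIV d\<Phi>"

lemma C1_map_has_derivative:
  assumes "C1_map \<Phi> d\<Phi>"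
  shows "(\<Phi> has_derivative (\<lambda>h. d\<Phi> x *v h)) (at x)"
proof -
  have "((\<lambda>x. \<chi> k. \<Phi> x $ k) has_derivative (\<lambda>h. \<chi> k. d\<Phi> x $ k \<bullet> h)) (at x)"
    using assms unfolding C1_map_def has_grad_def
    by (intro has_derivative_componentwise_within[THEN iffD2])
      (auto simp: Basis_vec_def inner_axis)
  moreover have "(\<chi> k. d\<Phi> x $ k \<bullet> h) = d\<Phi> x *v h" for h
    by (simp add: vec_eq_iff matrix_vector_mul_component)
  ultimately show ?thesis by simp
qed

lemma C1_map_continuous: "C1_map \<Phi> d\<Phi> \<Longrightarrow> continuous_on S \<Phi>"
  by (meson C1_map_has_derivative continuous_at_imp_continuous_on has_derivative_continuous)

text \<open>The inverse function theorem in matrix form. Of its conclusions, injectivity serves to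
  bound numbers of solutions from above, and openness to move solutions to nearby values.\<close>

lemma C1_map_locally_homeo:
  fixes \<Phi> :: "real^'n \<Rightarrow> real^'n"
  assumes "C1_map \<Phi> d\<Phi>" "det (d\<Phi> x0) \<noteq> 0" "open W" "x0 \<in> W"
  obtains U where "open U" "x0 \<in> U" "U \<subseteq> W" "inj_on \<Phi> U" "open (\<Phi> ` U)"
proof -
  define f' where "f' x = Blinfun (\<lambda>h. d\<Phi> x *v h)" for x
  have app: "blinfun_apply (f' x) = (\<lambda>h. d\<Phi> x *v h)" for x
    unfolding f'_def by (rule bounded_linear_Blinfun_apply) (rule matrix_vector_mul_bounded_linear)
  obtain B where B: "B ** d\<Phi> x0 = mat 1"
    using assms(2) invertible_det_nz invertible_def by blast
  define invf where "invf = Blinfun (\<lambda>h. B *v h)"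
  have appi: "blinfun_apply invf = (\<lambda>h. B *v h)"
    unfolding invf_def by (rule bounded_linear_Blinfun_apply) (rule matrix_vector_mul_bounded_linear)
  have cont: "continuous_on UNIV f'"
  proof (rule continuous_on_blinfun_componentwise)
    fix b :: "real^'n" assume "b \<in> Basis"
    have "continuous_on UNIV d\<Phi>" using assms(1) unfolding C1_map_def by auto
    then show "continuous_on UNIV (\<lambda>x. blinfun_apply (f' x) b)"
      unfolding app matrix_vector_mult_def
      by (intro continuous_on_vec_lambda continuous_on_sum continuous_on_mult_right
          continuous_on_component)
  qed
  obtain U V g g' where U: "open U" "U \<subseteq> W" "x0 \<in> U" "open V" "\<Phi> x0 \<in> V"
      and hom: "homeomorphism U V \<Phi> g"
  proof (rule inverse_function_theorem[of W \<Phi> f' x0 invf])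
    show "open W" "x0 \<in> W" by (fact assms)+
    show "\<And>x. x \<in> W \<Longrightarrow> (\<Phi> has_derivative blinfun_apply (f' x)) (at x)"
      unfolding app using C1_map_has_derivative[OF assms(1)] by blast
    show "continuous_on W f'" using cont continuous_on_subset by blast
    show "invf o\<^sub>L f' x0 = id_blinfun"
      by (rule blinfun_eqI) (simp add: app appi matrix_vector_mul_assoc B)
  qed blast
  show ?thesis
  proof (rule that[OF U(1) U(3) U(2)])
    show "inj_on \<Phi> U" using hom unfolding homeomorphism_def by (metis inj_on_inverseI)
    show "open (\<Phi> ` U)" using hom U(4) unfolding homeomorphism_def by simp
  qed
qed

text \<open>Each zero has a neighbourhood with open image, and the finite intersection of these
  images is a neighbourhood of \<open>w\<close>. This is how a count of zeros at a special value is
  replaced by a count at a generic one.\<close>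

lemma zeros_persist:
  fixes \<Phi> :: "real^'n \<Rightarrow> real^'n"
  assumes C1: "C1_map \<Phi> d\<Phi>" and fin: "finite Z"
    and Z: "\<And>z. z \<in> Z \<Longrightarrow> \<Phi> z = w \<and> det (d\<Phi> z) \<noteq> 0"
    and W: "open W" "Z \<subseteq> W" and "e > 0"
  obtains \<epsilon> where "\<epsilon> > 0"
    "\<And>v. dist v w < \<epsilon> \<Longrightarrow>
       \<exists>f. inj_on f Z \<and> (\<forall>z\<in>Z. \<Phi> (f z) = v \<and> f z \<in> W \<and> dist (f z) z < e)"
proof -
  obtain e0 where e0: "e0 > 0" "\<And>z z'. z \<in> Z \<Longrightarrow> z' \<in> Z \<Longrightarrow> z \<noteq> z' \<Longrightarrow> e0 \<le> dist z z'"
  proof -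
    have "\<exists>e0>0. \<forall>z'\<in>Z. z \<noteq> z' \<longrightarrow> e0 \<le> dist z z'" for z
      using finite_set_avoid[OF fin, of z] by metis
    then obtain d where d: "\<And>z. d z > 0" "\<And>z z'. z' \<in> Z \<Longrightarrow> z \<noteq> z' \<Longrightarrow> d z \<le> dist z z'"
      by metis
    show ?thesis
    proof (rule that[of "Min (insert 1 (d ` Z))"])
      show "Min (insert 1 (d ` Z)) > 0" using fin d(1) by (subst Min_gr_iff) auto
      show "Min (insert 1 (d ` Z)) \<le> dist z z'" if "z \<in> Z" "z' \<in> Z" "z \<noteq> z'" for z z'
        using d(2)[OF that(2,3)] that(1) fin by (meson Min_le finite_imageI finite_insert image_eqI
            insertI2 order_trans)
    qed
  qed
  \<comment> \<open>At most half of a lower bound for the distances between zeros, so that preimages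
    found near different zeros are different.\<close>
  define e1 where "e1 = min e (e0/2)"
  have "e1 > 0" using e0 \<open>e > 0\<close> unfolding e1_def by auto
  have "\<exists>U. open U \<and> z \<in> U \<and> U \<subseteq> W \<inter> ball z e1 \<and> open (\<Phi> ` U)" if zZ: "z \<in> Z" for z
  proof -
    have o: "open (W \<inter> ball z e1)" using W(1) open_Int open_ball by blast
    have i: "z \<in> W \<inter> ball z e1" using W(2) zZ \<open>e1 > 0\<close> by (simp add: subsetD)
    obtain U where "open U" "z \<in> U" "U \<subseteq> W \<inter> ball z e1" "open (\<Phi> ` U)"
      by (rule C1_map_locally_homeo[OF C1 conjunct2[OF Z[OF zZ]] o i])
    then show ?thesis by blast
  qed
  then obtain U where U: "\<And>z. z \<in> Z \<Longrightarrow> open (U z) \<and> z \<in> U z \<and> U z \<subseteq> W \<inter> ball z e1 \<and> open (\<Phi> ` U z)"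
    by metis
  have "open (\<Inter>z\<in>Z. \<Phi> ` U z)" using fin U by (intro open_INT) auto
  moreover have "w \<in> (\<Inter>z\<in>Z. \<Phi> ` U z)" using U Z by (metis INT_I image_eqI)
  ultimately obtain \<epsilon> where \<epsilon>: "\<epsilon> > 0" "ball w \<epsilon> \<subseteq> (\<Inter>z\<in>Z. \<Phi> ` U z)"
    using openE by blast
  show ?thesis
  proof (rule that[OF \<epsilon>(1)])
    fix v assume "dist v w < \<epsilon>"
    then have "v \<in> ball w \<epsilon>" by (simp add: dist_commute)
    then have "v \<in> (\<Inter>z\<in>Z. \<Phi> ` U z)" using \<epsilon>(2) by blast
    then have "\<forall>z\<in>Z. \<exists>x. x \<in> U z \<and> \<Phi> x = v" by auto
    then obtain f where f: "\<And>z. z \<in> Z \<Longrightarrow> f z \<in> U z \<and> \<Phi> (f z) = v" by metis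
    have near: "dist (f z) z < e1" "f z \<in> W" if "z \<in> Z" for z
      using f[OF that] U[OF that] by (auto simp: dist_commute)
    have "inj_on f Z"
    proof (rule inj_onI, rule ccontr)
      fix z z' assume z: "z \<in> Z" "z' \<in> Z" "f z = f z'" "z \<noteq> z'"
      have "dist z z' \<le> dist (f z) z + dist (f z') z'"
        using z(3) dist_triangle2[of z z' "f z"] by (simp add: dist_commute)
      then show False using near(1)[OF z(1)] near(1)[OF z(2)] e0(2)[OF z(1,2,4)] unfolding e1_def
        by linarith
    qed
    then show "\<exists>f. inj_on f Z \<and> (\<forall>z\<in>Z. \<Phi> (f z) = v \<and> f z \<in> W \<and> dist (f z) z < e)"
      using near f unfolding e1_def by (intro exI[of _ f]) auto
  qed
qed

text \<open>The supremum of the \<open>x\<close> in \<open>[a, b]\<close> with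
  \<open>q a \<le> q x\<close> has this property itself by the condition on the left, and it cannot
  be smaller than \<open>b\<close> by the condition on the right.\<close>

lemma locally_nondecreasing:
  fixes q :: "real \<Rightarrow> nat"
  assumes "\<And>x. \<exists>e>0. (\<forall>y. x - e < y \<and> y < x \<longrightarrow> q y \<le> q x) \<and> (\<forall>y. x < y \<and> y < x + e \<longrightarrow> q x \<le> q y)"
    and "a \<le> b"
  shows "q a \<le> q b"
proof -
  define S where "S = {x. a \<le> x \<and> x \<le> b \<and> q a \<le> q x}"
  have S: "a \<in> S" "bdd_above S" using assms(2) unfolding S_def by auto
  define s where "s = Sup S"
  have "a \<le> s" unfolding s_def by (rule cSup_upper[OF S])
  have "s \<le> b" unfolding s_def by (rule cSup_least) (use S(1) S_def in auto)
  note s = \<open>a \<le> s\<close> \<open>s \<le> b\<close>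
  obtain e where e: "e > 0" "\<And>y. s - e < y \<Longrightarrow> y < s \<Longrightarrow> q y \<le> q s"
    "\<And>y. s < y \<Longrightarrow> y < s + e \<Longrightarrow> q s \<le> q y"
    using assms(1)[of s] by blast
  obtain y where "y \<in> S" "s - e < y" "y \<le> s"
  proof -
    have "S \<noteq> {}" "s - e < Sup S" using S e(1) unfolding s_def by auto
    then obtain y where "y \<in> S" "s - e < y" using less_cSup_iff[OF _ S(2)] by blast
    then show ?thesis using that cSup_upper[OF _ S(2)] unfolding s_def by blast
  qed
  then have sS: "q a \<le> q s"
    using e(2)[of y] unfolding S_def by (cases "y = s") auto
  show ?thesis
  proof (cases "s = b")
    case True then show ?thesis using sS by simp
  next
    case False
    define y where "y = min b (s + e/2)"
    have "s < y" "y \<le> b" "y < s + e" using False s e(1) unfolding y_def by auto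
    then have "y \<in> S" using e(3)[of y] sS s unfolding S_def by auto
    then have "y \<le> s" using cSup_upper[OF _ S(2)] unfolding s_def by blast
    then show ?thesis using \<open>s < y\<close> by simp
  qed
qed

text \<open>Rolle's theorem along the curve cut out by the rows other than \<open>i\<close>, without
  parametrising the curve. As \<open>\<tau>\<close> grows, the solutions of
  \<open>\<Phi> u $ i = \<tau>\<close> on the curve inside \<open>g > a\<close> move continuously,
  since the Jacobian does not vanish there, and one can disappear only by reaching
  \<open>g = a\<close>. For large \<open>\<tau>\<close> none is left because the curve is compact,
  so each solution is paid for by a point with \<open>g = a\<close>. In the application
  \<open>g\<close> is, up to sign, a polynomial with the same zeros as the Jacobian.\<close>

lemma Khovanskii_Rolle:
  fixes \<Phi> :: "real^'m \<Rightarrow> real^'m" and h :: "real^'m" and g :: "real^'m \<Rightarrow> real"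
  assumes C1: "C1_map \<Phi> d\<Phi>"
    and g: "continuous_on UNIV g" "\<And>u. g u > 0 \<Longrightarrow> det (d\<Phi> u) \<noteq> 0"
    and bdd: "bounded {u. \<forall>k. k \<noteq> i \<longrightarrow> \<Phi> u $ k = h $ k}"
    and "a > 0"
    and fin: "finite {u. (\<forall>k. k \<noteq> i \<longrightarrow> \<Phi> u $ k = h $ k) \<and> g u = a}"
  shows "finite {u. \<Phi> u = h \<and> g u > a}"
    and "card {u. \<Phi> u = h \<and> g u > a} \<le> card {u. (\<forall>k. k \<noteq> i \<longrightarrow> \<Phi> u $ k = h $ k) \<and> g u = a}"
proof -
  define \<Gamma> where "\<Gamma> = {u. \<forall>k. k \<noteq> i \<longrightarrow> \<Phi> u $ k = h $ k}"
  define w where "w \<tau> = (\<chi> k. if k = i then \<tau> else h $ k)" for \<tau>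
  have w_iff: "\<Phi> u = w \<tau> \<longleftrightarrow> u \<in> \<Gamma> \<and> \<Phi> u $ i = \<tau>" for u \<tau>
    unfolding w_def \<Gamma>_def by (auto simp: vec_eq_iff)
  have wh: "w (h $ i) = h" unfolding w_def by (auto simp: vec_eq_iff)
  define E where "E = {u \<in> \<Gamma>. g u = a}"
  have finE: "finite E" using fin unfolding E_def \<Gamma>_def by simp
  define X where "X \<tau> = {u. \<Phi> u = w \<tau> \<and> g u > a}" for \<tau>
  define Y where "Y \<tau> = {u. \<Phi> u = w \<tau> \<and> g u \<ge> a}" for \<tau>
  define K where "K = {u \<in> \<Gamma>. g u \<ge> a}"
  have contk: "continuous_on UNIV (\<lambda>u. \<Phi> u $ k)" for k
    using C1_map_continuous[OF C1] by (intro continuous_on_component)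
  have "\<Gamma> = (\<Inter>k\<in>{k. k \<noteq> i}. {u. \<Phi> u $ k = h $ k})" unfolding \<Gamma>_def by auto
  moreover have "closed (\<Inter>k\<in>{k. k \<noteq> i}. {u. \<Phi> u $ k = h $ k})"
    using contk by (intro closed_INT ballI closed_Collect_eq) auto
  ultimately have "closed \<Gamma>" by simp
  then have "compact \<Gamma>" using bdd unfolding \<Gamma>_def[symmetric] by (simp add: compact_eq_bounded_closed)
  moreover have "closed {u. g u \<ge> a}" using closed_Collect_le[OF continuous_on_const g(1), of a] by simp
  moreover have "K = \<Gamma> \<inter> {u. g u \<ge> a}" unfolding K_def by auto
  ultimately have compK: "compact K" by auto
  have YK: "Y \<tau> = {u \<in> K. \<Phi> u $ i = \<tau>}" for \<tau> unfolding Y_def K_def w_iff by auto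
  have XY: "X \<tau> \<subseteq> Y \<tau>" for \<tau> unfolding X_def Y_def by auto
  have "\<exists>U. open U \<and> u \<in> U \<and> inj_on \<Phi> U" if "u \<in> K" for u
  proof -
    have "det (d\<Phi> u) \<noteq> 0" using g(2)[of u] that \<open>a > 0\<close> unfolding K_def by auto
    then show ?thesis using C1_map_locally_homeo[OF C1, of u UNIV] by (metis UNIV_I open_UNIV)
  qed
  then obtain U where U: "\<And>u. u \<in> K \<Longrightarrow> open (U u) \<and> u \<in> U u \<and> inj_on \<Phi> (U u)" by metis
  have compY: "compact (Y \<tau>)" for \<tau>
  proof -
    have "Y \<tau> = K \<inter> {u. \<Phi> u $ i = \<tau>}" unfolding YK by auto
    then show ?thesis using compK contk[of i] by (simp add: closed_Collect_eq compact_Int_closed)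
  qed
  have finY: "finite (Y \<tau>)" for \<tau>
  proof -
    have YsubK: "Y \<tau> \<subseteq> K" unfolding YK by auto
    have "\<forall>B\<in>U ` Y \<tau>. open B" using U YsubK by blast
    moreover have "Y \<tau> \<subseteq> \<Union>(U ` Y \<tau>)" using U YsubK by blast
    ultimately obtain C' where C': "C' \<subseteq> U ` Y \<tau>" "finite C'" "Y \<tau> \<subseteq> \<Union>C'"
      using compactE[OF compY[of \<tau>], of "U ` Y \<tau>"] by metis
    obtain Y' where Y': "Y' \<subseteq> Y \<tau>" "finite Y'" "C' = U ` Y'"
      using C'(1,2) by (meson finite_subset_image)
    have "Y \<tau> \<subseteq> Y'"
    proof
      fix u assume u: "u \<in> Y \<tau>"
      then obtain v where v: "v \<in> Y'" "u \<in> U v" using C'(3) Y'(3) by blast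
      have vK: "v \<in> Y \<tau>" "v \<in> K" using v(1) Y'(1) YsubK by auto
      have "\<Phi> u = \<Phi> v" using u vK(1) unfolding Y_def by simp
      moreover have "v \<in> U v" "inj_on \<Phi> (U v)" using U[OF vK(2)] by auto
      ultimately have "u = v" using v(2) by (meson inj_onD)
      then show "u \<in> Y'" using v by simp
    qed
    then show ?thesis using Y'(2) finite_subset by blast
  qed
  then have finX: "finite (X \<tau>)" for \<tau> using XY finite_subset by blast
  have cardY: "card (Y \<tau>) = card (X \<tau>) + card {u \<in> E. \<Phi> u $ i = \<tau>}" for \<tau>
  proof -
    have "Y \<tau> = X \<tau> \<union> {u \<in> E. \<Phi> u $ i = \<tau>}" unfolding Y_def X_def E_def w_iff by auto
    moreover have "X \<tau> \<inter> {u \<in> E. \<Phi> u $ i = \<tau>} = {}" unfolding X_def E_def by auto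
    ultimately show ?thesis using finX finE by (simp add: card_Un_disjoint)
  qed
  \<comment> \<open>Solutions still present plus exit points already passed; this number never
    decreases.\<close>
  define q where "q \<tau> = card (X \<tau>) + card {u \<in> E. \<Phi> u $ i \<le> \<tau>}" for \<tau>
  have below: "\<exists>e>0. \<forall>\<sigma>. \<tau> - e < \<sigma> \<and> \<sigma> < \<tau> \<longrightarrow> q \<sigma> \<le> q \<tau>" for \<tau>
  proof -
    \<comment> \<open>On this compact set \<open>\<Phi> u $ i\<close> keeps away from
      \<open>\<tau>\<close>, so the solutions for \<open>\<sigma>\<close> slightly below
      \<open>\<tau>\<close> lie in the neighbourhoods of the points of \<open>Y \<tau>\<close>, each
      of which contains at most one of them.\<close>
    define K' where "K' = K - (\<Union>u\<in>Y \<tau>. U u)"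
    have YsubK: "Y \<tau> \<subseteq> K" unfolding YK by auto
    have "compact K'" unfolding K'_def using compK U YsubK by (intro compact_diff open_UN) blast+
    then have "compact ((\<lambda>u. \<Phi> u $ i) ` K')"
      using contk[of i] continuous_on_subset compact_continuous_image by blast
    moreover have "\<tau> \<notin> (\<lambda>u. \<Phi> u $ i) ` K'"
    proof
      assume "\<tau> \<in> (\<lambda>u. \<Phi> u $ i) ` K'"
      then obtain u where u: "u \<in> K'" "\<Phi> u $ i = \<tau>" by auto
      then have "u \<in> Y \<tau>" unfolding YK K'_def by auto
      then show False using u U YsubK unfolding K'_def by blast
    qed
    ultimately obtain e where e: "e > 0" "\<And>u. u \<in> K' \<Longrightarrow> e \<le> dist \<tau> (\<Phi> u $ i)"
      using separate_point_closed[of "(\<lambda>u. \<Phi> u $ i) ` K'" \<tau>] compact_imp_closed by blast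
    have "q \<sigma> \<le> q \<tau>" if \<sigma>: "\<tau> - e < \<sigma>" "\<sigma> < \<tau>" for \<sigma>
    proof -
      have "\<exists>u. u \<in> Y \<tau> \<and> v \<in> U u" if "v \<in> X \<sigma>" for v
      proof (rule ccontr)
        assume "\<not> ?thesis"
        moreover have "v \<in> Y \<sigma>" using that XY by blast
        then have "v \<in> K" "\<Phi> v $ i = \<sigma>" unfolding YK by auto
        ultimately have "v \<in> K'" unfolding K'_def by blast
        then show False using e(2)[of v] \<open>\<Phi> v $ i = \<sigma>\<close> \<sigma> by (auto simp: dist_real_def)
      qed
      then obtain f where f: "\<And>v. v \<in> X \<sigma> \<Longrightarrow> f v \<in> Y \<tau> \<and> v \<in> U (f v)" by metis
      have "inj_on f (X \<sigma>)"
      proof (rule inj_onI)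
        fix v v' assume v: "v \<in> X \<sigma>" "v' \<in> X \<sigma>" "f v = f v'"
        have "v \<in> U (f v)" "v' \<in> U (f v)" "inj_on \<Phi> (U (f v))"
          using f[OF v(1)] f[OF v(2)] v(3) U YsubK by auto
        moreover have "\<Phi> v = \<Phi> v'" using v unfolding X_def by auto
        ultimately show "v = v'" by (meson inj_onD)
      qed
      then have "card (X \<sigma>) \<le> card (Y \<tau>)" using card_inj_on_le[of f "X \<sigma>" "Y \<tau>"] f finY by auto
      moreover have "card {u \<in> E. \<Phi> u $ i \<le> \<sigma>} + card {u \<in> E. \<Phi> u $ i = \<tau>} \<le> card {u \<in> E. \<Phi> u $ i \<le> \<tau>}"
      proof -
        have "card ({u \<in> E. \<Phi> u $ i \<le> \<sigma>} \<union> {u \<in> E. \<Phi> u $ i = \<tau>}) \<le> card {u \<in> E. \<Phi> u $ i \<le> \<tau>}"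
          using finE \<sigma> by (intro card_mono) auto
        moreover have "card ({u \<in> E. \<Phi> u $ i \<le> \<sigma>} \<union> {u \<in> E. \<Phi> u $ i = \<tau>})
            = card {u \<in> E. \<Phi> u $ i \<le> \<sigma>} + card {u \<in> E. \<Phi> u $ i = \<tau>}"
          using finE \<sigma> by (intro card_Un_disjoint) auto
        ultimately show ?thesis by simp
      qed
      ultimately show ?thesis unfolding q_def cardY by simp
    qed
    then show ?thesis using e(1) by blast
  qed
  have above: "\<exists>e>0. \<forall>\<sigma>. \<tau> < \<sigma> \<and> \<sigma> < \<tau> + e \<longrightarrow> q \<tau> \<le> q \<sigma>" for \<tau>
  proof -
    have op: "open {u. g u > a}" using open_Collect_less[OF continuous_on_const g(1), of a] by simp
    have z: "\<And>z. z \<in> X \<tau> \<Longrightarrow> \<Phi> z = w \<tau> \<and> det (d\<Phi> z) \<noteq> 0" "X \<tau> \<subseteq> {u. g u > a}"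
      using g(2) \<open>a > 0\<close> unfolding X_def by fastforce+
    obtain e where e: "e > 0" "\<And>v. dist v (w \<tau>) < e \<Longrightarrow>
       \<exists>f. inj_on f (X \<tau>) \<and> (\<forall>z\<in>X \<tau>. \<Phi> (f z) = v \<and> f z \<in> {u. g u > a} \<and> dist (f z) z < 1)"
      using zeros_persist[OF C1 finX z(1) op z(2) zero_less_one] by metis
    have "q \<tau> \<le> q \<sigma>" if \<sigma>: "\<tau> < \<sigma>" "\<sigma> < \<tau> + e" for \<sigma>
    proof -
      have "w \<sigma> - w \<tau> = (\<sigma> - \<tau>) *\<^sub>R axis i 1"
        unfolding w_def by (auto simp: vec_eq_iff axis_def)
      then have "dist (w \<sigma>) (w \<tau>) < e" using \<sigma> by (simp add: dist_norm)
      from e(2)[OF this] obtain f where f: "inj_on f (X \<tau>)" "f ` X \<tau> \<subseteq> X \<sigma>"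
        unfolding X_def by auto
      have "card (X \<tau>) \<le> card (X \<sigma>)" using card_inj_on_le[OF f finX] .
      moreover have "card {u \<in> E. \<Phi> u $ i \<le> \<tau>} \<le> card {u \<in> E. \<Phi> u $ i \<le> \<sigma>}"
        using finE \<sigma> by (intro card_mono) auto
      ultimately show ?thesis unfolding q_def by simp
    qed
    then show ?thesis using e(1) by blast
  qed
  have local: "\<exists>e>0. (\<forall>y. x - e < y \<and> y < x \<longrightarrow> q y \<le> q x) \<and> (\<forall>y. x < y \<and> y < x + e \<longrightarrow> q x \<le> q y)" for x
  proof -
    obtain e1 e2 where "e1 > 0" "\<forall>\<sigma>. x - e1 < \<sigma> \<and> \<sigma> < x \<longrightarrow> q \<sigma> \<le> q x"
      "e2 > 0" "\<forall>\<sigma>. x < \<sigma> \<and> \<sigma> < x + e2 \<longrightarrow> q x \<le> q \<sigma>"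
      using below[of x] above[of x] by blast
    then show ?thesis by (intro exI[of _ "min e1 e2"]) auto
  qed
  have "bounded ((\<lambda>u. \<Phi> u $ i) ` \<Gamma>)"
    using \<open>compact \<Gamma>\<close> contk[of i] continuous_on_subset compact_continuous_image compact_imp_bounded by blast
  then obtain B where B: "\<And>u. u \<in> \<Gamma> \<Longrightarrow> \<bar>\<Phi> u $ i\<bar> \<le> B" unfolding bounded_iff by auto
  \<comment> \<open>A value that the row does not take on the compact curve.\<close>
  define s where "s = max (h $ i) (B + 1)"
  have "X s = {}" using B unfolding X_def w_iff s_def by fastforce
  then have "q s \<le> card E" unfolding q_def using finE by (auto intro: card_mono)
  moreover have "q (h $ i) \<le> q s" by (rule locally_nondecreasing[OF local]) (simp add: s_def)
  ultimately have "card (X (h $ i)) \<le> card E" unfolding q_def by simp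
  moreover have "E = {u. (\<forall>k. k \<noteq> i \<longrightarrow> \<Phi> u $ k = h $ k) \<and> g u = a}" unfolding E_def \<Gamma>_def by auto
  ultimately show "card {u. \<Phi> u = h \<and> g u > a} \<le> card {u. (\<forall>k. k \<noteq> i \<longrightarrow> \<Phi> u $ k = h $ k) \<and> g u = a}"
    unfolding X_def wh by simp
  show "finite {u. \<Phi> u = h \<and> g u > a}" using finX[of "h $ i"] unfolding X_def wh .
qed

section \<open>Zeros of polynomial systems\<close>

definition mono_fun :: "('n \<Rightarrow> nat) \<Rightarrow> real^'n \<Rightarrow> real" where
  "mono_fun \<alpha> u = (\<Prod>i\<in>UNIV. (u $ i) ^ \<alpha> i)"

text \<open>Exponents are bounded in each variable separately and not in total, so that there are
  exactly \<open>(D + 1) ^ CARD('n)\<close> of them.\<close>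

definition box_exps :: "nat \<Rightarrow> ('n \<Rightarrow> nat) set" where
  "box_exps D = {\<alpha>. \<forall>i. \<alpha> i \<le> D}"

lemma box_exps_PiE: "box_exps D = (UNIV :: 'n::finite set) \<rightarrow>\<^sub>E {..D}"
  by (auto simp: box_exps_def PiE_def extensional_def Pi_def)

lemma finite_box_exps [simp]: "finite (box_exps D :: ('n::finite \<Rightarrow> nat) set)"
  unfolding box_exps_PiE by (intro finite_PiE) auto

lemma card_box_exps: "card (box_exps D :: ('n::finite \<Rightarrow> nat) set) = (D + 1) ^ CARD('n)"
  unfolding box_exps_PiE by (subst card_PiE) auto

definition in_box_span :: "nat \<Rightarrow> (real^'n \<Rightarrow> real) \<Rightarrow> bool" where
  "in_box_span D f \<longleftrightarrow> (\<exists>c. \<forall>u. f u = (\<Sum>\<alpha>\<in>box_exps D. c \<alpha> * mono_fun \<alpha> u))"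

lemma in_box_span_cmono: "\<alpha> \<in> box_exps D \<Longrightarrow> in_box_span D (\<lambda>u. b * mono_fun \<alpha> u)"
  unfolding in_box_span_def
  by (intro exI[of _ "\<lambda>\<beta>. if \<beta> = \<alpha> then b else 0"] allI)
    (simp add: if_distrib[of "\<lambda>x. x * _"] sum.delta cong: if_cong)

lemma in_box_span_add: "in_box_span D f \<Longrightarrow> in_box_span D g \<Longrightarrow> in_box_span D (\<lambda>u. f u + g u)"
  unfolding in_box_span_def
proof (elim exE)
  fix c d
  assume "\<forall>u. f u = (\<Sum>\<alpha>\<in>box_exps D. c \<alpha> * mono_fun \<alpha> u)"
    "\<forall>u. g u = (\<Sum>\<alpha>\<in>box_exps D. d \<alpha> * mono_fun \<alpha> u)"
  then show "\<exists>c. \<forall>u. f u + g u = (\<Sum>\<alpha>\<in>box_exps D. c \<alpha> * mono_fun \<alpha> u)"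
    by (intro exI[of _ "\<lambda>\<alpha>. c \<alpha> + d \<alpha>"]) (simp add: sum.distrib algebra_simps)
qed

lemma in_box_span_0: "in_box_span D (\<lambda>u. 0)"
  unfolding in_box_span_def by (intro exI[of _ "\<lambda>_. 0"]) simp

lemma in_box_span_sum:
  "(\<And>i. i \<in> I \<Longrightarrow> in_box_span D (f i)) \<Longrightarrow> in_box_span D (\<lambda>u. \<Sum>i\<in>I. f i u)"
  by (induction I rule: infinite_finite_induct) (auto intro: in_box_span_add in_box_span_0)

lemma mono_fun_add: "mono_fun (\<lambda>i. \<alpha> i + \<beta> i) u = mono_fun \<alpha> u * mono_fun \<beta> u"
  unfolding mono_fun_def by (simp add: power_add prod.distrib)

lemma bdpoly_in_box_span:
  assumes "bdpoly coords D f"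
  shows "in_box_span D f"
  using assms
proof (induction rule: bdpoly.induct)
  case (const D c)
  have "in_box_span D (\<lambda>u. c * mono_fun (\<lambda>_. 0) u)"
    by (rule in_box_span_cmono) (simp add: box_exps_def)
  then show ?case by (simp add: mono_fun_def)
next
  case (gen g D)
  then obtain k where g: "g = (\<lambda>u. u $ k)" unfolding coords_def by auto
  have "in_box_span D (\<lambda>u. 1 * mono_fun (\<lambda>i. if i = k then 1 else 0) u)"
    by (rule in_box_span_cmono) (use gen in \<open>simp add: box_exps_def\<close>)
  moreover have "mono_fun (\<lambda>i. if i = k then 1 else 0) u = u $ k" for u :: "real^'a"
  proof -
    have "(u $ i) ^ (if i = k then 1 else 0) = (if i = k then u $ k else 1)" for i by simp
    then show ?thesis unfolding mono_fun_def by simp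
  qed
  ultimately show ?case unfolding g by simp
next
  case (add D f g) then show ?case by (intro in_box_span_add)
next
  case (mult D f E g)
  then obtain c d where c: "\<And>u. f u = (\<Sum>\<alpha>\<in>box_exps D. c \<alpha> * mono_fun \<alpha> u)"
    and d: "\<And>u. g u = (\<Sum>\<alpha>\<in>box_exps E. d \<alpha> * mono_fun \<alpha> u)"
    unfolding in_box_span_def by blast
  have "f u * g u = (\<Sum>\<alpha>\<in>box_exps D. \<Sum>\<beta>\<in>box_exps E. (c \<alpha> * d \<beta>) * mono_fun (\<lambda>i. \<alpha> i + \<beta> i) u)" for u
    unfolding c d sum_product mono_fun_add by (simp add: mult_ac)
  moreover have "in_box_span (D + E)
    (\<lambda>u. \<Sum>\<alpha>\<in>box_exps D. \<Sum>\<beta>\<in>box_exps E. (c \<alpha> * d \<beta>) * mono_fun (\<lambda>i. \<alpha> i + \<beta> i) u)"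
    by (intro in_box_span_sum in_box_span_cmono) (auto simp: box_exps_def intro: add_mono)
  ultimately show ?case by simp
qed

text \<open>Gaussian elimination: one equation \<open>j\<close> is removed together with one unknown
  \<open>i0\<close> that has a nonzero coefficient in it.\<close>

lemma exists_linear_dependency:
  fixes A :: "'i \<Rightarrow> 'j \<Rightarrow> real"
  assumes "finite J" "finite I" "card J < card I"
  shows "\<exists>c. (\<exists>i\<in>I. c i \<noteq> 0) \<and> (\<forall>j\<in>J. (\<Sum>i\<in>I. c i * A i j) = 0)"
  using assms
proof (induction J arbitrary: I A rule: finite_induct)
  case empty
  then obtain i where "i \<in> I" by fastforce
  then show ?case by (intro exI[of _ "\<lambda>_. 1"]) auto
next
  case (insert j J)
  show ?case
  proof (cases "\<forall>i\<in>I. A i j = 0")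
    case True
    from insert have "card J < card I" by simp
    from insert.IH[OF \<open>finite I\<close> this, of A] obtain c
      where "\<exists>i\<in>I. c i \<noteq> 0" "\<forall>j\<in>J. (\<Sum>i\<in>I. c i * A i j) = 0" by blast
    then show ?thesis using True by (intro exI[of _ c]) auto
  next
    case False
    then obtain i0 where i0: "i0 \<in> I" "A i0 j \<noteq> 0" by blast
    define I' where "I' = I - {i0}"
    define A' where "A' i k = A i k - A i j / A i0 j * A i0 k" for i k
    have I': "finite I'" "card J < card I'" "i0 \<notin> I'" "I = insert i0 I'"
      using insert i0 unfolding I'_def by auto
    obtain c where c: "\<exists>i\<in>I'. c i \<noteq> 0" "\<forall>k\<in>J. (\<Sum>i\<in>I'. c i * A' i k) = 0"
      using insert.IH[OF I'(1,2), of A'] by blast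
    define s where "s = (\<Sum>i\<in>I'. c i * A i j)"
    define c' where "c' = c(i0 := - s / A i0 j)"
    have c'I: "(\<Sum>i\<in>I. c' i * A i k) = (\<Sum>i\<in>I'. c i * A i k) - s / A i0 j * A i0 k" for k
    proof -
      have "(\<Sum>i\<in>I'. c' i * A i k) = (\<Sum>i\<in>I'. c i * A i k)"
        using I'(3) unfolding c'_def by (intro sum.cong) auto
      then show ?thesis unfolding I'(4) using I'(1,3) by (simp add: c'_def)
    qed
    have "(\<Sum>i\<in>I. c' i * A i k) = 0" if "k \<in> insert j J" for k
    proof (cases "k = j")
      case True then show ?thesis unfolding c'I s_def[symmetric] using i0 by (simp add: s_def)
    next
      case False
      then have "(\<Sum>i\<in>I'. c i * A' i k) = 0" using c that by auto
      moreover have "(\<Sum>i\<in>I'. c i * A' i k) = (\<Sum>i\<in>I'. c i * A i k) - s / A i0 j * A i0 k"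
        unfolding A'_def s_def sum_divide_distrib sum_distrib_right sum_subtractf[symmetric]
        by (intro sum.cong) (auto simp: algebra_simps)
      ultimately show ?thesis unfolding c'I by simp
    qed
    moreover have "\<exists>i\<in>I. c' i \<noteq> 0" using c(1) I'(3,4) unfolding c'_def by auto
    ultimately show ?thesis by blast
  qed
qed

lemma mono_fun_upd:
  "mono_fun \<alpha> (\<chi> i. if i = k then t else v $ i) = t ^ \<alpha> k * mono_fun (\<alpha>(k := 0)) v"
  unfolding mono_fun_def
  by (subst (1 2) prod.remove[of UNIV k]) (auto intro!: prod.cong)

text \<open>Induction on the set \<open>V\<close> of variables that occur. Sorted by powers of one
  variable \<open>k\<close>, the polynomial has a coefficient polynomial that is nonzero at some
  small \<open>v\<close> by induction; the value of \<open>k\<close> then only has to avoid the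
  finitely many roots of a univariate polynomial.\<close>

lemma nonzero_near_0:
  fixes c :: "('n::finite \<Rightarrow> nat) \<Rightarrow> real"
  assumes "finite S" "\<alpha>0 \<in> S" "c \<alpha>0 \<noteq> 0" "\<epsilon> > 0"
  shows "\<exists>v::real^'n. (\<forall>i. \<bar>v $ i\<bar> < \<epsilon>) \<and> (\<Sum>\<alpha>\<in>S. c \<alpha> * mono_fun \<alpha> v) \<noteq> 0"
proof -
  have "\<exists>v::real^'n. (\<forall>i. \<bar>v $ i\<bar> < \<epsilon>) \<and> (\<Sum>\<alpha>\<in>S. c \<alpha> * mono_fun \<alpha> v) \<noteq> 0"
    if "finite V" "finite S" "\<forall>\<alpha>\<in>S. \<forall>i. i \<notin> V \<longrightarrow> \<alpha> i = 0" "\<alpha>0 \<in> S" "c \<alpha>0 \<noteq> 0"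
    for V S and c :: "('n \<Rightarrow> nat) \<Rightarrow> real" and \<alpha>0
    using that
  proof (induction V arbitrary: S c \<alpha>0 rule: finite_induct)
    case empty
    then have "S \<subseteq> {\<lambda>_. 0}" by auto
    then have "S = {\<alpha>0}" using empty.prems(3) by blast
    then show ?case using empty assms(4) by (intro exI[of _ 0]) (auto simp: mono_fun_def)
  next
    case (insert k V)
    define n0 where "n0 = \<alpha>0 k"
    define S' where "S' = {\<alpha> \<in> S. \<alpha> k = n0}"
    define c' where "c' \<beta> = c (\<beta>(k := n0))" for \<beta>
    have S'0: "\<forall>\<alpha>\<in>(\<lambda>\<alpha>. \<alpha>(k := 0)) ` S'. \<forall>i. i \<notin> V \<longrightarrow> \<alpha> i = 0"
    proof (intro ballI allI impI)
      fix \<beta> i assume "\<beta> \<in> (\<lambda>\<alpha>. \<alpha>(k := 0)) ` S'" "i \<notin> V"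
      then obtain \<alpha> where "\<alpha> \<in> S" "\<beta> = \<alpha>(k := 0)" unfolding S'_def by blast
      then show "\<beta> i = 0" using insert.prems(2) \<open>i \<notin> V\<close> by (cases "i = k") simp_all
    qed
    have inj: "inj_on (\<lambda>\<alpha>. \<alpha>(k := 0)) S'"
      by (rule inj_on_inverseI[of _ "\<lambda>\<beta>. \<beta>(k := n0)"]) (auto simp: S'_def)
    have fin': "finite ((\<lambda>\<alpha>. \<alpha>(k := 0)) ` S')"
      by (intro finite_imageI finite_subset[OF _ insert.prems(1)]) (auto simp: S'_def)
    have in': "\<alpha>0(k := 0) \<in> (\<lambda>\<alpha>. \<alpha>(k := 0)) ` S'"
      by (rule imageI) (simp add: S'_def n0_def insert.prems(3))
    have nz': "c' (\<alpha>0(k := 0)) \<noteq> 0" using insert.prems(4) by (simp add: c'_def n0_def)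
    obtain v :: "real^'n" where v: "\<And>i. \<bar>v $ i\<bar> < \<epsilon>"
      "(\<Sum>\<alpha>\<in>(\<lambda>\<alpha>. \<alpha>(k := 0)) ` S'. c' \<alpha> * mono_fun \<alpha> v) \<noteq> 0"
      using insert.IH[where c = c', OF fin' S'0 in' nz'] by blast
    define d where "d n = (\<Sum>\<alpha>\<in>{\<alpha>\<in>S. \<alpha> k = n}. c \<alpha> * mono_fun (\<alpha>(k := 0)) v)" for n
    have "(\<Sum>\<alpha>\<in>(\<lambda>\<alpha>. \<alpha>(k := 0)) ` S'. c' \<alpha> * mono_fun \<alpha> v) = d n0"
      unfolding sum.reindex[OF inj] d_def S'_def[symmetric]
      by (intro sum.cong) (auto simp: c'_def S'_def)
    then have dn0: "d n0 \<noteq> 0" using v(2) by simp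
    define N where "N = Max ((\<lambda>\<alpha>. \<alpha> k) ` S)"
    have N: "\<alpha> k \<le> N" if "\<alpha> \<in> S" for \<alpha> unfolding N_def using that insert.prems(1) by auto
    have "finite {t. (\<Sum>n\<le>N. d n * t ^ n) = 0}"
      using dn0 N insert.prems(3) n0_def polyfun_rootbound[of N d] by blast
    moreover have "infinite {0<..<\<epsilon>}" using assms(4) by simp
    ultimately obtain t where t: "t \<in> {0<..<\<epsilon>}" "(\<Sum>n\<le>N. d n * t ^ n) \<noteq> 0"
      by (metis (mono_tags, lifting) finite_subset mem_Collect_eq subsetI)
    have "(\<Sum>\<alpha>\<in>S. c \<alpha> * mono_fun \<alpha> (\<chi> i. if i = k then t else v $ i))
      = (\<Sum>\<alpha>\<in>S. t ^ \<alpha> k * (c \<alpha> * mono_fun (\<alpha>(k := 0)) v))"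
      unfolding mono_fun_upd by (simp add: mult_ac)
    also have "\<dots> = (\<Sum>n\<le>N. \<Sum>\<alpha>\<in>{\<alpha>\<in>S. \<alpha> k = n}. t ^ \<alpha> k * (c \<alpha> * mono_fun (\<alpha>(k := 0)) v))"
      using insert.prems(1) N by (intro sum.group[symmetric]) auto
    also have "\<dots> = (\<Sum>n\<le>N. d n * t ^ n)"
      unfolding d_def sum_distrib_right by (intro sum.cong) (auto simp: mult_ac)
    finally show ?case using t v(1) by (intro exI[of _ "\<chi> i. if i = k then t else v $ i"]) auto
  qed
  from this[of UNIV S \<alpha>0 c] show ?thesis using assms by auto
qed

lemma card_coordinate_bound:
  fixes Z :: "(real^'n) set"
  assumes "finite Z" "\<And>k. card ((\<lambda>z. z $ k) ` Z) \<le> b"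
  shows "card Z \<le> b ^ CARD('n)"
proof -
  have "card Z \<le> card (\<Pi>\<^sub>E k\<in>UNIV. (\<lambda>z. z $ k) ` Z)"
  proof (rule card_inj_on_le[where f = "\<lambda>z k. z $ k"])
    show "inj_on (\<lambda>z k. z $ k) Z" by (rule inj_onI) (metis vec_nth_inverse)
    show "(\<lambda>z k. z $ k) ` Z \<subseteq> (\<Pi>\<^sub>E k\<in>UNIV. (\<lambda>z. z $ k) ` Z)" by auto
    show "finite (\<Pi>\<^sub>E k\<in>UNIV. (\<lambda>z. z $ k) ` Z)" using assms(1) by (simp add: finite_PiE)
  qed
  also have "\<dots> = (\<Prod>k\<in>UNIV. card ((\<lambda>z. z $ k) ` Z))" by (simp add: card_PiE)
  also have "\<dots> \<le> (\<Prod>k\<in>(UNIV::'n set). b)" using assms(2) by (intro prod_mono) auto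
  finally show ?thesis by simp
qed

text \<open>A Bezout-type bound by counting dimensions. The products of powers up to
  \<open>b\<close> of the rows of \<open>\<Phi>\<close> and of a single coordinate
  \<open>u $ k\<close> outnumber the monomials that they are made of, hence satisfy a linear
  relation: \<open>u $ k\<close> is a root of a polynomial of degree at most \<open>b\<close> whose
  coefficients are polynomials in \<open>\<Phi> u\<close>. These coefficients may all vanish at
  \<open>\<Phi> u = 0\<close>, so the zeros are first moved to a nearby value \<open>v\<close> at
  which one of them does not.\<close>

lemma polynomial_zero_bound:
  fixes \<Phi> :: "real^'n \<Rightarrow> real^'n"
  assumes C1: "C1_map \<Phi> d\<Phi>" and poly: "\<And>i. bdpoly coords D (\<lambda>u. \<Phi> u $ i)"
    and fin: "finite Z" and Z: "\<And>z. z \<in> Z \<Longrightarrow> \<Phi> z = 0 \<and> det (d\<Phi> z) \<noteq> 0"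
  shows "card Z \<le> ((CARD('n) * D + 1) ^ CARD('n)) ^ CARD('n)"
proof (rule card_coordinate_bound[OF fin])
  fix k :: 'n
  let ?n = "CARD('n)"
  define b where "b = (?n * D + 1) ^ ?n"
  define I where "I = (box_exps b :: ('n \<Rightarrow> nat) set) \<times> {..b}"
  define F where "F = (\<lambda>(\<alpha>, \<beta>) u. mono_fun \<alpha> (\<Phi> u) * (u $ k) ^ \<beta>)"
  have "in_box_span (?n * (b * D) + b) (F i)" if "i \<in> I" for i
  proof -
    obtain \<alpha> \<beta> where i0: "i = (\<alpha>, \<beta>)" by (cases i)
    then have "\<And>j. \<alpha> j \<le> b" "\<beta> \<le> b" using that unfolding I_def box_exps_def by auto
    note i = i0 this
    have "bdpoly coords (b * D) (\<lambda>u. (\<Phi> u $ j) ^ \<alpha> j)" for j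
      using bdpoly_mono[OF bdpoly_power[OF poly[of j], of "\<alpha> j"]] i(2)[of j] by simp
    then have "bdpoly coords (?n * (b * D)) (\<lambda>u. mono_fun \<alpha> (\<Phi> u))"
      unfolding mono_fun_def by (intro bdpoly_prod)
    moreover have "bdpoly coords (\<beta> * 1) (\<lambda>u. (u $ k) ^ \<beta>)"
      by (intro bdpoly_power bdpoly.gen) (auto simp: coords_def)
    ultimately have "bdpoly coords (?n * (b * D) + b) (\<lambda>u. mono_fun \<alpha> (\<Phi> u) * (u $ k) ^ \<beta>)"
      using i(3) by (intro bdpoly_mult_le) auto
    then show ?thesis unfolding i(1) F_def by (simp add: bdpoly_in_box_span)
  qed
  then obtain A where A: "\<And>i u. i \<in> I \<Longrightarrow> F i u = (\<Sum>\<gamma>\<in>box_exps (?n * (b * D) + b). A i \<gamma> * mono_fun \<gamma> u)"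
    unfolding in_box_span_def by metis
  \<comment> \<open>The choice of \<open>b\<close> pays off here: at most
    \<open>b * (b + 1) ^ ?n\<close> monomials stand against \<open>(b + 1) ^ (?n + 1)\<close>
    products.\<close>
  have "card (box_exps (?n * (b * D) + b) :: ('n \<Rightarrow> nat) set) \<le> ((?n * D + 1) * (b + 1)) ^ ?n"
    unfolding card_box_exps by (rule power_mono) (auto simp: algebra_simps)
  also have "\<dots> = b * (b + 1) ^ ?n" unfolding b_def by (simp only: power_mult_distrib)
  also have "\<dots> < (b + 1) ^ ?n * (b + 1)" by simp
  also have "\<dots> = card I" unfolding I_def by (simp add: card_cartesian_product card_box_exps)
  finally obtain c where c: "\<exists>i\<in>I. c i \<noteq> 0"
    "\<forall>\<gamma>\<in>box_exps (?n * (b * D) + b). (\<Sum>i\<in>I. c i * A i \<gamma>) = 0"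
    using exists_linear_dependency[of "box_exps (?n * (b * D) + b) :: ('n \<Rightarrow> nat) set" I A]
    unfolding I_def by auto
  have rel: "(\<Sum>i\<in>I. c i * F i u) = 0" for u
  proof -
    have "(\<Sum>i\<in>I. c i * F i u) = (\<Sum>i\<in>I. \<Sum>\<gamma>\<in>box_exps (?n * (b * D) + b). c i * A i \<gamma> * mono_fun \<gamma> u)"
      using A by (intro sum.cong) (auto simp: sum_distrib_left mult_ac)
    also have "\<dots> = (\<Sum>\<gamma>\<in>box_exps (?n * (b * D) + b). (\<Sum>i\<in>I. c i * A i \<gamma>) * mono_fun \<gamma> u)"
      unfolding sum_distrib_right by (rule sum.swap)
    finally show ?thesis using c(2) by simp
  qed
  define q where "q v \<beta> = (\<Sum>\<alpha>\<in>box_exps b. c (\<alpha>, \<beta>) * mono_fun \<alpha> v)" for v :: "real^'n" and \<beta>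
  have rel': "(\<Sum>\<beta>\<le>b. q (\<Phi> u) \<beta> * (u $ k) ^ \<beta>) = 0" for u
  proof -
    have "(\<Sum>i\<in>I. c i * F i u) = (\<Sum>\<alpha>\<in>box_exps b. \<Sum>\<beta>\<le>b. c (\<alpha>, \<beta>) * F (\<alpha>, \<beta>) u)"
      unfolding I_def by (subst sum.cartesian_product) (auto intro: sum.cong)
    also have "\<dots> = (\<Sum>\<beta>\<le>b. \<Sum>\<alpha>\<in>box_exps b. c (\<alpha>, \<beta>) * F (\<alpha>, \<beta>) u)" by (rule sum.swap)
    also have "\<dots> = (\<Sum>\<beta>\<le>b. q (\<Phi> u) \<beta> * (u $ k) ^ \<beta>)"
      unfolding q_def F_def sum_distrib_right by (simp add: mult.assoc)
    finally show ?thesis using rel by simp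
  qed
  obtain \<alpha>0 \<beta>0 where ab: "\<alpha>0 \<in> box_exps b" "\<beta>0 \<le> b" "c (\<alpha>0, \<beta>0) \<noteq> 0"
    using c(1) unfolding I_def by auto
  obtain Z' where Z': "Z' \<subseteq> Z" "inj_on (\<lambda>z. z $ k) Z'" "(\<lambda>z. z $ k) ` Z = (\<lambda>z. z $ k) ` Z'"
    using subset_image_inj[of "(\<lambda>z. z $ k) ` Z" "\<lambda>z. z $ k" Z] by auto
  have finZ': "finite Z'" using Z' fin finite_subset by blast
  \<comment> \<open>A lower bound for the gaps between the different \<open>k\<close>-th
    coordinates, with 1 for the case of no pairs; moving each zero by less than
    \<open>dd / 2\<close> keeps these coordinates distinct.\<close>
  define dd where "dd = Min (insert 1 ((\<lambda>(z, z'). \<bar>z $ k - z' $ k\<bar>) ` {(z, z') \<in> Z' \<times> Z'. z \<noteq> z'}))"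
  have fin2: "finite {(z, z') \<in> Z' \<times> Z'. z \<noteq> z'}"
    using finZ' by (auto intro: finite_subset[of _ "Z' \<times> Z'"])
  have dd0: "dd > 0" unfolding dd_def using fin2 Z'(2) by (subst Min_gr_iff) (auto dest: inj_onD)
  have dd: "dd \<le> \<bar>z $ k - z' $ k\<bar>" if "z \<in> Z'" "z' \<in> Z'" "z \<noteq> z'" for z z'
    unfolding dd_def by (rule Min_le) (use fin2 that in \<open>auto intro!: image_eqI[of _ _ "(z, z')"]\<close>)
  obtain \<epsilon> where \<epsilon>: "\<epsilon> > 0" "\<And>v. dist v 0 < \<epsilon> \<Longrightarrow>
      \<exists>f. inj_on f Z' \<and> (\<forall>z\<in>Z'. \<Phi> (f z) = v \<and> f z \<in> UNIV \<and> dist (f z) z < dd / 2)"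
    by (rule zeros_persist[OF C1 finZ', of 0 UNIV "dd / 2"]) (use Z Z'(1) dd0 in auto)
  obtain v :: "real^'n" where v: "\<And>i. \<bar>v $ i\<bar> < \<epsilon> / ?n" "q v \<beta>0 \<noteq> 0"
    using nonzero_near_0[of "box_exps b" \<alpha>0 "\<lambda>\<alpha>. c (\<alpha>, \<beta>0)" "\<epsilon> / ?n"] ab \<epsilon>(1)
    unfolding q_def by auto
  have "norm v < \<epsilon>"
  proof -
    have "norm v \<le> (\<Sum>i\<in>UNIV. \<bar>v $ i\<bar>)" by (rule norm_le_l1_cart)
    also have "\<dots> < (\<Sum>i\<in>(UNIV::'n set). \<epsilon> / ?n)" using v(1) by (intro sum_strict_mono) auto
    finally show ?thesis by simp
  qed
  then obtain f where f: "\<And>z. z \<in> Z' \<Longrightarrow> \<Phi> (f z) = v \<and> dist (f z) z < dd / 2"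
    using \<epsilon>(2)[of v] by auto
  have inj: "inj_on (\<lambda>z. f z $ k) Z'"
  proof (rule inj_onI, rule ccontr)
    fix z z' assume z: "z \<in> Z'" "z' \<in> Z'" "f z $ k = f z' $ k" "z \<noteq> z'"
    have "\<bar>f z $ k - z $ k\<bar> < dd / 2" "\<bar>f z' $ k - z' $ k\<bar> < dd / 2"
      using f[OF z(1)] f[OF z(2)] dist_vec_nth_le[of "f z" k z] dist_vec_nth_le[of "f z'" k z']
      by (auto simp: dist_real_def)
    then show False using dd[OF z(1,2,4)] z(3) by linarith
  qed
  have roots: "finite {t. (\<Sum>\<beta>\<le>b. q v \<beta> * t ^ \<beta>) = 0}" "card {t. (\<Sum>\<beta>\<le>b. q v \<beta> * t ^ \<beta>) = 0} \<le> b"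
    using ab(2) v(2) polyfun_rootbound[of b "q v"] by blast+
  have "card Z' \<le> card {t. (\<Sum>\<beta>\<le>b. q v \<beta> * t ^ \<beta>) = 0}"
  proof (rule card_inj_on_le[where f = "\<lambda>z. f z $ k"])
    show "inj_on (\<lambda>z. f z $ k) Z'" by (rule inj)
    show "(\<lambda>z. f z $ k) ` Z' \<subseteq> {t. (\<Sum>\<beta>\<le>b. q v \<beta> * t ^ \<beta>) = 0}"
    proof
      fix t assume "t \<in> (\<lambda>z. f z $ k) ` Z'"
      then obtain z where "z \<in> Z'" "t = f z $ k" by blast
      then show "t \<in> {t. (\<Sum>\<beta>\<le>b. q v \<beta> * t ^ \<beta>) = 0}" using rel'[of "f z"] f by auto
    qed
  qed (rule roots(1))
  also have "\<dots> \<le> b" by (rule roots(2))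
  finally show "card ((\<lambda>z. z $ k) ` Z) \<le> (?n * D + 1) ^ ?n"
    unfolding Z'(3) card_image[OF Z'(2)] b_def .
qed

section \<open>Zeros of exponential-polynomial systems\<close>

lemma has_grad_unique:
  assumes "has_grad f df" "has_grad f dg"
  shows "df x = dg x"
proof -
  have "(\<lambda>h. df x \<bullet> h) = (\<lambda>h. dg x \<bullet> h)"
    using assms has_derivative_unique unfolding has_grad_def by blast
  then show ?thesis by (metis vector_eq_rdot inner_commute)
qed

lemma C1_mapI:
  fixes \<Phi> :: "real^'n \<Rightarrow> real^'n"
  assumes "\<And>k. \<exists>df. (\<forall>j. continuous_on UNIV (\<lambda>x. df x $ j)) \<and> has_grad (\<lambda>x. \<Phi> x $ k) df"
  shows "\<exists>d\<Phi>. C1_map \<Phi> d\<Phi>"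
proof -
  obtain df where df: "\<And>k j. continuous_on UNIV (\<lambda>x. df k x $ j)" "\<And>k. has_grad (\<lambda>x. \<Phi> x $ k) (df k)"
    using assms by metis
  have "continuous_on UNIV (df k)" for k
  proof -
    have "continuous_on UNIV (\<lambda>x. \<chi> j. df k x $ j)"
      using df(1) by (intro continuous_on_vec_lambda)
    then show ?thesis by simp
  qed
  then have "continuous_on UNIV (\<lambda>x. \<chi> k. df k x)" by (intro continuous_on_vec_lambda)
  moreover have "has_grad (\<lambda>x. \<Phi> x $ k) (\<lambda>x. (\<chi> k. df k x) $ k)" for k using df(2) by simp
  ultimately show ?thesis
    unfolding C1_map_def by (intro exI[of _ "\<lambda>x. \<chi> k. df k x"] conjI allI)
qed

lemma bdpoly_coords_C1:
  assumes "bdpoly coords D f"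
  shows "\<exists>df. (\<forall>j. bdpoly coords D (\<lambda>x. df x $ j)) \<and> (\<forall>j. continuous_on UNIV (\<lambda>x. df x $ j)) \<and> has_grad f df"
  using bdpoly_grad[OF assms grad_coords] bdpoly_coords_continuous by metis

lemma bdpoly_expcoords_C1:
  assumes "bdpoly expcoords D f"
  shows "\<exists>df. (\<forall>j. bdpoly expcoords D (\<lambda>x. df x $ j)) \<and> (\<forall>j. continuous_on UNIV (\<lambda>x. df x $ j)) \<and> has_grad f df"
  using bdpoly_grad[OF assms grad_expcoords] bdpoly_expcoords_continuous by metis

text \<open>Sard's theorem in equal dimensions, the source of the sort \<open>wellorder\<close> on
  the index types.\<close>

lemma negligible_critical_values:
  fixes \<Phi> :: "real^'m::{finite,wellorder} \<Rightarrow> real^'m::{finite,wellorder}"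
  assumes "C1_map \<Phi> d\<Phi>"
  shows "negligible (\<Phi> ` {u. det (d\<Phi> u) = 0})"
proof (rule baby_Sard[where f' = "\<lambda>u h. d\<Phi> u *v h"])
  show "(\<Phi> has_derivative (\<lambda>h. d\<Phi> u *v h)) (at u within {u. det (d\<Phi> u) = 0})" for u
    using C1_map_has_derivative[OF assms] has_derivative_at_withinI by blast
  show "rank (matrix (\<lambda>h. d\<Phi> u *v h)) < CARD('m)" if "u \<in> {u. det (d\<Phi> u) = 0}" for u
    using that by (simp add: det_eq_0_rank)
qed simp

lemma exists_not_negligible:
  assumes "open W" "W \<noteq> {}" "negligible (B :: 'a::euclidean_space set)"
  shows "\<exists>v\<in>W. v \<notin> B"
  using assms by (meson negligible_subset open_not_negligible subsetI)

lemma finite_card_bound: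
  assumes "\<And>F. finite F \<Longrightarrow> F \<subseteq> S \<Longrightarrow> card F \<le> N"
  shows "finite S \<and> card S \<le> N"
proof -
  have "finite S"
  proof (rule ccontr)
    assume "infinite S"
    then obtain F where "finite F" "card F = Suc N" "F \<subseteq> S"
      using infinite_arbitrarily_large by blast
    then show False using assms[of F] by simp
  qed
  then show ?thesis using assms by blast
qed

text \<open>The class of systems within which the elimination of exponentials takes place. A row in
  \<open>I\<close> fixes the ratio of \<open>u $ b\<close> and \<open>exp (u $ a)\<close>. Row
  \<open>c\<close> is a sphere that is kept through all steps in order to make the curves bounded.
  The constants \<open>r\<close> and \<open>\<tau>\<close> are existentially quantified, so that
  rows may be translated and the zero bounds do not depend on them.\<close>

definition mixed_system ::
  "nat \<Rightarrow> 'm set \<Rightarrow> 'm \<Rightarrow> (real^'m \<Rightarrow> real^'m) \<Rightarrow> bool" where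
  "mixed_system D I c \<Phi> \<longleftrightarrow> c \<notin> I \<and> (\<exists>r. \<forall>u. \<Phi> u $ c = u \<bullet> u - r) \<and>
     (\<forall>i. i \<notin> I \<longrightarrow> bdpoly coords D (\<lambda>u. \<Phi> u $ i)) \<and>
     (\<forall>i\<in>I. \<exists>a b \<tau>. \<forall>u. \<Phi> u $ i = u $ b * exp (- (u $ a)) - \<tau>)"

lemma mixed_systemD:
  assumes "mixed_system D I c \<Phi>"
  shows "c \<notin> I" "\<exists>r. \<forall>u. \<Phi> u $ c = u \<bullet> u - r"
    "i \<notin> I \<Longrightarrow> bdpoly coords D (\<lambda>u. \<Phi> u $ i)"
    "i \<in> I \<Longrightarrow> \<exists>a b \<tau>. \<forall>u. \<Phi> u $ i = u $ b * exp (- (u $ a)) - \<tau>"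
  using assms unfolding mixed_system_def by simp_all

lemma mixed_systemI:
  assumes "c \<notin> I" "\<And>u. \<Phi> u $ c = u \<bullet> u - r"
    "\<And>i. i \<notin> I \<Longrightarrow> bdpoly coords D (\<lambda>u. \<Phi> u $ i)"
    "\<And>i. i \<in> I \<Longrightarrow> \<exists>a b \<tau>. \<forall>u. \<Phi> u $ i = u $ b * exp (- (u $ a)) - \<tau>"
  shows "mixed_system D I c \<Phi>"
  using assms unfolding mixed_system_def by auto

lemma has_grad_exp_row:
  "has_grad (\<lambda>u. u $ b * exp (- (u $ a)) - \<tau>)
     (\<lambda>u. exp (- (u $ a)) *\<^sub>R (axis b 1 - (u $ b) *\<^sub>R axis a 1))"
  unfolding has_grad_def
  by (auto intro!: derivative_eq_intros bounded_linear_imp_has_derivative bounded_linear_vec_nth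
      simp: inner_diff_left inner_axis' algebra_simps)

lemma mixed_system_C1:
  fixes \<Phi> :: "real^'m \<Rightarrow> real^'m"
  assumes "mixed_system D I c \<Phi>"
  shows "\<exists>d\<Phi>. C1_map \<Phi> d\<Phi>"
proof (rule C1_mapI)
  fix k
  show "\<exists>df. (\<forall>j. continuous_on UNIV (\<lambda>x. df x $ j)) \<and> has_grad (\<lambda>x. \<Phi> x $ k) df"
  proof (cases "k \<in> I")
    case True
    then obtain a b \<tau> where ab: "\<And>u. \<Phi> u $ k = u $ b * exp (- (u $ a)) - \<tau>"
      using mixed_systemD(4)[OF assms] by blast
    have "continuous_on UNIV (\<lambda>u. (exp (- (u $ a)) *\<^sub>R (axis b 1 - (u $ b) *\<^sub>R axis a 1 :: real^'m)) $ j)" for j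
      by (auto intro!: continuous_intros)
    then show ?thesis
      unfolding ab
      by (intro exI[of _ "\<lambda>u. exp (- (u $ a)) *\<^sub>R (axis b 1 - (u $ b) *\<^sub>R axis a 1)"] conjI allI)
        (auto intro: has_grad_exp_row)
  next
    case False
    then have "bdpoly coords D (\<lambda>u. \<Phi> u $ k)" by (rule mixed_systemD(3)[OF assms])
    from bdpoly_coords_C1[OF this] show ?thesis by (elim exE conjE, intro exI conjI)
  qed
qed

text \<open>The gradient of an exponential row is a positive multiple of a polynomial vector, so up to a
  positive factor the Jacobian determinant is a polynomial.\<close>

lemma mixed_system_jacobian:
  fixes \<Phi> :: "real^'m \<Rightarrow> real^'m"
  assumes ms: "mixed_system D I c \<Phi>" and C1: "C1_map \<Phi> d\<Phi>"
  obtains J where "bdpoly coords (CARD('m) * Suc D) J" "\<And>u. J u \<noteq> 0 \<longleftrightarrow> det (d\<Phi> u) \<noteq> 0"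
proof -
  have grad: "has_grad (\<lambda>u. \<Phi> u $ k) (\<lambda>u. d\<Phi> u $ k)" for k using C1 unfolding C1_map_def by blast
  have "\<exists>s p. (\<forall>u. s u > 0) \<and> (\<forall>j. bdpoly coords (Suc D) (\<lambda>u. p u $ j)) \<and> (\<forall>u. d\<Phi> u $ k = s u *s p u)" for k
  proof (cases "k \<in> I")
    case True
    then obtain a b \<tau> where ab: "\<And>u. \<Phi> u $ k = u $ b * exp (- (u $ a)) - \<tau>"
      using mixed_systemD(4)[OF ms] by blast
    have "d\<Phi> u $ k = exp (- (u $ a)) *s (axis b 1 - (u $ b) *\<^sub>R axis a 1)" for u
      using has_grad_unique[OF grad[of k, unfolded ab] has_grad_exp_row] by (simp add: scalar_mult_eq_scaleR)
    moreover have "bdpoly coords (Suc D) (\<lambda>u. (axis b 1 - (u $ b) *\<^sub>R axis a 1 :: real^'m) $ j)" for j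
    proof -
      have "bdpoly coords (Suc D) (\<lambda>u::real^'m. axis b 1 $ j - u $ b * axis a 1 $ j)"
        by (intro bdpoly_diff bdpoly_mult_le[where D = 1 and E = 0] bdpoly.const bdpoly.gen)
          (auto simp: coords_def)
      then show ?thesis by simp
    qed
    ultimately show ?thesis
      by (intro exI[of _ "\<lambda>u. exp (- (u $ a))"] exI[of _ "\<lambda>u. axis b 1 - (u $ b) *\<^sub>R axis a 1"]) simp
  next
    case False
    then have "bdpoly coords D (\<lambda>u. \<Phi> u $ k)" by (rule mixed_systemD(3)[OF ms])
    from bdpoly_coords_C1[OF this] obtain df
      where df: "\<forall>j. bdpoly coords D (\<lambda>x. df x $ j)" "has_grad (\<lambda>u. \<Phi> u $ k) df"
      by (elim exE conjE)
    have "d\<Phi> u $ k = df u" for u using has_grad_unique[OF grad df(2)] .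
    then show ?thesis
      by (intro exI[of _ "\<lambda>u. 1"] exI[of _ df]) (auto intro: bdpoly_mono[OF df(1)[rule_format]])
  qed
  then obtain s p where s: "\<And>k u. s k u > 0" and p: "\<And>k j. bdpoly coords (Suc D) (\<lambda>u. p k u $ j)"
    and sp: "\<And>k u. d\<Phi> u $ k = s k u *s p k u" by metis
  have "det (d\<Phi> u) = (\<Prod>k\<in>UNIV. s k u) * det (\<chi> k. p k u)" for u
  proof -
    have "d\<Phi> u = (\<chi> k. s k u *s p k u)" by (simp add: vec_eq_iff[of "d\<Phi> u"] sp)
    then show ?thesis by (simp add: det_rows_mul)
  qed
  moreover have "(\<Prod>k\<in>UNIV. s k u) \<noteq> 0" for u using s by (simp add: less_imp_neq[symmetric])
  moreover have "bdpoly coords (CARD('m) * Suc D) (\<lambda>u. det (\<chi> k. p k u))"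
    by (rule bdpoly_det) (use p in simp)
  ultimately show ?thesis by (intro that[of "\<lambda>u. det (\<chi> k. p k u)"]) auto
qed

text \<open>The shift by \<open>v\<close> is absorbed by the constants of the sphere, of the
  exponential rows and of the polynomials, so one elimination step stays within the class.\<close>

lemma mixed_system_shift:
  fixes \<Phi> :: "real^'m \<Rightarrow> real^'m"
  assumes ms: "mixed_system D I c \<Phi>" and "i \<in> I" and J: "bdpoly coords E J" and "D \<le> E"
  shows "mixed_system E (I - {i}) c (\<lambda>u. (\<chi> k. if k = i then J u else \<Phi> u $ k) - v)"
proof -
  have "c \<noteq> i" using mixed_systemD(1)[OF ms] \<open>i \<in> I\<close> by auto
  moreover obtain r where "\<And>u. \<Phi> u $ c = u \<bullet> u - r" using mixed_systemD(2)[OF ms] by blast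
  ultimately have "((\<chi> k. if k = i then J u else \<Phi> u $ k) - v) $ c = u \<bullet> u - (r + v $ c)" for u by simp
  moreover have "bdpoly coords E (\<lambda>u. ((\<chi> k. if k = i then J u else \<Phi> u $ k) - v) $ k)"
    if "k \<notin> I - {i}" for k
  proof (cases "k = i")
    case True then show ?thesis using J by (simp add: bdpoly_diff bdpoly.const)
  next
    case False
    then have "k \<notin> I" using that by blast
    then have "bdpoly coords D (\<lambda>u. \<Phi> u $ k)" by (rule mixed_systemD(3)[OF ms])
    then have "bdpoly coords E (\<lambda>u. \<Phi> u $ k)" using bdpoly_mono \<open>D \<le> E\<close> by blast
    then show ?thesis using False by (simp add: bdpoly_diff bdpoly.const)
  qed
  moreover have "\<exists>a b \<tau>. \<forall>u. ((\<chi> k. if k = i then J u else \<Phi> u $ k) - v) $ k = u $ b * exp (- (u $ a)) - \<tau>"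
    if k: "k \<in> I - {i}" for k
  proof -
    have "k \<in> I" using k by blast
    from mixed_systemD(4)[OF ms this] obtain a b \<tau> where "\<And>u. \<Phi> u $ k = u $ b * exp (- (u $ a)) - \<tau>"
      by blast
    then show ?thesis using k by (intro exI[of _ a] exI[of _ b] exI[of _ "\<tau> + v $ k"]) simp
  qed
  moreover have "c \<notin> I - {i}" using mixed_systemD(1)[OF ms] by blast
  ultimately show ?thesis by (intro mixed_systemI)
qed

text \<open>Induction on the number of exponential rows. After a move to a nearby value
  \<open>h\<close>, the solutions with \<open>J > 0\<close> and those with \<open>J < 0\<close> are
  bounded by the numbers of solutions of the systems with row \<open>i\<close> replaced by
  \<open>J\<close> and by \<open>- J\<close>, which have one exponential row less. So each step
  doubles the bound and raises the degree to \<open>CARD('m) * Suc D\<close>.\<close>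

lemma mixed_system_zero_bound:
  "\<exists>N. \<forall>I c (\<Phi> :: real^'m::{finite,wellorder} \<Rightarrow> real^'m::{finite,wellorder}) d\<Phi> Z.
     card I = n \<longrightarrow> mixed_system D I c \<Phi> \<longrightarrow> C1_map \<Phi> d\<Phi> \<longrightarrow> finite Z \<longrightarrow>
     (\<forall>z\<in>Z. \<Phi> z = 0 \<and> det (d\<Phi> z) \<noteq> 0) \<longrightarrow> card Z \<le> N"
proof (induction n arbitrary: D)
  case 0
  show ?case
  proof (intro exI[of _ "((CARD('m) * D + 1) ^ CARD('m)) ^ CARD('m)"] allI impI)
    fix I :: "'m::{finite,wellorder} set" and c and \<Phi> :: "real^'m::{finite,wellorder} \<Rightarrow> real^'m::{finite,wellorder}" and d\<Phi> Z
    assume "card I = 0" "mixed_system D I c \<Phi>" and a: "C1_map \<Phi> d\<Phi>" "finite Z"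
      "\<forall>z\<in>Z. \<Phi> z = 0 \<and> det (d\<Phi> z) \<noteq> 0"
    then have "bdpoly coords D (\<lambda>u. \<Phi> u $ i)" for i using mixed_systemD(3) by (metis card_0_eq empty_iff finite)
    from polynomial_zero_bound[OF a(1) this a(2)] a(3)
    show "card Z \<le> ((CARD('m) * D + 1) ^ CARD('m)) ^ CARD('m)" by blast
  qed
next
  case (Suc n)
  define E where "E = CARD('m) * Suc D"
  have "D \<le> E" unfolding E_def by (simp add: le_Suc_eq[symmetric] trans_le_add2)
  obtain N where N: "\<And>I c (\<Phi> :: real^'m::{finite,wellorder} \<Rightarrow> real^'m::{finite,wellorder}) d\<Phi> Z. card I = n \<Longrightarrow> mixed_system E I c \<Phi> \<Longrightarrow>
     C1_map \<Phi> d\<Phi> \<Longrightarrow> finite Z \<Longrightarrow> (\<forall>z\<in>Z. \<Phi> z = 0 \<and> det (d\<Phi> z) \<noteq> 0) \<Longrightarrow> card Z \<le> N"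
    using Suc.IH[of E] by metis
  show ?case
  proof (intro exI[of _ "N + N"] allI impI)
    fix I :: "'m::{finite,wellorder} set" and c and \<Phi> :: "real^'m::{finite,wellorder} \<Rightarrow> real^'m::{finite,wellorder}" and d\<Phi> Z
    assume I: "card I = Suc n" and ms: "mixed_system D I c \<Phi>" and C1: "C1_map \<Phi> d\<Phi>" and fin: "finite Z"
      and Z: "\<forall>z\<in>Z. \<Phi> z = 0 \<and> det (d\<Phi> z) \<noteq> 0"
    obtain i where i: "i \<in> I" using I by fastforce
    have cardI: "card (I - {i}) = n" using I i by simp
    have "c \<noteq> i" using mixed_systemD(1)[OF ms] i by auto
    obtain J where J: "bdpoly coords E J" "\<And>u. J u \<noteq> 0 \<longleftrightarrow> det (d\<Phi> u) \<noteq> 0"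
      using mixed_system_jacobian[OF ms C1] unfolding E_def by blast
    have contJ: "continuous_on UNIV J" using J(1) bdpoly_coords_continuous by blast
    define \<Theta> where "\<Theta> \<sigma> u = (\<chi> k. if k = i then \<sigma> * J u else \<Phi> u $ k)" for \<sigma> u
    have ms': "mixed_system E (I - {i}) c (\<lambda>u. \<Theta> \<sigma> u - v)" for \<sigma> v
      unfolding \<Theta>_def by (rule mixed_system_shift[OF ms i bdpoly_cmult[OF J(1)] \<open>D \<le> E\<close>])
    have "\<exists>d\<Theta>. C1_map (\<Theta> \<sigma>) d\<Theta>" for \<sigma> using mixed_system_C1[OF ms'[of \<sigma> 0]] by simp
    then obtain d\<Theta> where d\<Theta>: "\<And>\<sigma>. C1_map (\<Theta> \<sigma>) (d\<Theta> \<sigma>)" by metis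
    have C1v: "C1_map (\<lambda>u. \<Theta> \<sigma> u - v) (d\<Theta> \<sigma>)" for \<sigma> v
    proof -
      have "has_grad (\<lambda>u. f u - t) df" if "has_grad f df" for f t and df :: "real^'m::{finite,wellorder} \<Rightarrow> real^'m::{finite,wellorder}"
        using that unfolding has_grad_def by (auto intro!: derivative_eq_intros)
      then show ?thesis using d\<Theta>[of \<sigma>] unfolding C1_map_def by simp
    qed
    \<comment> \<open>Half of the smallest \<open>\<bar>J\<bar>\<close> on \<open>Z\<close>, or 1/2
      if that is smaller. A level of \<open>J\<close> or \<open>- J\<close> chosen below it leaves
      all perturbed zeros on the side that is counted.\<close>
    define \<eta> where "\<eta> = Min (insert 1 ((\<lambda>z. \<bar>J z\<bar>) ` Z)) / 2"
    have \<eta>: "\<eta> > 0" "\<And>z. z \<in> Z \<Longrightarrow> \<bar>J z\<bar> > \<eta>"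
    proof -
      have M: "Min (insert 1 ((\<lambda>z. \<bar>J z\<bar>) ` Z)) > 0" using fin Z J(2) by (subst Min_gr_iff) auto
      then show "\<eta> > 0" unfolding \<eta>_def by simp
      fix z assume "z \<in> Z"
      then have "Min (insert 1 ((\<lambda>z. \<bar>J z\<bar>) ` Z)) \<le> \<bar>J z\<bar>" using fin by (intro Min_le) auto
      then show "\<bar>J z\<bar> > \<eta>" unfolding \<eta>_def using M by linarith
    qed
    have ZW: "Z \<subseteq> {u. \<eta> < \<bar>J u\<bar>}" using \<eta>(2) by blast
    have opW: "open {u. \<eta> < \<bar>J u\<bar>}"
      using open_Collect_less[OF continuous_on_const continuous_on_rabs[OF contJ], of \<eta>] by simp
    obtain \<epsilon> where \<epsilon>: "\<epsilon> > 0" "\<And>v. dist v 0 < \<epsilon> \<Longrightarrow>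
       \<exists>f. inj_on f Z \<and> (\<forall>z\<in>Z. \<Phi> (f z) = v \<and> f z \<in> {u. \<eta> < \<bar>J u\<bar>} \<and> dist (f z) z < 1)"
      using zeros_persist[OF C1 fin bspec[OF Z] opW ZW zero_less_one] by metis
    define W where "W = ball 0 (min \<epsilon> \<eta>) \<inter> {v::real^'m::{finite,wellorder}. 0 < v $ i}"
    have "open W" unfolding W_def
      by (intro open_Int open_ball open_Collect_less continuous_on_const continuous_on_component continuous_on_id)
    moreover have "axis i (min \<epsilon> \<eta> / 2) \<in> W"
    proof -
      have "norm (axis i t :: real^'m::{finite,wellorder}) = \<bar>t\<bar>" for t
        by (simp add: norm_eq_sqrt_inner inner_axis_axis flip: power2_eq_square)
      then show ?thesis unfolding W_def using \<epsilon>(1) \<eta>(1) by (simp add: min_def)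
    qed
    then have "W \<noteq> {}" by blast
    moreover have "negligible (\<Theta> 1 ` {u. det (d\<Theta> 1 u) = 0} \<union> \<Theta> (-1) ` {u. det (d\<Theta> (-1) u) = 0})"
      by (intro negligible_Un negligible_critical_values d\<Theta>)
    \<comment> \<open>A common regular value of both eliminated systems: its coordinate
      \<open>i\<close> is the level for \<open>J\<close> and \<open>- J\<close>, the others perturb
      the remaining rows.\<close>
    ultimately obtain v where v: "v \<in> W"
      "v \<notin> \<Theta> 1 ` {u. det (d\<Theta> 1 u) = 0} \<union> \<Theta> (-1) ` {u. det (d\<Theta> (-1) u) = 0}"
      using exists_not_negligible by blast
    have vpos: "v $ i > 0" "norm v < \<epsilon>" "norm v < \<eta>" using v(1) unfolding W_def by auto
    have "\<bar>v $ i\<bar> \<le> norm v" by (rule component_le_norm_cart)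
    then have vi: "v $ i < \<eta>" using vpos by linarith
    define h where "h = (\<chi> k. if k = i then 0 else v $ k)"
    have "norm h \<le> norm v" unfolding h_def
      by (rule norm_le_componentwise_cart) auto
    then obtain f where f: "inj_on f Z" "\<And>z. z \<in> Z \<Longrightarrow> \<Phi> (f z) = h \<and> \<bar>J (f z)\<bar> > \<eta>"
      using \<epsilon>(2)[of h] vpos(2) by auto
    have bound: "finite {u. \<Phi> u = h \<and> \<sigma> * J u > v $ i} \<and> card {u. \<Phi> u = h \<and> \<sigma> * J u > v $ i} \<le> N"
      if \<sigma>: "\<sigma> = 1 \<or> \<sigma> = -1" for \<sigma>
    proof -
      have S: "{u. (\<forall>k. k \<noteq> i \<longrightarrow> \<Phi> u $ k = h $ k) \<and> \<sigma> * J u = v $ i} = {u. \<Theta> \<sigma> u - v = 0}"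
        unfolding \<Theta>_def h_def by (auto simp: vec_eq_iff)
      have "finite {u. \<Theta> \<sigma> u - v = 0} \<and> card {u. \<Theta> \<sigma> u - v = 0} \<le> N"
      proof (rule finite_card_bound)
        fix F assume F: "finite F" "F \<subseteq> {u. \<Theta> \<sigma> u - v = 0}"
        have "\<forall>z\<in>F. \<Theta> \<sigma> z - v = 0 \<and> det (d\<Theta> \<sigma> z) \<noteq> 0"
          using F(2) v(2) \<sigma> by (auto simp: image_iff)
        then show "card F \<le> N" using N[OF cardI ms' C1v F(1)] by blast
      qed
      note fc = this[folded S]
      obtain r where r: "\<And>u. \<Phi> u $ c = u \<bullet> u - r" using mixed_systemD(2)[OF ms] by blast
      \<comment> \<open>The sphere row is among the rows that define the curve, as
        \<open>c \<noteq> i\<close>.\<close>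
      have bdd: "bounded {u. \<forall>k. k \<noteq> i \<longrightarrow> \<Phi> u $ k = h $ k}"
      proof (rule boundedI)
        fix u assume "u \<in> {u. \<forall>k. k \<noteq> i \<longrightarrow> \<Phi> u $ k = h $ k}"
        then have "u \<bullet> u = r + h $ c" using r[of u] \<open>c \<noteq> i\<close> by auto
        then show "norm u \<le> sqrt (r + h $ c)" by (simp add: norm_eq_sqrt_inner)
      qed
      have "continuous_on UNIV (\<lambda>u. \<sigma> * J u)" using contJ by (intro continuous_on_mult_left)
      moreover have "\<sigma> * J u > 0 \<Longrightarrow> det (d\<Phi> u) \<noteq> 0" for u using J(2)[of u] by auto
      ultimately have "finite {u. \<Phi> u = h \<and> \<sigma> * J u > v $ i}"
        "card {u. \<Phi> u = h \<and> \<sigma> * J u > v $ i} \<le> card {u. (\<forall>k. k \<noteq> i \<longrightarrow> \<Phi> u $ k = h $ k) \<and> \<sigma> * J u = v $ i}"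
        using Khovanskii_Rolle[OF C1 _ _ bdd vpos(1) conjunct1[OF fc]] by blast+
      then show ?thesis using fc by linarith
    qed
    have "f ` Z \<subseteq> {u. \<Phi> u = h \<and> 1 * J u > v $ i} \<union> {u. \<Phi> u = h \<and> (-1) * J u > v $ i}"
      using f(2) vi by fastforce
    then have "card (f ` Z) \<le> card ({u. \<Phi> u = h \<and> 1 * J u > v $ i} \<union> {u. \<Phi> u = h \<and> (-1) * J u > v $ i})"
      using bound[of 1] bound[of "-1"] by (intro card_mono) blast+
    also have "\<dots> \<le> card {u. \<Phi> u = h \<and> 1 * J u > v $ i} + card {u. \<Phi> u = h \<and> (-1) * J u > v $ i}"
      by (rule card_Un_le)
    also have "\<dots> \<le> N + N" using bound[of 1] bound[of "-1"] by (intro add_mono) blast+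
    finally show "card Z \<le> N + N" using card_image[OF f(1)] by simp
  qed
qed

lemma det_nz_if_ker_trivial:
  fixes A :: "real^'m^'m"
  assumes "\<And>h. (\<And>k. A $ k \<bullet> h = 0) \<Longrightarrow> h = 0"
  shows "det A \<noteq> 0"
proof -
  have "\<forall>h. A *v h = 0 \<longrightarrow> h = 0"
    using assms by (simp add: vec_eq_iff[of "A *v _"] matrix_vector_mul_component)
  then have "\<exists>B. B ** A = mat 1" by (simp add: matrix_left_invertible_ker)
  then show ?thesis using invertible_det_nz invertible_left_inverse by blast
qed

lemma ker_trivial_if_det_nz:
  fixes A :: "real^'m^'m"
  assumes "det A \<noteq> 0" "\<And>k. A $ k \<bullet> h = 0"
  shows "h = 0"
proof -
  have "A *v h = 0" using assms(2) by (simp add: vec_eq_iff matrix_vector_mul_component)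
  then show ?thesis
    using assms(1) invertible_det_nz invertible_left_inverse matrix_left_invertible_ker by blast
qed

lemma has_grad_has_real_derivative:
  assumes "has_grad f df" "(\<gamma> has_vector_derivative h) (at t)"
  shows "((\<lambda>s. f (\<gamma> s)) has_real_derivative (df (\<gamma> t) \<bullet> h)) (at t)"
proof -
  have "(f has_derivative (\<lambda>h. df (\<gamma> t) \<bullet> h)) (at (\<gamma> t))" using assms(1) unfolding has_grad_def by blast
  from has_derivative_compose[OF assms(2)[unfolded has_vector_derivative_def] this]
  have "((\<lambda>s. f (\<gamma> s)) has_derivative (\<lambda>x. df (\<gamma> t) \<bullet> (x *\<^sub>R h))) (at t)" .
  then show ?thesis unfolding has_field_derivative_def by (simp add: mult_commute_abs)
qed

lemma has_vector_derivative_vecI: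
  assumes "\<And>k. ((\<lambda>t. \<gamma> t $ k) has_real_derivative h $ k) (at t)"
  shows "(\<gamma> has_vector_derivative h) (at t)"
  unfolding has_vector_derivative_def
proof (rule has_derivative_componentwise_within[THEN iffD2], rule ballI)
  fix b :: "real^'a" assume "b \<in> Basis"
  then obtain k where b: "b = axis k 1" by (auto simp: Basis_vec_def)
  show "((\<lambda>t. \<gamma> t \<bullet> b) has_derivative (\<lambda>x. x *\<^sub>R h \<bullet> b)) (at t)"
    using assms[of k] unfolding has_field_derivative_def b by (simp add: inner_axis mult_commute_abs)
qed

lemma bdpoly_inner_self: "bdpoly coords 2 (\<lambda>u. u \<bullet> u)"
proof -
  have "bdpoly coords (1 + 1) (\<lambda>u. u $ k * u $ k)" for k
    by (rule bdpoly.mult; rule bdpoly.gen) (auto simp: coords_def)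
  then have "bdpoly coords 2 (\<lambda>u. u $ k * u $ k)" for k by (simp only: one_add_one)
  then have "bdpoly coords 2 (\<lambda>u. \<Sum>k\<in>UNIV. u $ k * u $ k)" by (rule bdpoly_sum)
  then show ?thesis by (simp add: inner_vec_def)
qed

text \<open>Every \<open>x $ i\<close> and every \<open>exp (x $ i)\<close> becomes a coordinate,
  the two being tied together by a row \<open>u $ b * exp (- (u $ a)) - 1\<close>, and one slack
  coordinate puts the point on a sphere; hence \<open>2 * CARD('n) + 1\<close> variables. The radius
  depends on \<open>Z\<close>, which is harmless because the bound for mixed systems is independent
  of it.\<close>

theorem exp_polynomial_zero_bound:
  assumes card: "CARD('m::{finite,wellorder}) = 2 * CARD('n) + 1"
  shows "\<exists>N. \<forall>(\<Psi> :: real^'n \<Rightarrow> real^'n) d\<Psi> Z. C1_map \<Psi> d\<Psi> \<longrightarrow>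
     (\<forall>i. bdpoly expcoords D (\<lambda>x. \<Psi> x $ i)) \<longrightarrow> finite Z \<longrightarrow>
     (\<forall>z\<in>Z. \<Psi> z = 0 \<and> det (d\<Psi> z) \<noteq> 0) \<longrightarrow> card Z \<le> N"
proof -
  have "card (UNIV :: ('n + 'n + unit) set) = card (UNIV :: 'm set)" using card by simp
  then obtain \<phi> :: "'n + 'n + unit \<Rightarrow> 'm" where \<phi>: "bij \<phi>"
    using finite_same_card_bij[of "UNIV :: ('n + 'n + unit) set" "UNIV :: 'm set"] by auto
  define a b c where "a i = \<phi> (Inl i)" and "b i = \<phi> (Inr (Inl i))" and "c = \<phi> (Inr (Inr ()))" for i
  have cover: "(\<exists>i. k = a i) \<or> (\<exists>i. k = b i) \<or> k = c" for k
  proof -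
    obtain s where "k = \<phi> s" using \<phi> by (metis bij_pointE)
    then show ?thesis unfolding a_def b_def c_def by (cases s rule: sum.exhaust) (auto, metis old.unit.exhaust sum.exhaust)
  qed
  have inj: "\<phi> s = \<phi> s' \<longleftrightarrow> s = s'" for s s' using \<phi> by (simp add: bij_def inj_eq)
  have ab [simp]: "a i = a j \<longleftrightarrow> i = j" "b i = b j \<longleftrightarrow> i = j" "a i \<noteq> b j" "b j \<noteq> a i" "a i \<noteq> c" "b i \<noteq> c"
     "c \<noteq> a i" "c \<noteq> b i" for i j
    unfolding a_def b_def c_def inj by auto
  define mk where "mk f g w = (\<chi> k. case inv \<phi> k of Inl i \<Rightarrow> f i | Inr (Inl i) \<Rightarrow> g i | Inr (Inr _) \<Rightarrow> w)"
    for f g and w :: real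
  have mk [simp]: "mk f g w $ a i = f i" "mk f g w $ b i = g i" "mk f g w $ c = w" for f g w i
    unfolding mk_def a_def b_def c_def using \<phi> by (simp_all add: bij_def)
  have UNIV_eq: "UNIV = range a \<union> (range b \<union> {c})" using cover by blast
  have sumU: "(\<Sum>k\<in>UNIV. F k) = (\<Sum>i\<in>UNIV. F (a i)) + ((\<Sum>i\<in>UNIV. F (b i)) + F c)" for F :: "'m \<Rightarrow> real"
    unfolding UNIV_eq
    by (subst sum.union_disjoint, simp, simp, force, subst sum.union_disjoint)
      (auto simp: sum.reindex inj_on_def)
  obtain N where N: "\<And>I c (\<Phi> :: real^'m::{finite,wellorder} \<Rightarrow> real^'m::{finite,wellorder}) d\<Phi> Z. card I = CARD('n) \<Longrightarrow>
     mixed_system (D + 2) I c \<Phi> \<Longrightarrow> C1_map \<Phi> d\<Phi> \<Longrightarrow> finite Z \<Longrightarrow>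
     \<forall>z\<in>Z. \<Phi> z = 0 \<and> det (d\<Phi> z) \<noteq> 0 \<Longrightarrow> card Z \<le> N"
    using mixed_system_zero_bound[where n = "CARD('n)" and D = "D + 2" and 'm = 'm] by metis
  show ?thesis
  proof (intro exI[of _ N] allI impI)
    fix \<Psi> :: "real^'n \<Rightarrow> real^'n" and d\<Psi> Z
    assume C1: "C1_map \<Psi> d\<Psi>" and pol: "\<forall>i. bdpoly expcoords D (\<lambda>x. \<Psi> x $ i)" and fin: "finite Z"
      and Z: "\<forall>z\<in>Z. \<Psi> z = 0 \<and> det (d\<Psi> z) \<noteq> 0"
    define R where "R x u \<longleftrightarrow> (\<forall>i. u $ a i = x $ i \<and> u $ b i = exp (x $ i))" for x :: "real^'n" and u
    have "\<exists>p. bdpoly coords D p \<and> (\<forall>x u. R x u \<longrightarrow> \<Psi> x $ i = p u)" for i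
    proof (rule bdpoly_factor)
      show "bdpoly expcoords D (\<lambda>x. \<Psi> x $ i)" using pol by blast
      fix g :: "real^'n \<Rightarrow> real" assume "g \<in> expcoords"
      then consider j where "g = (\<lambda>x. x $ j)" | j where "g = (\<lambda>x. exp (x $ j))"
        unfolding expcoords_def coords_def by blast
      then show "\<exists>p. bdpoly coords 1 p \<and> (\<forall>x u. R x u \<longrightarrow> g x = p u)"
      proof cases
        case 1 then show ?thesis
          by (intro exI[of _ "\<lambda>u. u $ a j"]) (auto simp: R_def coords_def intro: bdpoly.gen)
      next
        case 2 then show ?thesis
          by (intro exI[of _ "\<lambda>u. u $ b j"]) (auto simp: R_def coords_def intro: bdpoly.gen)
      qed
    qed
    then obtain p where p: "\<And>i. bdpoly coords D (p i)" "\<And>i x u. R x u \<Longrightarrow> \<Psi> x $ i = p i u" by metis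
    define S where "S x = (\<Sum>i\<in>UNIV. (x $ i)\<^sup>2) + (\<Sum>i\<in>UNIV. (exp (x $ i))\<^sup>2)" for x :: "real^'n"
    \<comment> \<open>Larger than \<open>S\<close> on all of \<open>Z\<close>, so the slack
      coordinate \<open>sqrt (r - S x)\<close> is positive; this also makes the lifted zeros
      nondegenerate in the slack direction.\<close>
    define r where "r = (\<Sum>x\<in>Z. S x) + 1"
    have r: "S x < r" if "x \<in> Z" for x
    proof -
      have "S x \<le> (\<Sum>x\<in>Z. S x)" using that fin by (intro member_le_sum) (auto simp: S_def sum_nonneg)
      then show ?thesis unfolding r_def by simp
    qed
    define \<Phi> where "\<Phi> u = mk (\<lambda>i. p i u) (\<lambda>i. u $ b i * exp (- (u $ a i)) - 1) (u \<bullet> u - r)" for u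
    have \<Phi>a: "\<Phi> u $ a i = p i u" and \<Phi>b: "\<Phi> u $ b i = u $ b i * exp (- (u $ a i)) - 1"
      and \<Phi>c: "\<Phi> u $ c = u \<bullet> u - r" for u i
      unfolding \<Phi>_def by (rule mk)+
    have ms: "mixed_system (D + 2) (range b) c \<Phi>"
    proof (rule mixed_systemI)
      show "c \<notin> range b" by auto
      show "\<Phi> u $ c = u \<bullet> u - r" for u by (rule \<Phi>c)
      show "bdpoly coords (D + 2) (\<lambda>u. \<Phi> u $ k)" if kb: "k \<notin> range b" for k
      proof (cases "k = c")
        case True
        have "bdpoly coords (D + 2) (\<lambda>u. u \<bullet> u)" by (rule bdpoly_mono[OF bdpoly_inner_self]) simp
        from bdpoly_diff[OF this bdpoly.const[of _ _ r]] show ?thesis unfolding True \<Phi>c .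
      next
        case False
        then obtain i where "k = a i" using cover[of k] kb by auto
        then show ?thesis using bdpoly_mono[OF p(1)[of i], of "D + 2"] by (simp only: \<Phi>a le_add1)
      qed
      show "\<exists>a b \<tau>. \<forall>u. \<Phi> u $ k = u $ b * exp (- (u $ a)) - \<tau>" if kb: "k \<in> range b" for k
      proof -
        obtain i where i: "k = b i" using kb by blast
        show ?thesis unfolding i \<Phi>b by blast
      qed
    qed
    obtain d\<Phi> where C1\<Phi>: "C1_map \<Phi> d\<Phi>" using mixed_system_C1[OF ms] by blast
    have grad: "has_grad (\<lambda>u. \<Phi> u $ k) (\<lambda>u. d\<Phi> u $ k)" for k using C1\<Phi> unfolding C1_map_def by blast
    have grad\<Psi>: "has_grad (\<lambda>x. \<Psi> x $ k) (\<lambda>x. d\<Psi> x $ k)" for k using C1 unfolding C1_map_def by blast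
    define L where "L x w = mk (\<lambda>i. x $ i) (\<lambda>i. exp (x $ i)) w" for x :: "real^'n" and w
    have RL: "R x (L x w)" for x w unfolding R_def L_def by simp
    have rowa: "\<Phi> (L x w) $ a i = \<Psi> x $ i" for x w i unfolding \<Phi>a using p(2)[OF RL] by simp
    define lift where "lift x = L x (sqrt (r - S x))" for x
    have zero: "\<Phi> (lift x) = 0" if "x \<in> Z" for x
    proof -
      have "\<Phi> (lift x) $ k = 0" for k
      proof -
        consider i where "k = a i" | i where "k = b i" | "k = c" using cover[of k] by auto
        then show ?thesis
        proof cases
          case 1 then show ?thesis using rowa that Z unfolding lift_def by simp
        next
          case 2 then show ?thesis by (simp add: \<Phi>b lift_def L_def exp_minus)
        next
          case 3
          then show ?thesis using r[OF that]
            by (simp add: \<Phi>c lift_def L_def inner_vec_def sumU S_def flip: power2_eq_square)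
        qed
      qed
      then show ?thesis by (simp add: vec_eq_iff)
    qed
    have nondeg: "det (d\<Phi> (lift x)) \<noteq> 0" if x: "x \<in> Z" for x
    proof (rule det_nz_if_ker_trivial)
      fix h assume h: "\<And>k. d\<Phi> (lift x) $ k \<bullet> h = 0"
      define w where "w = sqrt (r - S x)"
      have w: "w > 0" unfolding w_def using r[OF x] by simp
      have lw: "lift x = L x w" unfolding lift_def w_def ..
      define \<xi> where "\<xi> = (\<chi> i. h $ a i)"
      have hb: "h $ b i = exp (x $ i) * h $ a i" for i
      proof -
        have g: "has_grad (\<lambda>u. \<Phi> u $ b i) (\<lambda>u. exp (- (u $ a i)) *\<^sub>R (axis (b i) 1 - (u $ b i) *\<^sub>R axis (a i) 1))"
          unfolding \<Phi>b by (rule has_grad_exp_row)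
        have "d\<Phi> (lift x) $ b i = exp (- (lift x $ a i)) *\<^sub>R (axis (b i) 1 - (lift x $ b i) *\<^sub>R axis (a i) 1)"
          by (rule has_grad_unique[OF grad g])
        then show ?thesis using h[of "b i"] unfolding lw L_def
          by (simp add: inner_diff_left inner_axis')
      qed
      \<comment> \<open>A curve with velocity \<open>h\<close> at 0 along which the rows
        \<open>a i\<close> of \<open>\<Phi>\<close> coincide with the rows of \<open>\<Psi>\<close>.
        The chain rule then carries the vanishing of the derivative over to \<open>\<Psi>\<close>,
        without the derivatives of \<open>p\<close>.\<close>
      define \<gamma> where "\<gamma> t = L (x + t *\<^sub>R \<xi>) (w + t * h $ c)" for t
      have \<gamma>': "(\<gamma> has_vector_derivative h) (at 0)"
      proof (rule has_vector_derivative_vecI)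
        fix k
        consider i where "k = a i" | i where "k = b i" | "k = c" using cover[of k] by auto
        then show "((\<lambda>t. \<gamma> t $ k) has_real_derivative h $ k) (at 0)"
          by cases (auto simp: \<gamma>_def L_def \<xi>_def hb intro!: derivative_eq_intros)
      qed
      have d1: "((\<lambda>t. \<Phi> (\<gamma> t) $ k) has_real_derivative 0) (at 0)" for k
        using has_grad_has_real_derivative[OF grad[of k] \<gamma>'] h[of k] unfolding \<gamma>_def lw by simp
      have "d\<Psi> x $ i \<bullet> \<xi> = 0" for i
      proof -
        have "((\<lambda>t. x + t *\<^sub>R \<xi>) has_vector_derivative \<xi>) (at 0)"
          by (auto intro!: derivative_eq_intros)
        from has_grad_has_real_derivative[OF grad\<Psi>[of i] this]
        have "((\<lambda>t. \<Psi> (x + t *\<^sub>R \<xi>) $ i) has_real_derivative (d\<Psi> x $ i \<bullet> \<xi>)) (at 0)" by simp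
        moreover have "((\<lambda>t. \<Psi> (x + t *\<^sub>R \<xi>) $ i) has_real_derivative 0) (at 0)"
          using d1[of "a i"] unfolding \<gamma>_def rowa .
        ultimately show ?thesis using DERIV_unique by blast
      qed
      then have "\<xi> = 0" using ker_trivial_if_det_nz Z x by blast
      then have ha: "h $ a i = 0" for i unfolding \<xi>_def by (simp add: vec_eq_iff)
      then have hb0: "h $ b i = 0" for i using hb by simp
      have "has_grad (\<lambda>u. \<Phi> u $ c) (\<lambda>u. 2 *\<^sub>R u)"
        unfolding \<Phi>c has_grad_def by (auto intro!: derivative_eq_intros simp: inner_commute)
      from has_grad_unique[OF grad this] have "2 * (lift x \<bullet> h) = 0" using h[of c] by simp
      then have "w * h $ c = 0" unfolding lw L_def inner_vec_def sumU by (simp add: ha hb0)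
      then have "h $ c = 0" using w by simp
      then show "h = 0" using ha hb0 cover by (metis vec_eq_iff zero_index)
    qed
    have injl: "inj_on lift Z"
      by (rule inj_onI) (metis (mono_tags, lifting) RL R_def lift_def vec_eq_iff)
    have "card (range b) = CARD('n)" by (simp add: card_image inj_on_def)
    from N[OF this ms C1\<Phi>, of "lift ` Z"] have "card (lift ` Z) \<le> N" using fin zero nondeg by blast
    then show "card Z \<le> N" using card_image[OF injl] by simp
  qed
qed

section \<open>Generic sublevel sets\<close>

lemma differentiable_if_C1_map: "C1_map \<Phi> d\<Phi> \<Longrightarrow> \<Phi> differentiable_on S"
  by (meson C1_map_has_derivative differentiable_at_imp_differentiable_on differentiable_def)

lemma negligible_image_hyperplane:
  assumes "C1_map (\<Phi> :: real^'n \<Rightarrow> real^'n) d\<Phi>"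
  shows "negligible (\<Phi> ` {x. x $ i = t})"
proof (rule negligible_differentiable_image_negligible)
  show "negligible {x :: real^'n. x $ i = t}"
    using negligible_standard_hyperplane[of "axis i 1 :: real^'n" t] by (simp add: inner_axis axis_in_Basis_iff)
qed (simp_all add: differentiable_if_C1_map[OF assms])

text \<open>Exchanging the zero set of \<open>h\<close> for the sublevel set of a generic coercive perturbation of
  \<open>h\<close>. The fibrewise critical points at the level \<open>v $ i0\<close> are the solutions of
  \<open>\<Psi> p x = v\<close>, where \<open>\<Psi>\<close> does not involve \<open>v\<close>, so Sard's theorem for maps between spaces of
  the same dimension is all that is needed.\<close>

lemma generic_sublevel:
  assumes card: "CARD('m::{finite,wellorder}) = 2 * CARD('n::{finite,wellorder}) + 1"
  shows "\<exists>N. \<forall>(P :: 'p set) (h :: 'p \<Rightarrow> real^'n::{finite,wellorder} \<Rightarrow> real) dh tp. finite P \<longrightarrow>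
    (\<forall>p\<in>P. bdpoly expcoords D (h p)) \<longrightarrow> (\<forall>p\<in>P. \<forall>x. h p x \<ge> 0) \<longrightarrow>
    (\<forall>p\<in>P. \<forall>k. bdpoly expcoords D (dh p k)) \<longrightarrow>
    (\<forall>p\<in>P. \<forall>k x. ((\<lambda>s. h p (x + s *\<^sub>R axis k 1)) has_real_derivative dh p k x) (at 0)) \<longrightarrow>
    (\<exists>\<delta> v. \<forall>p\<in>P. let G = (\<lambda>x. h p x + \<delta> * (\<Sum>k\<in>-{i0}. (x $ k)\<^sup>2) + (\<Sum>k\<in>-{i0}. v $ k * x $ k));
          Z = {x. G x = v $ i0 \<and> (\<forall>k. k \<noteq> i0 \<longrightarrow> dh p k x + 2 * \<delta> * x $ k + v $ k = 0)} in
      ((\<exists>x. x $ i0 = tp p \<and> h p x = 0) \<longleftrightarrow> (\<exists>x. x $ i0 = tp p \<and> G x \<le> v $ i0)) \<and>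
      finite Z \<and> card Z \<le> N \<and> (\<forall>x\<in>Z. x $ i0 \<noteq> tp p) \<and>
      (\<forall>s t. (\<exists>x. x $ i0 = s \<and> G x \<le> v $ i0) \<longrightarrow> \<not> (\<exists>x. x $ i0 = t \<and> G x \<le> v $ i0) \<longrightarrow>
         (\<exists>x\<in>Z. x $ i0 \<in> closed_segment s t)))"
proof -
  obtain N where N: "\<And>(\<Psi> :: real^'n::{finite,wellorder} \<Rightarrow> real^'n::{finite,wellorder}) d\<Psi> Z. C1_map \<Psi> d\<Psi> \<Longrightarrow>
     (\<And>i. bdpoly expcoords (D + 2) (\<lambda>x. \<Psi> x $ i)) \<Longrightarrow> finite Z \<Longrightarrow>
     \<forall>z\<in>Z. \<Psi> z = 0 \<and> det (d\<Psi> z) \<noteq> 0 \<Longrightarrow> card Z \<le> N"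
    using exp_polynomial_zero_bound[OF card, of "D + 2"] by metis
  define q where "q x = (\<Sum>k\<in>-{i0}. (x $ k)\<^sup>2)" for x :: "real^'n::{finite,wellorder}"
  have q0: "q x \<ge> 0" for x unfolding q_def by (simp add: sum_nonneg)
  have contq: "continuous_on S q" for S unfolding q_def by (intro continuous_intros)
  have normq: "(norm x)\<^sup>2 = (x $ i0)\<^sup>2 + q x" for x
    unfolding q_def power2_norm_eq_inner inner_vec_def
    by (subst sum.remove[of UNIV i0]) (auto simp: power2_eq_square Compl_eq_Diff_UNIV)
  show ?thesis
  proof (intro exI[of _ N] allI impI)
    fix P :: "'p set" and h :: "'p \<Rightarrow> real^'n::{finite,wellorder} \<Rightarrow> real" and dh tp
    assume fin: "finite P" and hpol: "\<forall>p\<in>P. bdpoly expcoords D (h p)" and h0: "\<forall>p\<in>P. \<forall>x. h p x \<ge> 0"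
      and dhpol: "\<forall>p\<in>P. \<forall>k. bdpoly expcoords D (dh p k)"
      and dh: "\<forall>p\<in>P. \<forall>k x. ((\<lambda>s. h p (x + s *\<^sub>R axis k 1)) has_real_derivative dh p k x) (at 0)"
    have conth: "continuous_on S (h p)" if "p \<in> P" for p S
      using bdpoly_expcoords_continuous hpol that by blast
    define pos where "pos p \<longleftrightarrow> (\<exists>x. x $ i0 = tp p \<and> h p x = 0)" for p
    have "\<exists>x. pos p \<longrightarrow> x $ i0 = tp p \<and> h p x = 0" for p unfolding pos_def by blast
    then obtain wit where wit: "\<And>p. pos p \<Longrightarrow> wit p $ i0 = tp p \<and> h p (wit p) = 0" by metis
    \<comment> \<open>Bounds \<open>q\<close> at one chosen zero for every \<open>p\<close> whose
      hyperplane contains a zero.\<close>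
    define M where "M = (\<Sum>p\<in>P. q (wit p))"
    have M0: "M \<ge> 0" unfolding M_def by (simp add: sum_nonneg q0)
    have M: "q (wit p) \<le> M" if "p \<in> P" for p
      unfolding M_def using that fin q0 by (intro member_le_sum) auto
    \<comment> \<open>On the compact part \<open>q \<le> M + 1\<close> of a hyperplane without
      zeros, \<open>h p\<close> has a positive minimum.\<close>
    have "\<exists>\<mu>>0. \<not> pos p \<longrightarrow> (\<forall>x. x $ i0 = tp p \<and> q x \<le> M + 1 \<longrightarrow> \<mu> \<le> h p x)" if p: "p \<in> P" for p
    proof (cases "pos p")
      case False
      define C where "C = {x. x $ i0 = tp p} \<inter> {x. q x \<le> M + 1}"
      have "closed C" unfolding C_def
        using contq by (intro closed_Int closed_Collect_eq closed_Collect_le) (auto intro!: continuous_intros)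
      moreover have "bounded C"
      proof (rule boundedI)
        fix x assume "x \<in> C"
        then have "(norm x)\<^sup>2 \<le> (tp p)\<^sup>2 + (M + 1)" unfolding normq C_def by auto
        then show "norm x \<le> sqrt ((tp p)\<^sup>2 + (M + 1))" by (simp add: real_le_rsqrt)
      qed
      ultimately have "compact C" by (simp add: compact_eq_bounded_closed)
      show ?thesis
      proof (cases "C = {}")
        case True then show ?thesis unfolding C_def by (intro exI[of _ 1]) auto
      next
        case ne: False
        obtain x where x: "x \<in> C" "\<And>y. y \<in> C \<Longrightarrow> h p x \<le> h p y"
          using continuous_attains_inf[OF \<open>compact C\<close> ne conth[OF p]] by blast
        have "h p x \<noteq> 0" using False x(1) unfolding pos_def C_def by auto
        then have "h p x > 0" using h0 p by (metis order_le_less)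
        then show ?thesis using x(2) unfolding C_def by (intro exI[of _ "h p x"]) auto
      qed
    qed (auto intro: exI[of _ 1])
    then obtain mu where mu: "\<And>p. p \<in> P \<Longrightarrow> mu p > 0"
      "\<And>p x. p \<in> P \<Longrightarrow> \<not> pos p \<Longrightarrow> x $ i0 = tp p \<Longrightarrow> q x \<le> M + 1 \<Longrightarrow> mu p \<le> h p x"
      by metis
    define \<mu> where "\<mu> = Min (insert 1 (mu ` P))"
    have "\<mu> > 0" unfolding \<mu>_def using fin mu(1) by (subst Min_gr_iff) auto
    moreover have "\<mu> \<le> mu p" if "p \<in> P" for p unfolding \<mu>_def using fin that by (intro Min_le) auto
    ultimately have \<mu>: "\<mu> > 0" "\<And>p. p \<in> P \<Longrightarrow> \<mu> \<le> mu p" by blast+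
    \<comment> \<open>The constants make the level \<open>\<delta> * (M + 1/2)\<close> separate the
      two kinds of \<open>p\<close>: at a chosen zero \<open>G\<close> is at most about
      \<open>\<delta> * M\<close>, whereas on a hyperplane without zeros it is at least about
      \<open>2 * \<delta> * (M + 1)\<close> where \<open>q \<le> M + 1\<close>, and at least about
      \<open>\<delta> * (M + 1)\<close> elsewhere. The factor 4 in \<open>\<kappa>\<close> leaves
      room for the linear term and for the deviation of the level.\<close>
    define \<delta> where "\<delta> = \<mu> / (2 * (M + 1))"
    have \<delta>: "\<delta> > 0" "2 * \<delta> * (M + 1) = \<mu>"
      unfolding \<delta>_def using \<mu>(1) M0 by (auto simp: field_simps)
    define n where "n = real CARD('n)"
    define \<kappa> where "\<kappa> = \<delta> / (4 * (n + M + 2))"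
    have n0: "n \<ge> 0" unfolding n_def by simp
    have \<kappa>: "\<kappa> > 0" "4 * \<kappa> * (n + M + 2) = \<delta>"
      unfolding \<kappa>_def using \<delta>(1) M0 n0 by (auto simp: field_simps)
    have \<kappa>n: "\<kappa> * n \<ge> 0" "\<kappa> * M \<ge> 0" using \<kappa>(1) n0 M0 by auto
    define G0 where "G0 p x = h p x + \<delta> * q x" for p x
    define dG0 where "dG0 p k x = dh p k x + 2 * \<delta> * x $ k" for p k and x :: "real^'n::{finite,wellorder}"
    \<comment> \<open>A kind of Legendre transform: at a fibrewise critical point
      \<open>v $ k = - dG0 p k x\<close>, and substituting this into the linear term leaves
      \<open>v\<close> only as the value of the map.\<close>
    define \<Psi> where "\<Psi> p x = (\<chi> k. if k = i0 then G0 p x - (\<Sum>k\<in>-{i0}. x $ k * dG0 p k x) else - dG0 p k x)" for p x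
    have coordpol: "bdpoly expcoords 1 (\<lambda>x. x $ k)" for k
      by (rule bdpoly.gen) (auto simp: expcoords_def coords_def)
    have qpol: "bdpoly expcoords 2 q"
    proof -
      have "bdpoly expcoords (2 * 1) (\<lambda>x. (x $ k)\<^sup>2)" for k by (rule bdpoly_power[OF coordpol])
      then show ?thesis unfolding q_def by (intro bdpoly_sum) simp
    qed
    have dGpol: "bdpoly expcoords (D + 1) (dG0 p k)" if "p \<in> P" for p k
    proof -
      have "bdpoly expcoords (D + 1) (dh p k)" using bdpoly_mono dhpol that by (metis le_add1)
      moreover have "bdpoly expcoords (D + 1) (\<lambda>x. 2 * \<delta> * x $ k)"
        by (rule bdpoly_cmult[OF bdpoly_mono[OF coordpol]]) simp
      ultimately show ?thesis unfolding dG0_def by (rule bdpoly.add)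
    qed
    have \<Psi>pol: "bdpoly expcoords (D + 2) (\<lambda>x. \<Psi> p x $ k)" if p: "p \<in> P" for p k
    proof (cases "k = i0")
      case True
      have "bdpoly expcoords (D + 2) (h p)" using bdpoly_mono hpol p by (metis le_add1)
      moreover have "bdpoly expcoords (D + 2) (\<lambda>x. \<delta> * q x)"
        by (rule bdpoly_cmult[OF bdpoly_mono[OF qpol]]) simp
      ultimately have "bdpoly expcoords (D + 2) (\<lambda>x. h p x + \<delta> * q x)" by (rule bdpoly.add)
      moreover have "bdpoly expcoords (D + 2) (\<lambda>x. \<Sum>k\<in>-{i0}. x $ k * dG0 p k x)"
        by (rule bdpoly_sum, rule bdpoly_mult_le[OF coordpol dGpol[OF p]]) simp
      ultimately have "bdpoly expcoords (D + 2) (\<lambda>x. h p x + \<delta> * q x - (\<Sum>k\<in>-{i0}. x $ k * dG0 p k x))"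
        by (rule bdpoly_diff)
      then show ?thesis unfolding \<Psi>_def G0_def True by simp
    next
      case False
      have "bdpoly expcoords (D + 2) (\<lambda>x. - dG0 p k x)"
        by (rule bdpoly_mono[OF bdpoly_minus[OF dGpol[OF p]]]) simp
      then show ?thesis unfolding \<Psi>_def using False by simp
    qed
    have "\<exists>d. p \<in> P \<longrightarrow> C1_map (\<Psi> p) d" for p
    proof (cases "p \<in> P")
      case True
      have "\<exists>d. C1_map (\<Psi> p) d"
      proof (rule C1_mapI)
        fix k
        from bdpoly_expcoords_C1[OF \<Psi>pol[OF True, of k]]
        show "\<exists>df. (\<forall>j. continuous_on UNIV (\<lambda>x. df x $ j)) \<and> has_grad (\<lambda>x. \<Psi> p x $ k) df"
          by (elim exE conjE, intro exI conjI)
      qed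
      then show ?thesis by simp
    qed simp
    then obtain d\<Psi> where d\<Psi>: "\<And>p. p \<in> P \<Longrightarrow> C1_map (\<Psi> p) (d\<Psi> p)" by metis
    define \<rho>0 where "\<rho>0 = \<delta> * (M + 1/2)"
    \<comment> \<open>Outside the critical values all critical points are nondegenerate, as the zero
      bound requires; outside the images of the hyperplanes none of them lies over
      \<open>tp p\<close>.\<close>
    define bad where "bad = (\<Union>p\<in>P. \<Psi> p ` {x. det (d\<Psi> p x) = 0} \<union> \<Psi> p ` {x. x $ i0 = tp p})"
    have "negligible bad" unfolding bad_def
    proof (rule negligible_Union)
      show "finite ((\<lambda>p. \<Psi> p ` {x. det (d\<Psi> p x) = 0} \<union> \<Psi> p ` {x. x $ i0 = tp p}) ` P)" using fin by simp
    qed (use negligible_critical_values[OF d\<Psi>] negligible_image_hyperplane[OF d\<Psi>] in auto)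
    moreover have "ball (axis i0 \<rho>0) \<kappa> \<noteq> ({} :: (real^'n::{finite,wellorder}) set)" using \<kappa>(1) by (metis centre_in_ball empty_iff)
    ultimately obtain v where v: "v \<in> ball (axis i0 \<rho>0 :: real^'n::{finite,wellorder}) \<kappa>" "v \<notin> bad"
      using exists_not_negligible[OF open_ball] by blast
    have vk: "\<bar>v $ k\<bar> \<le> \<kappa>" if "k \<noteq> i0" for k
      using v(1) dist_vec_nth_le[of "axis i0 \<rho>0" k v] that by (auto simp: axis_def dist_real_def)
    have vi0: "\<bar>v $ i0 - \<rho>0\<bar> < \<kappa>"
      using v(1) dist_vec_nth_le[of "axis i0 \<rho>0" i0 v] by (auto simp: axis_def dist_real_def)
    define lin where "lin x = (\<Sum>k\<in>-{i0}. v $ k * x $ k)" for x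
    have lin: "\<bar>lin x\<bar> \<le> \<kappa> * (n + q x)" for x
    proof -
      have "\<bar>lin x\<bar> \<le> (\<Sum>k\<in>-{i0}. \<bar>v $ k * x $ k\<bar>)" unfolding lin_def by (rule sum_abs)
      also have "\<dots> \<le> (\<Sum>k\<in>-{i0}. \<kappa> * (1 + (x $ k)\<^sup>2))"
      proof (rule sum_mono)
        fix k assume "k \<in> -{i0}"
        have "2 * \<bar>x $ k\<bar> \<le> 1 + (x $ k)\<^sup>2"
          using zero_le_power2[of "\<bar>x $ k\<bar> - 1"] by (simp add: power2_eq_square algebra_simps)
        then have "\<bar>x $ k\<bar> \<le> 1 + (x $ k)\<^sup>2" by linarith
        then show "\<bar>v $ k * x $ k\<bar> \<le> \<kappa> * (1 + (x $ k)\<^sup>2)"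
          unfolding abs_mult using vk[of k] \<open>k \<in> -{i0}\<close> by (intro mult_mono) auto
      qed
      also have "\<dots> = \<kappa> * (real (card (-{i0})) + q x)"
        unfolding q_def by (simp add: sum_distrib_left[symmetric] sum.distrib)
      also have "\<dots> \<le> \<kappa> * (n + q x)"
        unfolding n_def using \<kappa>(1) by (intro mult_left_mono add_right_mono) (auto intro: card_mono)
      finally show ?thesis .
    qed
    define G where "G p x = h p x + \<delta> * q x + lin x" for p x
    have contG: "continuous_on S (G p)" if "p \<in> P" for p S
      unfolding G_def lin_def using conth[OF that] contq by (intro continuous_intros)
    define Z where "Z p = {x. G p x = v $ i0 \<and> (\<forall>k. k \<noteq> i0 \<longrightarrow> dh p k x + 2 * \<delta> * x $ k + v $ k = 0)}" for p
    have Z\<Psi>: "Z p = {x. \<Psi> p x = v}" for p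
    proof (rule set_eqI)
      fix x
      have Gv: "G p x = v $ i0 \<longleftrightarrow> G0 p x - (\<Sum>k\<in>-{i0}. x $ k * dG0 p k x) = v $ i0"
        if "\<forall>k. k \<noteq> i0 \<longrightarrow> dG0 p k x = - v $ k"
      proof -
        have "(\<Sum>k\<in>-{i0}. x $ k * dG0 p k x) = (\<Sum>k\<in>-{i0}. - (v $ k * x $ k))"
          using that by (intro sum.cong) auto
        also have "\<dots> = - lin x" unfolding lin_def by (simp add: sum_negf)
        finally show ?thesis unfolding G_def G0_def by simp
      qed
      have "dh p k x + 2 * \<delta> * x $ k + v $ k = 0 \<longleftrightarrow> dG0 p k x = - v $ k" for k
        unfolding dG0_def by linarith
      then have "x \<in> Z p \<longleftrightarrow> G p x = v $ i0 \<and> (\<forall>k. k \<noteq> i0 \<longrightarrow> dG0 p k x = - v $ k)"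
        unfolding Z_def by simp
      also have "\<dots> \<longleftrightarrow> G0 p x - (\<Sum>k\<in>-{i0}. x $ k * dG0 p k x) = v $ i0 \<and> (\<forall>k. k \<noteq> i0 \<longrightarrow> dG0 p k x = - v $ k)"
        using Gv by blast
      also have "\<dots> \<longleftrightarrow> (\<forall>k. \<Psi> p x $ k = v $ k)"
      proof -
        have "- dG0 p k x = v $ k \<longleftrightarrow> dG0 p k x = - v $ k" for k by linarith
        then have "(\<forall>k. \<Psi> p x $ k = v $ k) \<longleftrightarrow> (\<forall>k. if k = i0
            then G0 p x - (\<Sum>k\<in>-{i0}. x $ k * dG0 p k x) = v $ i0 else dG0 p k x = - v $ k)"
          unfolding \<Psi>_def by (intro iff_allI) simp
        then show ?thesis unfolding if_bool_eq_conj by blast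
      qed
      finally show "x \<in> Z p \<longleftrightarrow> x \<in> {x. \<Psi> p x = v}" by (simp add: vec_eq_iff)
    qed
    have agree: "pos p \<longleftrightarrow> (\<exists>x. x $ i0 = tp p \<and> G p x \<le> v $ i0)" if p: "p \<in> P" for p
    proof
      assume "pos p"
      have "G p (wit p) = \<delta> * q (wit p) + lin (wit p)" unfolding G_def using wit[OF \<open>pos p\<close>] by simp
      also have "\<dots> \<le> \<delta> * q (wit p) + \<kappa> * (n + q (wit p))" using lin[of "wit p"] by linarith
      also have "\<dots> \<le> \<delta> * M + \<kappa> * (n + M)"
        using M[OF p] \<delta>(1) \<kappa>(1) by (intro add_mono mult_left_mono) auto
      also have "\<dots> \<le> v $ i0"
        using vi0 \<kappa>(2) \<kappa>n \<delta>(1) unfolding \<rho>0_def by (simp add: algebra_simps; linarith)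
      finally show "\<exists>x. x $ i0 = tp p \<and> G p x \<le> v $ i0" using wit[OF \<open>pos p\<close>] by blast
    next
      assume "\<exists>x. x $ i0 = tp p \<and> G p x \<le> v $ i0"
      then obtain x where x: "x $ i0 = tp p" "G p x \<le> v $ i0" by blast
      show "pos p"
      proof (rule ccontr)
        assume np: "\<not> pos p"
        have l: "lin x \<ge> - (\<kappa> * (n + q x))" using lin[of x] by linarith
        show False
        proof (cases "q x \<le> M + 1")
          case True
          have "\<mu> \<le> h p x" using mu(2)[OF p np x(1) True] \<mu>(2)[OF p] by linarith
          moreover have "\<kappa> * q x \<le> \<kappa> * (M + 1)" using True \<kappa>(1) by simp
          moreover have "\<delta> * q x \<ge> 0" using q0 \<delta>(1) by simp
          moreover have "\<delta> * M \<ge> 0" using M0 \<delta>(1) by simp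
          ultimately show False using x(2) l vi0 \<kappa> \<kappa>n \<delta> unfolding G_def \<rho>0_def
            by (simp add: algebra_simps; linarith)
        next
          case False
          have "\<kappa> * 4 * 2 \<le> \<kappa> * (4 * (n + M + 2))"
            using \<kappa>(1) n0 M0 by (simp add: algebra_simps)
          then have "\<kappa> \<le> \<delta>" using \<kappa> by linarith
          then have "(\<delta> - \<kappa>) * (M + 1) \<le> (\<delta> - \<kappa>) * q x" using False by (intro mult_left_mono) auto
          moreover have "h p x \<ge> 0" using h0 p by blast
          ultimately show False using x(2) l vi0 \<kappa> \<kappa>n \<delta>(1) unfolding G_def \<rho>0_def
            by (simp add: algebra_simps; linarith)
        qed
      qed
    qed
    have Zfin: "finite (Z p) \<and> card (Z p) \<le> N" if p: "p \<in> P" for p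
    proof (rule finite_card_bound)
      fix F assume F: "finite F" "F \<subseteq> Z p"
      have "C1_map (\<lambda>x. \<Psi> p x - v) (d\<Psi> p)"
      proof -
        have "has_grad (\<lambda>u. f u - t) df" if "has_grad f df" for f t and df :: "real^'n::{finite,wellorder} \<Rightarrow> real^'n::{finite,wellorder}"
          using that unfolding has_grad_def by (auto intro!: derivative_eq_intros)
        then show ?thesis using d\<Psi>[OF p] unfolding C1_map_def by simp
      qed
      moreover have "bdpoly expcoords (D + 2) (\<lambda>x. (\<Psi> p x - v) $ i)" for i
        using bdpoly_diff[OF \<Psi>pol[OF p, of i] bdpoly.const[of _ _ "v $ i"]] by simp
      moreover have "\<forall>z\<in>F. \<Psi> p z - v = 0 \<and> det (d\<Psi> p z) \<noteq> 0"
        using F(2) v(2) p unfolding Z\<Psi> bad_def by auto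
      ultimately show "card F \<le> N" using N[of "\<lambda>x. \<Psi> p x - v" "d\<Psi> p" F] F(1) by blast
    qed
    have Ztp: "x $ i0 \<noteq> tp p" if "p \<in> P" "x \<in> Z p" for p x
      using that v(2) unfolding Z\<Psi> bad_def by auto
    have coerc: "(\<delta> - \<kappa>) * q x - \<kappa> * n \<le> G p x" if "p \<in> P" for p x
    proof -
      have "h p x \<ge> 0" using h0 that by blast
      then show ?thesis using lin[of x] unfolding G_def by (simp add: algebra_simps; linarith)
    qed
    have \<delta>\<kappa>: "\<delta> - \<kappa> > 0"
    proof -
      have "\<kappa> * 4 * 2 \<le> \<kappa> * (4 * (n + M + 2))" using \<kappa>(1) n0 M0 by (simp add: algebra_simps)
      then show ?thesis using \<kappa> by linarith
    qed
    have cross: "\<exists>x\<in>Z p. x $ i0 \<in> closed_segment s t"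
      if p: "p \<in> P" and s: "\<exists>x. x $ i0 = s \<and> G p x \<le> v $ i0" and t: "\<not> (\<exists>x. x $ i0 = t \<and> G p x \<le> v $ i0)"
      for p s t
    proof -
      \<comment> \<open>Coercivity makes this part of the sublevel set compact. Consider its point
        farthest from \<open>s\<close>: if its slice went below the level, the set would reach
        farther still, so the level is the minimum of the slice and the fibrewise gradient vanishes
        at this point.\<close>
      define C where "C = {x. x $ i0 \<in> closed_segment s t} \<inter> {x. G p x \<le> v $ i0}"
      have "closed {x :: real^'n::{finite,wellorder}. x $ i0 \<in> closed_segment s t}"
        by (intro closed_vimage[of "closed_segment s t" "\<lambda>x. x $ i0", unfolded vimage_def])
          (auto intro!: continuous_intros)
      moreover have "closed {x. G p x \<le> v $ i0}"
        by (rule closed_Collect_le[OF contG[OF p] continuous_on_const])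
      ultimately have "closed C" unfolding C_def by blast
      moreover have "bounded C"
      proof (rule boundedI)
        fix x assume x: "x \<in> C"
        have "\<bar>x $ i0\<bar> \<le> max \<bar>s\<bar> \<bar>t\<bar>"
          using x unfolding C_def closed_segment_eq_real_ivl by (auto split: if_splits)
        then have a: "(x $ i0)\<^sup>2 \<le> (max \<bar>s\<bar> \<bar>t\<bar>)\<^sup>2" by (metis abs_le_square_iff abs_of_nonneg abs_ge_zero max.coboundedI1)
        have "(\<delta> - \<kappa>) * q x \<le> v $ i0 + \<kappa> * n" using x coerc[OF p, of x] unfolding C_def by auto
        then have "q x \<le> (v $ i0 + \<kappa> * n) / (\<delta> - \<kappa>)" using \<delta>\<kappa> by (simp add: field_simps)
        then have "(norm x)\<^sup>2 \<le> (max \<bar>s\<bar> \<bar>t\<bar>)\<^sup>2 + (v $ i0 + \<kappa> * n) / (\<delta> - \<kappa>)" unfolding normq using a by linarith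
        then show "norm x \<le> sqrt ((max \<bar>s\<bar> \<bar>t\<bar>)\<^sup>2 + (v $ i0 + \<kappa> * n) / (\<delta> - \<kappa>))" by (simp add: real_le_rsqrt)
      qed
      ultimately have "compact C" by (simp add: compact_eq_bounded_closed)
      moreover have "C \<noteq> {}" using s unfolding C_def by auto
      moreover have "continuous_on C (\<lambda>x. \<bar>x $ i0 - s\<bar>)" by (intro continuous_intros)
      ultimately obtain y where y: "y \<in> C" "\<And>x. x \<in> C \<Longrightarrow> \<bar>x $ i0 - s\<bar> \<le> \<bar>y $ i0 - s\<bar>"
        using continuous_attains_sup by (metis (no_types, lifting))
      have yt: "y $ i0 \<noteq> t" using t y(1) unfolding C_def by auto
      have yseg: "y $ i0 \<in> closed_segment s t" using y(1) unfolding C_def by auto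
      have "s \<noteq> t" using s t by blast
      define \<sigma> where "\<sigma> = (if s < t then 1 else -1 :: real)"
      have min: "G p x \<ge> v $ i0" if x: "x $ i0 = y $ i0" for x
      proof (rule ccontr)
        assume "\<not> G p x \<ge> v $ i0"
        then have lt: "G p x < v $ i0" by simp
        have "continuous_on UNIV (\<lambda>e. G p (x + e *\<^sub>R axis i0 1))"
          by (rule continuous_on_compose2[OF contG[OF p, of UNIV]]) (auto intro!: continuous_intros)
        then have "isCont (\<lambda>e. G p (x + e *\<^sub>R axis i0 1)) 0" by (simp add: continuous_on_eq_continuous_at)
        then have "((\<lambda>e. G p (x + e *\<^sub>R axis i0 1)) \<longlongrightarrow> G p x) (at 0)"
          unfolding isCont_def by simp
        then have "\<forall>\<^sub>F e in at 0. G p (x + e *\<^sub>R axis i0 1) < v $ i0" using lt by (rule order_tendstoD(2))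
        then obtain d where d: "d > 0" "\<And>e. e \<noteq> 0 \<Longrightarrow> \<bar>e\<bar> < d \<Longrightarrow> G p (x + e *\<^sub>R axis i0 1) < v $ i0"
          unfolding eventually_at by (auto simp: dist_real_def)
        \<comment> \<open>A small step away from \<open>s\<close> that does not leave the
          segment.\<close>
        define e where "e = \<sigma> * min (d / 2) \<bar>t - y $ i0\<bar>"
        have e: "e \<noteq> 0" "\<bar>e\<bar> < d" unfolding e_def \<sigma>_def using d(1) yt by auto
        define x' where "x' = x + e *\<^sub>R axis i0 1"
        have x'0: "x' $ i0 = y $ i0 + e" unfolding x'_def using x by simp
        have "x' $ i0 \<in> closed_segment s t" "\<bar>x' $ i0 - s\<bar> > \<bar>y $ i0 - s\<bar>"
          unfolding x'0 using yseg yt \<open>s \<noteq> t\<close> d(1) unfolding e_def \<sigma>_def closed_segment_eq_real_ivl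
          by (auto split: if_splits simp: min_def abs_if)
        moreover have "G p x' \<le> v $ i0" using d(2)[OF e] unfolding x'_def by simp
        ultimately show False using y(2)[of x'] unfolding C_def by auto
      qed
      have Gy: "G p y = v $ i0" using min[of y] y(1) unfolding C_def by auto
      have "dh p k y + 2 * \<delta> * y $ k + v $ k = 0" if k: "k \<noteq> i0" for k
      proof -
        have 1: "((\<lambda>e. h p (y + e *\<^sub>R axis k 1)) has_real_derivative dh p k y) (at 0)" using dh p by blast
        have 2: "((\<lambda>e. q (y + e *\<^sub>R axis k 1)) has_real_derivative (2 * y $ k)) (at 0)"
        proof -
          have "q (y + e *\<^sub>R axis k 1) = (y $ k + e)\<^sup>2 + (\<Sum>j\<in>-{i0} - {k}. (y $ j)\<^sup>2)" for e
            unfolding q_def by (subst sum.remove[of _ k]) (use k in \<open>auto simp: axis_def intro!: sum.cong\<close>)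
          then show ?thesis by (auto intro!: derivative_eq_intros)
        qed
        have 3: "((\<lambda>e. lin (y + e *\<^sub>R axis k 1)) has_real_derivative v $ k) (at 0)"
        proof -
          have "lin (y + e *\<^sub>R axis k 1) = v $ k * (y $ k + e) + (\<Sum>j\<in>-{i0} - {k}. v $ j * y $ j)" for e
            unfolding lin_def by (subst sum.remove[of _ k]) (use k in \<open>auto simp: axis_def intro!: sum.cong\<close>)
          then show ?thesis by (auto intro!: derivative_eq_intros)
        qed
        have "((\<lambda>e. G p (y + e *\<^sub>R axis k 1)) has_real_derivative (dh p k y + \<delta> * (2 * y $ k) + v $ k)) (at 0)"
          unfolding G_def by (intro DERIV_add DERIV_cmult 1 2 3)
        moreover have "\<forall>e. \<bar>0 - e\<bar> < 1 \<longrightarrow> G p (y + 0 *\<^sub>R axis k 1) \<le> G p (y + e *\<^sub>R axis k 1)"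
          using Gy min k by (simp add: axis_def)
        ultimately have "dh p k y + \<delta> * (2 * y $ k) + v $ k = 0"
          by (intro DERIV_local_min[where d = 1 and x = 0]) auto
        then show ?thesis by (simp add: algebra_simps)
      qed
      then have "y \<in> Z p" unfolding Z_def using Gy by blast
      then show ?thesis using yseg by blast
    qed
    show "\<exists>\<delta> v. \<forall>p\<in>P. let G = (\<lambda>x. h p x + \<delta> * (\<Sum>k\<in>-{i0}. (x $ k)\<^sup>2) + (\<Sum>k\<in>-{i0}. v $ k * x $ k));
          Z = {x. G x = v $ i0 \<and> (\<forall>k. k \<noteq> i0 \<longrightarrow> dh p k x + 2 * \<delta> * x $ k + v $ k = 0)} in
      ((\<exists>x. x $ i0 = tp p \<and> h p x = 0) \<longleftrightarrow> (\<exists>x. x $ i0 = tp p \<and> G x \<le> v $ i0)) \<and>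
      finite Z \<and> card Z \<le> N \<and> (\<forall>x\<in>Z. x $ i0 \<noteq> tp p) \<and>
      (\<forall>s t. (\<exists>x. x $ i0 = s \<and> G x \<le> v $ i0) \<longrightarrow> \<not> (\<exists>x. x $ i0 = t \<and> G x \<le> v $ i0) \<longrightarrow>
         (\<exists>x\<in>Z. x $ i0 \<in> closed_segment s t))"
    proof (rule exI[of _ \<delta>], rule exI[of _ v], rule ballI)
      fix p assume p: "p \<in> P"
      have G_eq: "(\<lambda>x. h p x + \<delta> * (\<Sum>k\<in>-{i0}. (x $ k)\<^sup>2) + (\<Sum>k\<in>-{i0}. v $ k * x $ k)) = G p"
        unfolding G_def q_def lin_def ..
      show "let G = (\<lambda>x. h p x + \<delta> * (\<Sum>k\<in>-{i0}. (x $ k)\<^sup>2) + (\<Sum>k\<in>-{i0}. v $ k * x $ k));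
          Z = {x. G x = v $ i0 \<and> (\<forall>k. k \<noteq> i0 \<longrightarrow> dh p k x + 2 * \<delta> * x $ k + v $ k = 0)} in
      ((\<exists>x. x $ i0 = tp p \<and> h p x = 0) \<longleftrightarrow> (\<exists>x. x $ i0 = tp p \<and> G x \<le> v $ i0)) \<and>
      finite Z \<and> card Z \<le> N \<and> (\<forall>x\<in>Z. x $ i0 \<noteq> tp p) \<and>
      (\<forall>s t. (\<exists>x. x $ i0 = s \<and> G x \<le> v $ i0) \<longrightarrow> \<not> (\<exists>x. x $ i0 = t \<and> G x \<le> v $ i0) \<longrightarrow>
         (\<exists>x\<in>Z. x $ i0 \<in> closed_segment s t))"
        unfolding G_eq Let_def Z_def[symmetric] pos_def[symmetric]
        using agree[OF p] Zfin[OF p] Ztp[OF p] cross[OF p] by blast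
    qed
  qed
qed

section \<open>Fibres of existential sets\<close>

definition nvars :: "nat \<Rightarrow> ((nat \<Rightarrow> real) \<Rightarrow> real) set" where
  "nvars K = (\<lambda>i z. z i) ` {..<K} \<union> (\<lambda>i z. exp (z i)) ` {..<K}"

text \<open>Points are sequences, so that the number \<open>K\<close> of variables can grow without
  a change of type; membership depends only on the first \<open>j\<close> coordinates. The
  coefficients of \<open>F\<close> are arbitrary reals and only \<open>K\<close> and
  \<open>D\<close> are recorded, which allows bounds that are uniform in the parameters.\<close>

definition exsets :: "nat \<Rightarrow> nat \<Rightarrow> nat \<Rightarrow> (nat \<Rightarrow> real) set set" where
  "exsets j K D = {A. \<exists>F. bdpoly (nvars K) D F \<and> A = {x. \<exists>z. (\<forall>i<j. z i = x i) \<and> F z = 0}}"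

lemma bdpoly_nvars_coord: "i < K \<Longrightarrow> 1 \<le> D \<Longrightarrow> bdpoly (nvars K) D (\<lambda>z. z i)"
  by (rule bdpoly.gen) (auto simp: nvars_def)

lemma bdpoly_nvars_exp: "i < K \<Longrightarrow> 1 \<le> D \<Longrightarrow> bdpoly (nvars K) D (\<lambda>z. exp (z i))"
  by (rule bdpoly.gen) (auto simp: nvars_def)

lemma bdpoly_nvars_rename:
  assumes "bdpoly (nvars K) D F" "\<And>i. i < K \<Longrightarrow> \<sigma> i < K'"
  shows "bdpoly (nvars K') D (\<lambda>z. F (\<lambda>i. z (\<sigma> i)))"
  by (rule bdpoly_comp[OF assms(1)])
    (use assms(2) in \<open>auto simp: nvars_def intro!: bdpoly.gen\<close>)

lemma bdpoly_nvars_mono: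
  assumes "bdpoly (nvars K) D F" "K \<le> K'" "D \<le> D'"
  shows "bdpoly (nvars K') D' F"
  using bdpoly_mono[OF bdpoly_nvars_rename[OF assms(1), of "\<lambda>i. i" K'] assms(3)] assms(2) by simp

lemma bdpoly_nvars_cong:
  assumes "bdpoly (nvars K) D F" "\<And>i. i < K \<Longrightarrow> z i = z' i"
  shows "F z = F z'"
  using assms(1) by (induction rule: bdpoly.induct) (use assms(2) in \<open>auto simp: nvars_def\<close>)

lemma bdpoly_nvars_partial:
  assumes "bdpoly (nvars K) D F"
  shows "\<exists>dF. (\<forall>i. bdpoly (nvars K) D (dF i)) \<and>
    (\<forall>i z. ((\<lambda>s. F (z(i := z i + s))) has_real_derivative dF i z) (at 0))"
  using assms
proof (induction rule: bdpoly.induct)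
  case (const D c)
  show ?case by (intro exI[of _ "\<lambda>i z. 0"]) (auto intro: bdpoly.const)
next
  case (gen g D)
  then consider k where "k < K" "g = (\<lambda>z. z k)" | k where "k < K" "g = (\<lambda>z. exp (z k))"
    unfolding nvars_def by blast
  then show ?case
  proof cases
    case 1
    then show ?thesis
      by (intro exI[of _ "\<lambda>i z. if i = k then 1 else 0"])
        (auto intro: bdpoly.const intro!: derivative_eq_intros)
  next
    case 2
    have "bdpoly (nvars K) D (\<lambda>z. if i = k then exp (z k) else 0)" for i
      using 2 gen bdpoly_nvars_exp by (cases "i = k") (auto intro: bdpoly.const)
    then show ?thesis using 2
      by (intro exI[of _ "\<lambda>i z. if i = k then exp (z k) else 0"])
        (auto intro!: derivative_eq_intros)
  qed
next
  case (add D f g)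
  then obtain df dg where d: "\<forall>i. bdpoly (nvars K) D (df i)" "\<forall>i. bdpoly (nvars K) D (dg i)"
    "\<And>i z. ((\<lambda>s. f (z(i := z i + s))) has_real_derivative df i z) (at 0)"
    "\<And>i z. ((\<lambda>s. g (z(i := z i + s))) has_real_derivative dg i z) (at 0)"
    by blast
  show ?case
    by (intro exI[of _ "\<lambda>i z. df i z + dg i z"] conjI allI bdpoly.add DERIV_add d d(1,2)[rule_format])
next
  case (mult D f E g)
  then obtain df dg where d: "\<forall>i. bdpoly (nvars K) D (df i)" "\<forall>i. bdpoly (nvars K) E (dg i)"
    "\<And>i z. ((\<lambda>s. f (z(i := z i + s))) has_real_derivative df i z) (at 0)"
    "\<And>i z. ((\<lambda>s. g (z(i := z i + s))) has_real_derivative dg i z) (at 0)"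
    by blast
  have "((\<lambda>s. f (z(i := z i + s)) * g (z(i := z i + s))) has_real_derivative (df i z * g z + dg i z * f z)) (at 0)" for i z
    using DERIV_mult[OF d(3)[of z i] d(4)[of z i]] by simp
  moreover have "bdpoly (nvars K) (D + E) (\<lambda>z. df i z * g z + dg i z * f z)" for i
    using d mult.hyps by (intro bdpoly.add bdpoly_mult_le) auto
  ultimately show ?case by (intro exI[of _ "\<lambda>i z. df i z * g z + dg i z * f z"] conjI allI)
qed

text \<open>A closed formula in the number \<open>n\<close> of the variables \<open>x\<^bsub>j\<^esub>, \<dots>, x\<^bsub>j+n-1\<^esub>\<close>, all but the first of
  which are quantified; this allows the choice of a type with \<open>n\<close> elements below.\<close>

definition fibre_step :: "nat \<Rightarrow> bool" where
  "fibre_step n \<longleftrightarrow> (\<forall>j K D. K = j + n \<longrightarrow> (\<exists>N K' D'. \<forall>A\<in>exsets (Suc j) K D. \<forall>P. finite P \<longrightarrow>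
     (\<exists>A'\<in>exsets (Suc j) K' D'. \<exists>B\<in>exsets (Suc j) K' D'. \<forall>p\<in>P.
        (p \<in> A \<longleftrightarrow> p \<in> A') \<and> finite {t. p(j := t) \<in> B} \<and> card {t. p(j := t) \<in> B} \<le> N \<and> p \<notin> B \<and>
        (\<forall>s t. p(j := s) \<in> A' \<longrightarrow> p(j := t) \<notin> A' \<longrightarrow> (\<exists>b\<in>closed_segment s t. p(j := b) \<in> B)))))"

text \<open>This is \<open>generic_sublevel\<close> transported along a bijection of the variables
  \<open>j, ..., K - 1\<close> with \<open>'n\<close>. Coordinate \<open>j\<close> corresponds to
  \<open>i0\<close>, and the coordinates below \<open>j\<close> are parameters supplied by
  \<open>p\<close>. The set \<open>A'\<close> is the projection of the sublevel set, and
  \<open>B\<close> that of the critical points.\<close>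

lemma fibre_step_CARD:
  assumes card: "CARD('m::{finite,wellorder}) = 2 * CARD('n::{finite,wellorder}) + 1"
  shows "fibre_step (CARD('n))"
  unfolding fibre_step_def
proof (intro allI impI)
  fix j K D assume K: "K = j + CARD('n)"
  have "card {j..<K} = CARD('n)" using K by simp
  then obtain e :: "nat \<Rightarrow> 'n" where e: "bij_betw e {j..<K} UNIV"
    using finite_same_card_bij[of "{j..<K}" "UNIV :: 'n set"] by auto
  define e' where "e' = inv_into {j..<K} e"
  have e'1: "e' k \<in> {j..<K}" for k unfolding e'_def using e by (metis UNIV_I bij_betw_imp_surj_on inv_into_into)
  have ee': "e (e' k) = k" for k unfolding e'_def using e by (metis UNIV_I bij_betw_inv_into_right)
  have e'e: "e' (e i) = i" if "i \<in> {j..<K}" for i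
    unfolding e'_def using e that by (metis bij_betw_inv_into_left)
  have jK: "j < K" using K by simp
  define i0 where "i0 = e j"
  have e'i0: "e' i0 = j" unfolding i0_def using e'e jK by simp
  have sum_e: "(\<Sum>k\<in>-{i0}. f k) = (\<Sum>i\<in>{Suc j..<K}. f (e i))" for f :: "'n \<Rightarrow> real"
  proof (rule sum.reindex_bij_witness[of _ e e'])
    fix k assume k: "k \<in> -{i0}"
    then have "e' k \<noteq> j" using ee'[of k] unfolding i0_def by auto
    then show "e' k \<in> {Suc j..<K}" using e'1[of k] by auto
  next
    fix i assume i: "i \<in> {Suc j..<K}"
    then have "e' (e i) \<noteq> e' i0" using e'e[of i] e'i0 by auto
    then show "e i \<in> -{i0}" by auto
  qed (use ee' e'e in auto)
  obtain N where N: "\<forall>(P :: (nat \<Rightarrow> real) set) (h :: (nat \<Rightarrow> real) \<Rightarrow> real^'n::{finite,wellorder} \<Rightarrow> real) dh tp. finite P \<longrightarrow>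
    (\<forall>p\<in>P. bdpoly expcoords (2 * D) (h p)) \<longrightarrow> (\<forall>p\<in>P. \<forall>x. h p x \<ge> 0) \<longrightarrow>
    (\<forall>p\<in>P. \<forall>k. bdpoly expcoords (2 * D) (dh p k)) \<longrightarrow>
    (\<forall>p\<in>P. \<forall>k x. ((\<lambda>s. h p (x + s *\<^sub>R axis k 1)) has_real_derivative dh p k x) (at 0)) \<longrightarrow>
    (\<exists>\<delta> v. \<forall>p\<in>P. let G = (\<lambda>x. h p x + \<delta> * (\<Sum>k\<in>-{i0}. (x $ k)\<^sup>2) + (\<Sum>k\<in>-{i0}. v $ k * x $ k));
          Z = {x. G x = v $ i0 \<and> (\<forall>k. k \<noteq> i0 \<longrightarrow> dh p k x + 2 * \<delta> * x $ k + v $ k = 0)} in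
      ((\<exists>x. x $ i0 = tp p \<and> h p x = 0) \<longleftrightarrow> (\<exists>x. x $ i0 = tp p \<and> G x \<le> v $ i0)) \<and>
      finite Z \<and> card Z \<le> N \<and> (\<forall>x\<in>Z. x $ i0 \<noteq> tp p) \<and>
      (\<forall>s t. (\<exists>x. x $ i0 = s \<and> G x \<le> v $ i0) \<longrightarrow> \<not> (\<exists>x. x $ i0 = t \<and> G x \<le> v $ i0) \<longrightarrow>
         (\<exists>x\<in>Z. x $ i0 \<in> closed_segment s t)))"
    using generic_sublevel[OF card, of "2 * D" i0, where 'p = "nat \<Rightarrow> real"] by (elim exE)
  show "\<exists>N K' D'. \<forall>A\<in>exsets (Suc j) K D. \<forall>P. finite P \<longrightarrow>
     (\<exists>A'\<in>exsets (Suc j) K' D'. \<exists>B\<in>exsets (Suc j) K' D'. \<forall>p\<in>P.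
        (p \<in> A \<longleftrightarrow> p \<in> A') \<and> finite {t. p(j := t) \<in> B} \<and> card {t. p(j := t) \<in> B} \<le> N \<and> p \<notin> B \<and>
        (\<forall>s t. p(j := s) \<in> A' \<longrightarrow> p(j := t) \<notin> A' \<longrightarrow> (\<exists>b\<in>closed_segment s t. p(j := b) \<in> B)))"
  proof (rule exI[of _ N], rule exI[of _ "Suc K"], rule exI[of _ "2 * (2 * D + 2)"], intro ballI allI impI)
    fix A and P :: "(nat \<Rightarrow> real) set" assume "A \<in> exsets (Suc j) K D" and fin: "finite P"
    then obtain F where F: "bdpoly (nvars K) D F" and A: "A = {x. \<exists>z. (\<forall>i<Suc j. z i = x i) \<and> F z = 0}"
      unfolding exsets_def by blast
    \<comment> \<open>Squaring gives a nonnegative function with the same zeros, at the price of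
      doubling the degree.\<close>
    define F2 where "F2 z = (F z)\<^sup>2" for z
    have F2: "bdpoly (nvars K) (2 * D) F2" unfolding F2_def by (rule bdpoly_power[OF F])
    obtain dF2 where dF2: "\<And>i. bdpoly (nvars K) (2 * D) (dF2 i)"
      "\<And>i z. ((\<lambda>s. F2 (z(i := z i + s))) has_real_derivative dF2 i z) (at 0)"
      using bdpoly_nvars_partial[OF F2] by blast
    define emb where "emb p x i = (if j \<le> i \<and> i < K then x $ e i else p i)" for p i and x :: "real^'n::{finite,wellorder}"
    have emb_poly: "bdpoly expcoords E (\<lambda>x. f (emb p x))" if "bdpoly (nvars K) E f" for f E p
    proof (rule bdpoly_comp[OF that])
      fix g assume "g \<in> nvars K"
      then consider i where "g = (\<lambda>z. z i)" | i where "g = (\<lambda>z. exp (z i))" unfolding nvars_def by blast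
      then show "bdpoly expcoords 1 (\<lambda>x. g (emb p x))"
      proof cases
        case (1 i)
        have "bdpoly expcoords 1 (\<lambda>x. x $ e i)" by (rule bdpoly.gen) (auto simp: expcoords_def coords_def)
        then show ?thesis unfolding 1 emb_def by (cases "j \<le> i \<and> i < K") (simp_all only: simp_thms if_True if_False bdpoly.const)
      next
        case (2 i)
        have "bdpoly expcoords 1 (\<lambda>x. exp (x $ e i))" by (rule bdpoly.gen) (auto simp: expcoords_def)
        then show ?thesis unfolding 2 emb_def by (cases "j \<le> i \<and> i < K") (simp_all only: simp_thms if_True if_False bdpoly.const)
      qed
    qed
    have emb_axis: "emb p (x + s *\<^sub>R axis k 1) = (emb p x)(e' k := emb p x (e' k) + s)" for p x s k
      using e'1[of k] e'e ee' by (auto simp: emb_def axis_def fun_eq_iff)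
    have A1: "\<forall>p\<in>P. bdpoly expcoords (2 * D) (\<lambda>x. F2 (emb p x))" using emb_poly[OF F2] by blast
    have A2: "\<forall>p\<in>P. \<forall>x. 0 \<le> F2 (emb p x)" unfolding F2_def by simp
    have A3: "\<forall>p\<in>P. \<forall>k. bdpoly expcoords (2 * D) (\<lambda>x. dF2 (e' k) (emb p x))" using emb_poly[OF dF2(1)] by blast
    have A4: "\<forall>p\<in>P. \<forall>k x. ((\<lambda>s. F2 (emb p (x + s *\<^sub>R axis k 1))) has_real_derivative dF2 (e' k) (emb p x)) (at 0)"
        unfolding emb_axis using dF2(2) by blast

    have "\<exists>\<delta> v. \<forall>p\<in>P. let G = (\<lambda>x. F2 (emb p x) + \<delta> * (\<Sum>k\<in>-{i0}. (x $ k)\<^sup>2) + (\<Sum>k\<in>-{i0}. v $ k * x $ k));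
          Z = {x. G x = v $ i0 \<and> (\<forall>k. k \<noteq> i0 \<longrightarrow> dF2 (e' k) (emb p x) + 2 * \<delta> * x $ k + v $ k = 0)} in
      ((\<exists>x. x $ i0 = p j \<and> F2 (emb p x) = 0) \<longleftrightarrow> (\<exists>x. x $ i0 = p j \<and> G x \<le> v $ i0)) \<and>
      finite Z \<and> card Z \<le> N \<and> (\<forall>x\<in>Z. x $ i0 \<noteq> p j) \<and>
      (\<forall>s t. (\<exists>x. x $ i0 = s \<and> G x \<le> v $ i0) \<longrightarrow> \<not> (\<exists>x. x $ i0 = t \<and> G x \<le> v $ i0) \<longrightarrow>
         (\<exists>x\<in>Z. x $ i0 \<in> closed_segment s t))"
      by (rule N[THEN spec[of _ P], THEN spec[of _ "\<lambda>p x. F2 (emb p x)"],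
            THEN spec[of _ "\<lambda>p k x. dF2 (e' k) (emb p x)"], THEN spec[of _ "\<lambda>p. p j"],
            THEN mp, OF fin, THEN mp, OF A1, THEN mp, OF A2, THEN mp, OF A3, THEN mp, OF A4])
    then obtain \<delta> v where dv: "\<And>p. p \<in> P \<Longrightarrow> let G = (\<lambda>x. F2 (emb p x) + \<delta> * (\<Sum>k\<in>-{i0}. (x $ k)\<^sup>2) + (\<Sum>k\<in>-{i0}. v $ k * x $ k));
          Z = {x. G x = v $ i0 \<and> (\<forall>k. k \<noteq> i0 \<longrightarrow> dF2 (e' k) (emb p x) + 2 * \<delta> * x $ k + v $ k = 0)} in
      ((\<exists>x. x $ i0 = p j \<and> F2 (emb p x) = 0) \<longleftrightarrow> (\<exists>x. x $ i0 = p j \<and> G x \<le> v $ i0)) \<and>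
      finite Z \<and> card Z \<le> N \<and> (\<forall>x\<in>Z. x $ i0 \<noteq> p j) \<and>
      (\<forall>s t. (\<exists>x. x $ i0 = s \<and> G x \<le> v $ i0) \<longrightarrow> \<not> (\<exists>x. x $ i0 = t \<and> G x \<le> v $ i0) \<longrightarrow>
         (\<exists>x\<in>Z. x $ i0 \<in> closed_segment s t))" by blast
    define G where "G z = F2 z + \<delta> * (\<Sum>i\<in>{Suc j..<K}. (z i)\<^sup>2) + (\<Sum>i\<in>{Suc j..<K}. v $ e i * z i)" for z
    \<comment> \<open>A sum of squares merges the equations of a critical point at the level
      \<open>v $ i0\<close> into one.\<close>
    define H where "H z = (G z - v $ i0)\<^sup>2 + (\<Sum>i\<in>{Suc j..<K}. (dF2 i z + 2 * \<delta> * z i + v $ e i)\<^sup>2)" for z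
    have Gpoly: "bdpoly (nvars K) (2 * D + 2) G"
    proof -
      have "bdpoly (nvars K) (2 * D + 2) (\<lambda>z. (z i)\<^sup>2)" if "i \<in> {Suc j..<K}" for i
        using bdpoly_power[OF bdpoly_nvars_coord[of i K 1], of 2] that bdpoly_mono by force
      moreover have "bdpoly (nvars K) (2 * D + 2) (\<lambda>z. z i)" if "i \<in> {Suc j..<K}" for i
        using that by (intro bdpoly_nvars_coord) auto
      ultimately show ?thesis unfolding G_def
        by (intro bdpoly.add bdpoly_cmult bdpoly_sum bdpoly_mono[OF F2]) simp_all
    qed
    have Hpoly: "bdpoly (nvars K) (2 * (2 * D + 2)) H"
    proof -
      have "bdpoly (nvars K) (2 * D + 2) (\<lambda>z. dF2 i z + 2 * \<delta> * z i + v $ e i)" if "i \<in> {Suc j..<K}" for i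
        using that by (intro bdpoly.add bdpoly_cmult bdpoly.const bdpoly_mono[OF dF2(1)] bdpoly_nvars_coord) auto
      then have "bdpoly (nvars K) (2 * (2 * D + 2)) (\<lambda>z. \<Sum>i\<in>{Suc j..<K}. (dF2 i z + 2 * \<delta> * z i + v $ e i)\<^sup>2)"
        by (intro bdpoly_sum bdpoly_power) auto
      moreover have "bdpoly (nvars K) (2 * (2 * D + 2)) (\<lambda>z. (G z - v $ i0)\<^sup>2)"
        by (intro bdpoly_power bdpoly_diff Gpoly bdpoly.const)
      ultimately show ?thesis unfolding H_def by (intro bdpoly.add)
    qed
    \<comment> \<open>The new variable \<open>z K\<close> is a slack that turns
      \<open>G z \<le> v $ i0\<close> into an equation.\<close>
    define A' where "A' = {x. \<exists>z. (\<forall>i<Suc j. z i = x i) \<and> G z - v $ i0 + (z K)\<^sup>2 = 0}"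
    define B where "B = {x. \<exists>z. (\<forall>i<Suc j. z i = x i) \<and> H z = 0}"
    have A'_ex: "A' \<in> exsets (Suc j) (Suc K) (2 * (2 * D + 2))"
    proof -
      have "bdpoly (nvars (Suc K)) (2 * (2 * D + 2)) (\<lambda>z. (z K)\<^sup>2)"
        using bdpoly_power[OF bdpoly_nvars_coord[of K "Suc K" 1], of 2] by (auto intro: bdpoly_mono)
      then have "bdpoly (nvars (Suc K)) (2 * (2 * D + 2)) (\<lambda>z. G z - v $ i0 + (z K)\<^sup>2)"
        by (intro bdpoly.add bdpoly_diff bdpoly.const bdpoly_nvars_mono[OF Gpoly]) auto
      then show ?thesis unfolding exsets_def A'_def by blast
    qed
    have B_ex: "B \<in> exsets (Suc j) (Suc K) (2 * (2 * D + 2))"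
      unfolding exsets_def B_def using bdpoly_nvars_mono[OF Hpoly, of "Suc K"] by auto
    have emb_iff: "(\<exists>z. (\<forall>i<Suc j. z i = (p(j := t)) i) \<and> Q z) \<longleftrightarrow> (\<exists>x. x $ i0 = t \<and> Q (emb p x))"
      if Q: "\<And>z z'. (\<And>i. i < K \<Longrightarrow> z i = z' i) \<Longrightarrow> Q z = Q z'" for Q p t
    proof
      assume "\<exists>z. (\<forall>i<Suc j. z i = (p(j := t)) i) \<and> Q z"
      then obtain z where z: "\<And>i. i < Suc j \<Longrightarrow> z i = (p(j := t)) i" "Q z" by blast
      have "z i = emb p (\<chi> k. z (e' k)) i" if "i < K" for i
        using that z(1)[of i] e'e[of i] by (auto simp: emb_def)
      then have "Q (emb p (\<chi> k. z (e' k)))" using Q z(2) by blast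
      moreover have "(\<chi> k. z (e' k)) $ i0 = t" using z(1)[of j] e'i0 by simp
      ultimately show "\<exists>x. x $ i0 = t \<and> Q (emb p x)" by blast
    next
      assume "\<exists>x. x $ i0 = t \<and> Q (emb p x)"
      then obtain x where x: "x $ i0 = t" "Q (emb p x)" by blast
      have "emb p x i = (p(j := t)) i" if "i < Suc j" for i
        using that x(1) jK unfolding emb_def i0_def by auto
      then show "\<exists>z. (\<forall>i<Suc j. z i = (p(j := t)) i) \<and> Q z" using x(2) by blast
    qed
    have G_cong: "G z = G z'" if "\<And>i. i < K \<Longrightarrow> z i = z' i" for z z'
      by (rule bdpoly_nvars_cong[OF Gpoly]) (use that in auto)
    have H_cong: "H z = H z'" if "\<And>i. i < K \<Longrightarrow> z i = z' i" for z z'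
      by (rule bdpoly_nvars_cong[OF Hpoly]) (use that in auto)
    have F_cong: "F2 z = F2 z'" if "\<And>i. i < K \<Longrightarrow> z i = z' i" for z z'
      by (rule bdpoly_nvars_cong[OF F2]) (use that in auto)
    have A'_alt: "x \<in> A' \<longleftrightarrow> (\<exists>z. (\<forall>i<Suc j. z i = x i) \<and> G z \<le> v $ i0)" for x
    proof
      assume "x \<in> A'"
      then obtain z where z: "\<forall>i<Suc j. z i = x i" "G z - v $ i0 + (z K)\<^sup>2 = 0" unfolding A'_def by blast
      then have "G z \<le> v $ i0" using zero_le_power2[of "z K"] by linarith
      then show "\<exists>z. (\<forall>i<Suc j. z i = x i) \<and> G z \<le> v $ i0" using z(1) by blast
    next
      assume "\<exists>z. (\<forall>i<Suc j. z i = x i) \<and> G z \<le> v $ i0"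
      then obtain z where z: "\<forall>i<Suc j. z i = x i" "G z \<le> v $ i0" by blast
      define z' where "z' = z(K := sqrt (v $ i0 - G z))"
      have "G z' = G z" by (rule G_cong) (simp add: z'_def)
      then have "G z' - v $ i0 + (z' K)\<^sup>2 = 0" using z(2) by (simp add: z'_def)
      moreover have "\<forall>i<Suc j. z' i = x i" using z(1) jK by (auto simp: z'_def)
      ultimately show "x \<in> A'" unfolding A'_def by blast
    qed
    have A'_iff: "p(j := t) \<in> A' \<longleftrightarrow> (\<exists>x. x $ i0 = t \<and> G (emb p x) \<le> v $ i0)" for p t
      unfolding A'_alt proof (rule emb_iff)
      fix z z' :: "nat \<Rightarrow> real" assume "\<And>i. i < K \<Longrightarrow> z i = z' i"
      then have "G z = G z'" by (rule G_cong)
      then show "(G z \<le> v $ i0) = (G z' \<le> v $ i0)" by simp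
    qed
    have B_iff: "p(j := t) \<in> B \<longleftrightarrow> (\<exists>x. x $ i0 = t \<and> H (emb p x) = 0)" for p t
      unfolding B_def mem_Collect_eq proof (rule emb_iff)
      fix z z' :: "nat \<Rightarrow> real" assume "\<And>i. i < K \<Longrightarrow> z i = z' i"
      then have "H z = H z'" by (rule H_cong)
      then show "(H z = 0) = (H z' = 0)" by simp
    qed
    have A_iff: "p(j := t) \<in> A \<longleftrightarrow> (\<exists>x. x $ i0 = t \<and> F2 (emb p x) = 0)" for p t
    proof -
      have "p(j := t) \<in> A \<longleftrightarrow> (\<exists>z. (\<forall>i<Suc j. z i = (p(j := t)) i) \<and> F2 z = 0)"
        unfolding A F2_def by simp
      also have "\<dots> \<longleftrightarrow> (\<exists>x. x $ i0 = t \<and> F2 (emb p x) = 0)"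
      proof (rule emb_iff)
      fix z z' :: "nat \<Rightarrow> real" assume "\<And>i. i < K \<Longrightarrow> z i = z' i"
      then have "F2 z = F2 z'" by (rule F_cong)
      then show "(F2 z = 0) = (F2 z' = 0)" by simp
    qed
      finally show ?thesis .
    qed
    have emb_e: "emb p x i = x $ e i" if "i \<in> {Suc j..<K}" for p x i using that by (auto simp: emb_def)
    have G_emb: "G (emb p x) = F2 (emb p x) + \<delta> * (\<Sum>k\<in>-{i0}. (x $ k)\<^sup>2) + (\<Sum>k\<in>-{i0}. v $ k * x $ k)" for p x
      unfolding G_def sum_e using emb_e by simp
    have H_emb: "H (emb p x) = 0 \<longleftrightarrow> G (emb p x) = v $ i0 \<and> (\<forall>k. k \<noteq> i0 \<longrightarrow> dF2 (e' k) (emb p x) + 2 * \<delta> * x $ k + v $ k = 0)" for p x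
    proof -
      have "(\<Sum>i\<in>{Suc j..<K}. (dF2 i (emb p x) + 2 * \<delta> * emb p x i + v $ e i)\<^sup>2)
        = (\<Sum>k\<in>-{i0}. (dF2 (e' k) (emb p x) + 2 * \<delta> * x $ k + v $ k)\<^sup>2)"
        unfolding sum_e using emb_e e'e by (intro sum.cong) auto
      moreover have "(\<Sum>k\<in>-{i0}. (dF2 (e' k) (emb p x) + 2 * \<delta> * x $ k + v $ k)\<^sup>2) = 0 \<longleftrightarrow>
          (\<forall>k\<in>-{i0}. dF2 (e' k) (emb p x) + 2 * \<delta> * x $ k + v $ k = 0)"
        by (subst sum_nonneg_eq_0_iff) auto
      moreover have "(\<Sum>k\<in>-{i0}. (dF2 (e' k) (emb p x) + 2 * \<delta> * x $ k + v $ k)\<^sup>2) \<ge> 0" by (simp add: sum_nonneg)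
      ultimately show ?thesis unfolding H_def by (subst add_nonneg_eq_0_iff) auto
    qed
    show "\<exists>A'\<in>exsets (Suc j) (Suc K) (2 * (2 * D + 2)). \<exists>B\<in>exsets (Suc j) (Suc K) (2 * (2 * D + 2)). \<forall>p\<in>P.
        (p \<in> A \<longleftrightarrow> p \<in> A') \<and> finite {t. p(j := t) \<in> B} \<and> card {t. p(j := t) \<in> B} \<le> N \<and> p \<notin> B \<and>
        (\<forall>s t. p(j := s) \<in> A' \<longrightarrow> p(j := t) \<notin> A' \<longrightarrow> (\<exists>b\<in>closed_segment s t. p(j := b) \<in> B))"
    proof (rule bexI[OF _ A'_ex], rule bexI[OF _ B_ex], rule ballI)
      fix p assume p: "p \<in> P"
      define Z where "Z = {x. H (emb p x) = 0}"
      note main = dv[OF p, folded G_emb, unfolded Let_def, folded H_emb, folded Z_def]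
      have tri: "p(j := p j) = p" by simp
      have 1: "p \<in> A \<longleftrightarrow> p \<in> A'" using main A_iff[of p "p j"] A'_iff[of p "p j"] unfolding tri by blast
      have \<beta>: "{t. p(j := t) \<in> B} = (\<lambda>x. x $ i0) ` Z" unfolding B_iff Z_def by blast
      have 2: "finite {t. p(j := t) \<in> B}" "card {t. p(j := t) \<in> B} \<le> N"
        unfolding \<beta> using main card_image_le[of Z "\<lambda>x. x $ i0"] by (blast, linarith)
      have 3: "p \<notin> B" using main B_iff[of p "p j"] unfolding tri Z_def by blast
      have 4: "\<exists>b\<in>closed_segment s t. p(j := b) \<in> B" if "p(j := s) \<in> A'" "p(j := t) \<notin> A'" for s t
      proof -
        have "\<exists>x\<in>Z. x $ i0 \<in> closed_segment s t" using main that unfolding A'_iff by blast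
        then show ?thesis unfolding B_iff Z_def by blast
      qed
      show "(p \<in> A \<longleftrightarrow> p \<in> A') \<and> finite {t. p(j := t) \<in> B} \<and> card {t. p(j := t) \<in> B} \<le> N \<and> p \<notin> B \<and>
        (\<forall>s t. p(j := s) \<in> A' \<longrightarrow> p(j := t) \<notin> A' \<longrightarrow> (\<exists>b\<in>closed_segment s t. p(j := b) \<in> B))"
        using 1 2 3 4 by blast
    qed
  qed
qed

text \<open>The number of quantified variables is not bounded in terms of the types of the theorem,
  while calculus is available for a number of variables given by a type. If \<open>fibre_step\<close> failed for
  some number, then it would fail for a definite one, which is the number of elements of a type.\<close>

definition fail_dim :: nat where
  "fail_dim = Suc (SOME n. \<not> fibre_step (Suc n))"

typedef fail_idx = "{..<fail_dim}"
  by (rule exI[of _ 0]) (simp add: fail_dim_def)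

text \<open>As many elements as the reduction to mixed systems has variables for
  \<open>fail_dim\<close> unknowns.\<close>

typedef fail_idx2 = "{..<2 * fail_dim + 1}"
  by (rule exI[of _ 0]) simp

instantiation fail_idx :: wellorder
begin
definition "x \<le> y \<longleftrightarrow> Rep_fail_idx x \<le> Rep_fail_idx y"
definition "x < y \<longleftrightarrow> Rep_fail_idx x < Rep_fail_idx y"
instance
proof
  fix P :: "fail_idx \<Rightarrow> bool" and a
  assume *: "\<And>x. (\<And>y. y < x \<Longrightarrow> P y) \<Longrightarrow> P x"
  show "P a" by (induction a rule: measure_induct_rule[of Rep_fail_idx]) (rule *, simp add: less_fail_idx_def)
qed (auto simp: less_eq_fail_idx_def less_fail_idx_def Rep_fail_idx_inject)
end

instantiation fail_idx2 :: wellorder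
begin
definition "x \<le> y \<longleftrightarrow> Rep_fail_idx2 x \<le> Rep_fail_idx2 y"
definition "x < y \<longleftrightarrow> Rep_fail_idx2 x < Rep_fail_idx2 y"
instance
proof
  fix P :: "fail_idx2 \<Rightarrow> bool" and a
  assume *: "\<And>x. (\<And>y. y < x \<Longrightarrow> P y) \<Longrightarrow> P x"
  show "P a" by (induction a rule: measure_induct_rule[of Rep_fail_idx2]) (rule *, simp add: less_fail_idx2_def)
qed (auto simp: less_eq_fail_idx2_def less_fail_idx2_def Rep_fail_idx2_inject)
end

instance fail_idx :: finite
  by standard (metis finite_imageI finite_lessThan type_definition.Abs_image type_definition_fail_idx)

instance fail_idx2 :: finite
  by standard (metis finite_imageI finite_lessThan type_definition.Abs_image type_definition_fail_idx2)

lemma CARD_fail_idx: "CARD(fail_idx) = fail_dim"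
  using type_definition.card[OF type_definition_fail_idx] by simp

lemma CARD_fail_idx2: "CARD(fail_idx2) = 2 * CARD(fail_idx) + 1"
  using type_definition.card[OF type_definition_fail_idx2] by (simp add: CARD_fail_idx)

theorem fibre_step_all:
  assumes "n > 0"
  shows "fibre_step n"
proof (rule ccontr)
  assume "\<not> fibre_step n"
  then have "\<not> fibre_step (Suc (n - 1))" using assms by simp
  then have "\<not> fibre_step fail_dim" unfolding fail_dim_def by (rule someI)
  then show False using fibre_step_CARD[OF CARD_fail_idx2] by (simp add: CARD_fail_idx)
qed

section \<open>Closure properties of existential sets\<close>

lemma exsetsI:
  assumes "bdpoly (nvars K) D F"
    and "\<And>x. x \<in> A \<longleftrightarrow> (\<exists>z. (\<forall>i<j. z i = x i) \<and> F z = 0)"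
  shows "A \<in> exsets j K D"
proof -
  have "A = {x. \<exists>z. (\<forall>i<j. z i = x i) \<and> F z = 0}" using assms(2) by blast
  then show ?thesis unfolding exsets_def using assms(1) by blast
qed

lemma exsetsE:
  assumes "A \<in> exsets j K D"
  obtains F where "bdpoly (nvars K) D F" "\<And>x. x \<in> A \<longleftrightarrow> (\<exists>z. (\<forall>i<j. z i = x i) \<and> F z = 0)"
  using assms unfolding exsets_def by blast

lemma exsets_mono:
  assumes "A \<in> exsets j K D" "K \<le> K'" "D \<le> D'"
  shows "A \<in> exsets j K' D'"
  using assms bdpoly_nvars_mono unfolding exsets_def by blast

lemma exsets_cong:
  assumes "A \<in> exsets j K D" "\<And>i. i < j \<Longrightarrow> x i = x' i"
  shows "x \<in> A \<longleftrightarrow> x' \<in> A"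
  using assms(1) by (rule exsetsE) (use assms(2) in auto)

lemma exsets_rename:
  assumes "A \<in> exsets j K D" "\<And>i. i < j \<Longrightarrow> \<sigma> i < j'"
  shows "{x. (\<lambda>i. x (\<sigma> i)) \<in> A} \<in> exsets j' (j' + K) D"
proof -
  obtain F where F: "bdpoly (nvars K) D F" "\<And>x. x \<in> A \<longleftrightarrow> (\<exists>z. (\<forall>i<j. z i = x i) \<and> F z = 0)"
    using exsetsE[OF assms(1)] by blast
  \<comment> \<open>The quantified variables move to indices from \<open>j'\<close> on, out of the
    way of the new free coordinates.\<close>
  define \<tau> where "\<tau> i = (if i < j then \<sigma> i else j' + i)" for i
  show ?thesis
  proof (rule exsetsI)
    show "bdpoly (nvars (j' + K)) D (\<lambda>z. F (\<lambda>i. z (\<tau> i)))"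
      by (rule bdpoly_nvars_rename[OF F(1)]) (use assms(2) in \<open>auto simp: \<tau>_def intro: trans_less_add1\<close>)
    fix x
    show "x \<in> {x. (\<lambda>i. x (\<sigma> i)) \<in> A} \<longleftrightarrow> (\<exists>z. (\<forall>i<j'. z i = x i) \<and> F (\<lambda>i. z (\<tau> i)) = 0)"
    proof
      assume "x \<in> {x. (\<lambda>i. x (\<sigma> i)) \<in> A}"
      then obtain z where z: "\<And>i. i < j \<Longrightarrow> z i = x (\<sigma> i)" "F z = 0" using F(2) by auto
      define z' where "z' i = (if i < j' then x i else z (i - j'))" for i
      have "(\<lambda>i. z' (\<tau> i)) = z" using z(1) assms(2) by (auto simp: z'_def \<tau>_def fun_eq_iff)
      then show "\<exists>z. (\<forall>i<j'. z i = x i) \<and> F (\<lambda>i. z (\<tau> i)) = 0"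
        using z(2) by (intro exI[of _ z']) (simp add: z'_def)
    next
      assume "\<exists>z. (\<forall>i<j'. z i = x i) \<and> F (\<lambda>i. z (\<tau> i)) = 0"
      then obtain z where "\<And>i. i < j' \<Longrightarrow> z i = x i" "F (\<lambda>i. z (\<tau> i)) = 0" by blast
      then show "x \<in> {x. (\<lambda>i. x (\<sigma> i)) \<in> A}"
        using assms(2) unfolding F(2) mem_Collect_eq
        by (intro exI[of _ "\<lambda>i. z (\<tau> i)"]) (auto simp: \<tau>_def)
    qed
  qed
qed

text \<open>A sum of squares and a product of the two equations, with the quantified variables of
  the second shifted by \<open>K\<close> to make them independent of those of the first.\<close>

lemma exsets_binop:
  assumes "A \<in> exsets j K D" "B \<in> exsets j K D"
  shows "A \<inter> B \<in> exsets j (K + K) (2 * D)" "A \<union> B \<in> exsets j (K + K) (2 * D)"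
proof -
  obtain F where F: "bdpoly (nvars K) D F" "\<And>x. x \<in> A \<longleftrightarrow> (\<exists>z. (\<forall>i<j. z i = x i) \<and> F z = 0)"
    using exsetsE[OF assms(1)] by blast
  obtain G where G: "bdpoly (nvars K) D G" "\<And>x. x \<in> B \<longleftrightarrow> (\<exists>z. (\<forall>i<j. z i = x i) \<and> G z = 0)"
    using exsetsE[OF assms(2)] by blast
  define \<sigma> where "\<sigma> i = (if i < j then i else K + i)" for i
  have pF: "bdpoly (nvars (K + K)) D F" by (rule bdpoly_nvars_mono[OF F(1)]) auto
  have pG: "bdpoly (nvars (K + K)) D (\<lambda>z. G (\<lambda>i. z (\<sigma> i)))"
    by (rule bdpoly_nvars_rename[OF G(1)]) (auto simp: \<sigma>_def)
  show "A \<inter> B \<in> exsets j (K + K) (2 * D)"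
  proof (rule exsetsI)
    show "bdpoly (nvars (K + K)) (2 * D) (\<lambda>z. (F z)\<^sup>2 + (G (\<lambda>i. z (\<sigma> i)))\<^sup>2)"
      by (intro bdpoly.add bdpoly_power pF pG)
    fix x
    show "x \<in> A \<inter> B \<longleftrightarrow> (\<exists>z. (\<forall>i<j. z i = x i) \<and> (F z)\<^sup>2 + (G (\<lambda>i. z (\<sigma> i)))\<^sup>2 = 0)"
    proof
      assume "x \<in> A \<inter> B"
      then obtain z z' where z: "\<And>i. i < j \<Longrightarrow> z i = x i" "F z = 0"
        and z': "\<And>i. i < j \<Longrightarrow> z' i = x i" "G z' = 0" unfolding Int_iff F(2) G(2) by blast
      define y where "y i = (if i < K \<or> i < j then z i else z' (i - K))" for i
      have "F y = F z" by (rule bdpoly_nvars_cong[OF F(1)]) (simp add: y_def)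
      moreover have "(\<lambda>i. y (\<sigma> i)) = z'" using z(1) z'(1) by (auto simp: y_def \<sigma>_def fun_eq_iff)
      moreover have "\<forall>i<j. y i = x i" using z(1) by (simp add: y_def)
      ultimately show "\<exists>z. (\<forall>i<j. z i = x i) \<and> (F z)\<^sup>2 + (G (\<lambda>i. z (\<sigma> i)))\<^sup>2 = 0"
        using z(2) z'(2) by (intro exI[of _ y]) simp
    next
      assume "\<exists>z. (\<forall>i<j. z i = x i) \<and> (F z)\<^sup>2 + (G (\<lambda>i. z (\<sigma> i)))\<^sup>2 = 0"
      then obtain z where z: "\<And>i. i < j \<Longrightarrow> z i = x i" "F z = 0" "G (\<lambda>i. z (\<sigma> i)) = 0"
        by (auto simp: sum_power2_eq_zero_iff)
      then have "x \<in> A" unfolding F(2) by blast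
      moreover have "x \<in> B" unfolding G(2) using z by (intro exI[of _ "\<lambda>i. z (\<sigma> i)"]) (simp add: \<sigma>_def)
      ultimately show "x \<in> A \<inter> B" by blast
    qed
  qed
  show "A \<union> B \<in> exsets j (K + K) (2 * D)"
  proof (rule exsetsI)
    show "bdpoly (nvars (K + K)) (2 * D) (\<lambda>z. F z * G (\<lambda>i. z (\<sigma> i)))"
      by (rule bdpoly_mult_le[OF pF pG]) simp
    fix x
    show "x \<in> A \<union> B \<longleftrightarrow> (\<exists>z. (\<forall>i<j. z i = x i) \<and> F z * G (\<lambda>i. z (\<sigma> i)) = 0)"
    proof
      assume "x \<in> A \<union> B"
      then consider z where "\<And>i. i < j \<Longrightarrow> z i = x i" "F z = 0" | z where "\<And>i. i < j \<Longrightarrow> z i = x i" "G z = 0"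
        unfolding Un_iff F(2) G(2) by blast
      then show "\<exists>z. (\<forall>i<j. z i = x i) \<and> F z * G (\<lambda>i. z (\<sigma> i)) = 0"
      proof cases
        case (1 z) then show ?thesis by (intro exI[of _ z]) simp
      next
        case (2 z)
        define y where "y i = (if i < j then z i else z (i - K))" for i
        have "(\<lambda>i. y (\<sigma> i)) = z" by (auto simp: y_def \<sigma>_def fun_eq_iff)
        then show ?thesis using 2 by (intro exI[of _ y]) (simp add: y_def)
      qed
    next
      assume "\<exists>z. (\<forall>i<j. z i = x i) \<and> F z * G (\<lambda>i. z (\<sigma> i)) = 0"
      then obtain z where z: "\<And>i. i < j \<Longrightarrow> z i = x i" "F z = 0 \<or> G (\<lambda>i. z (\<sigma> i)) = 0" by auto
      then show "x \<in> A \<union> B"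
      proof (elim disjE)
        assume "F z = 0"
        then show ?thesis using z(1) F(2) by blast
      next
        assume "G (\<lambda>i. z (\<sigma> i)) = 0"
        then have "x \<in> B" unfolding G(2) using z(1)
          by (intro exI[of _ "\<lambda>i. z (\<sigma> i)"]) (simp add: \<sigma>_def)
        then show ?thesis by blast
      qed
    qed
  qed
qed

lemma exsets_proj:
  assumes "A \<in> exsets (Suc j) K D"
  shows "{x. \<exists>t. x(j := t) \<in> A} \<in> exsets j K D"
proof -
  obtain F where F: "bdpoly (nvars K) D F" "\<And>x. x \<in> A \<longleftrightarrow> (\<exists>z. (\<forall>i<Suc j. z i = x i) \<and> F z = 0)"
    using exsetsE[OF assms] by blast
  show ?thesis
  proof (rule exsetsI[OF F(1)])
    fix x
    show "x \<in> {x. \<exists>t. x(j := t) \<in> A} \<longleftrightarrow> (\<exists>z. (\<forall>i<j. z i = x i) \<and> F z = 0)"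
    proof
      assume "x \<in> {x. \<exists>t. x(j := t) \<in> A}"
      then obtain t z where "\<forall>i<Suc j. z i = (x(j := t)) i" "F z = 0" unfolding F(2) by blast
      then show "\<exists>z. (\<forall>i<j. z i = x i) \<and> F z = 0"
        by (intro exI[of _ z]) (metis fun_upd_other less_Suc_eq less_irrefl)
    next
      assume "\<exists>z. (\<forall>i<j. z i = x i) \<and> F z = 0"
      then obtain z where "\<forall>i<j. z i = x i" "F z = 0" by blast
      then have "x(j := z j) \<in> A" unfolding F(2) by (intro exI[of _ z]) (auto simp: less_Suc_eq)
      then show "x \<in> {x. \<exists>t. x(j := t) \<in> A}" by blast
    qed
  qed
qed

text \<open>The exponential maps onto the positive reals, so a strict inequality is an equation with
  one more variable.\<close>

lemma exsets_less:
  assumes "a < j" "b < j"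
  shows "{x. x a < x b} \<in> exsets j (Suc j) 1"
proof (rule exsetsI)
  show "bdpoly (nvars (Suc j)) 1 (\<lambda>z. z b - z a - exp (z j))"
    using assms by (intro bdpoly_diff bdpoly_nvars_coord bdpoly_nvars_exp) auto
  fix x :: "nat \<Rightarrow> real"
  show "x \<in> {x. x a < x b} \<longleftrightarrow> (\<exists>z. (\<forall>i<j. z i = x i) \<and> z b - z a - exp (z j) = 0)"
  proof
    assume "x \<in> {x. x a < x b}"
    then show "\<exists>z. (\<forall>i<j. z i = x i) \<and> z b - z a - exp (z j) = 0"
      using assms by (intro exI[of _ "x(j := ln (x b - x a))"]) auto
  next
    assume "\<exists>z. (\<forall>i<j. z i = x i) \<and> z b - z a - exp (z j) = 0"
    then obtain z where "\<forall>i<j. z i = x i" "z b - z a = exp (z j)" by auto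
    then have "x b - x a = exp (z j)" using assms by simp
    then show "x \<in> {x. x a < x b}" by (metis diff_gt_0_iff_gt exp_gt_zero mem_Collect_eq)
  qed
qed

lemma exsets_eq:
  assumes "a < j" "b < j"
  shows "{x. x a = x b} \<in> exsets j j 1"
proof (rule exsetsI)
  show "bdpoly (nvars j) 1 (\<lambda>z. z a - z b)"
    using assms by (intro bdpoly_diff bdpoly_nvars_coord) auto
  show "x \<in> {x. x a = x b} \<longleftrightarrow> (\<exists>z. (\<forall>i<j. z i = x i) \<and> z a - z b = 0)" for x :: "nat \<Rightarrow> real"
    using assms by auto
qed

text \<open>The index will be a tuple of parameters, on which the constants of the decomposition
  must not depend.\<close>

definition uniform :: "'i set \<Rightarrow> nat \<Rightarrow> ('i \<Rightarrow> (nat \<Rightarrow> real) set) \<Rightarrow> bool" where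
  "uniform I j f \<longleftrightarrow> (\<exists>K D. \<forall>i\<in>I. f i \<in> exsets j K D)"

lemma uniform_binop:
  assumes "uniform I j f" "uniform I j g"
  shows "uniform I j (\<lambda>i. f i \<inter> g i)" "uniform I j (\<lambda>i. f i \<union> g i)"
proof -
  obtain K D K' D' where "\<forall>i\<in>I. f i \<in> exsets j K D" "\<forall>i\<in>I. g i \<in> exsets j K' D'"
    using assms unfolding uniform_def by blast
  then have "\<forall>i\<in>I. f i \<in> exsets j (max K K') (max D D')" "\<forall>i\<in>I. g i \<in> exsets j (max K K') (max D D')"
    using exsets_mono by (metis max.cobounded1, metis max.cobounded2)
  then show "uniform I j (\<lambda>i. f i \<inter> g i)" "uniform I j (\<lambda>i. f i \<union> g i)"
    unfolding uniform_def using exsets_binop by blast+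
qed

lemma uniform_rename:
  assumes "uniform I j f" "\<And>i. i < j \<Longrightarrow> \<sigma> i < j'"
  shows "uniform I j' (\<lambda>i. {x. (\<lambda>k. x (\<sigma> k)) \<in> f i})"
proof -
  obtain K D where "\<forall>i\<in>I. f i \<in> exsets j K D" using assms(1) unfolding uniform_def by blast
  then show ?thesis unfolding uniform_def
    by (intro exI[of _ "j' + K"] exI[of _ D] ballI exsets_rename[where j = j] assms(2)) auto
qed

lemma uniform_proj:
  assumes "uniform I (Suc j) f"
  shows "uniform I j (\<lambda>i. {x. \<exists>t. x(j := t) \<in> f i})"
  using assms exsets_proj unfolding uniform_def by blast

lemma uniform_less: "a < j \<Longrightarrow> b < j \<Longrightarrow> uniform I j (\<lambda>i. {x. x a < x b})"
  unfolding uniform_def using exsets_less by blast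

lemma uniform_eq: "a < j \<Longrightarrow> b < j \<Longrightarrow> uniform I j (\<lambda>i. {x. x a = x b})"
  unfolding uniform_def using exsets_eq by blast

lemma uniform_le: "a < j \<Longrightarrow> b < j \<Longrightarrow> uniform I j (\<lambda>i. {x. x a \<le> x b})"
  using uniform_binop(2)[OF uniform_less uniform_eq, of a j b a b I]
  by (simp add: Un_def le_less)

lemma uniform_UNIV: "uniform I j (\<lambda>i. UNIV)"
proof -
  have "UNIV \<in> exsets j 0 0"
    by (rule exsetsI[OF bdpoly.const[of _ _ 0]]) (auto intro: exI)
  then show ?thesis unfolding uniform_def by blast
qed

section \<open>Counting the points of a fibre\<close>

definition fib :: "nat \<Rightarrow> (nat \<Rightarrow> real) set \<Rightarrow> (nat \<Rightarrow> real) \<Rightarrow> real set" where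
  "fib j A x = {t. x(j := t) \<in> A}"

text \<open>Only lower bounds on numbers of points are formed, since these can be written
  existentially; they also make sense for infinite fibres.\<close>

definition atleast :: "nat \<Rightarrow> real set \<Rightarrow> bool" where
  "atleast n S \<longleftrightarrow> (\<exists>T\<subseteq>S. finite T \<and> card T = n)"

lemma atleast_finite: "finite S \<Longrightarrow> atleast n S \<longleftrightarrow> n \<le> card S"
  unfolding atleast_def by (metis card_mono obtain_subset_with_card_n)

text \<open>Splitting off the least point yields a recursion that quantifies over one point and
  counts the points above it.\<close>

lemma atleast_Suc: "atleast (Suc n) S \<longleftrightarrow> (\<exists>t\<in>S. atleast n {s \<in> S. t < s})"
proof
  assume "atleast (Suc n) S"
  then obtain T where T: "T \<subseteq> S" "finite T" "card T = Suc n" unfolding atleast_def by blast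
  then have ne: "T \<noteq> {}" by auto
  have "T - {Min T} \<subseteq> {s \<in> S. Min T < s}" using T(1,2) by (auto simp: order.not_eq_order_implies_strict)
  moreover have "Min T \<in> S" using T ne Min_in by blast
  moreover have "card (T - {Min T}) = n" using T ne by simp
  ultimately show "\<exists>t\<in>S. atleast n {s \<in> S. t < s}"
    using T(2) unfolding atleast_def by (intro bexI[of _ "Min T"] exI[of _ "T - {Min T}"]) auto
next
  assume "\<exists>t\<in>S. atleast n {s \<in> S. t < s}"
  then obtain t T where t: "t \<in> S" "T \<subseteq> {s \<in> S. t < s}" "finite T" "card T = n"
    unfolding atleast_def by blast
  then have "t \<notin> T" by auto
  then show "atleast (Suc n) S" unfolding atleast_def
    using t by (intro exI[of _ "insert t T"]) auto
qed

text \<open>In \<open>\<real>\<^bsup>j+2\<^esup>\<close> the coordinate \<open>j + 1\<close> runs over the fibre and is compared with the coordinate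
  \<open>j\<close> by \<open>rel\<close>.\<close>

lemma uniform_fib_rel:
  assumes "uniform I (Suc j) f" "uniform I (Suc (Suc j)) (\<lambda>i. {w. rel (w (Suc j)) (w j)})"
  shows "\<exists>g. uniform I (Suc (Suc j)) g \<and>
    (\<forall>i\<in>I. \<forall>y. fib (Suc j) (g i) y = {t \<in> fib j (f i) y. rel t (y j)})"
proof -
  define g where "g i = {w. (\<lambda>k. w (if k = j then Suc j else k)) \<in> f i} \<inter> {w. rel (w (Suc j)) (w j)}" for i
  obtain K D where KD: "\<And>i. i \<in> I \<Longrightarrow> f i \<in> exsets (Suc j) K D" using assms(1) unfolding uniform_def by blast
  have "uniform I (Suc (Suc j)) g"
    unfolding g_def by (rule uniform_binop(1)[OF uniform_rename[OF assms(1)] assms(2)]) auto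
  moreover have "fib (Suc j) (g i) y = {t \<in> fib j (f i) y. rel t (y j)}" if "i \<in> I" for i y
  proof -
    have "(\<lambda>k. (y(Suc j := t)) (if k = j then Suc j else k)) \<in> f i \<longleftrightarrow> y(j := t) \<in> f i" for t
      by (rule exsets_cong[OF KD[OF that]]) auto
    then show ?thesis unfolding fib_def g_def by simp
  qed
  ultimately show ?thesis by blast
qed

text \<open>Induction with \<open>j\<close> arbitrary: the least point is kept as coordinate
  \<open>j\<close>, and the points above it form a fibre in the next dimension, to which the case
  \<open>n\<close> applies.\<close>

lemma uniform_atleast:
  assumes "uniform I (Suc j) f"
  shows "uniform I j (\<lambda>i. {x. atleast n (fib j (f i) x)})"
  using assms
proof (induction n arbitrary: j f)
  case 0
  have "atleast 0 S" for S unfolding atleast_def by auto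
  then show ?case using uniform_UNIV by simp
next
  case (Suc n)
  obtain g where g: "uniform I (Suc (Suc j)) g"
      "\<And>i y. i \<in> I \<Longrightarrow> fib (Suc j) (g i) y = {t \<in> fib j (f i) y. y j < t}"
    using uniform_fib_rel[OF Suc.prems, of "\<lambda>a b. b < a"] uniform_less[of j "Suc (Suc j)" "Suc j" I] by auto
  have "uniform I (Suc j) (\<lambda>i. f i \<inter> {y. atleast n (fib (Suc j) (g i) y)})"
    by (rule uniform_binop(1)[OF Suc.prems Suc.IH[OF g(1)]])
  from uniform_proj[OF this]
  have u: "uniform I j (\<lambda>i. {x. \<exists>t. x(j := t) \<in> f i \<inter> {y. atleast n (fib (Suc j) (g i) y)}})" .
  have "{x. \<exists>t. x(j := t) \<in> f i \<inter> {y. atleast n (fib (Suc j) (g i) y)}} = {x. atleast (Suc n) (fib j (f i) x)}"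
    if "i \<in> I" for i
    unfolding atleast_Suc using g(2)[OF that] by (auto simp: fib_def)
  then show ?case using u unfolding uniform_def by auto
qed

lemma uniform_atleast_rel:
  assumes "uniform I (Suc j) f" "uniform I (Suc (Suc j)) (\<lambda>i. {w. rel (w (Suc j)) (w j)})"
  shows "uniform I (Suc j) (\<lambda>i. {y. atleast n {t \<in> fib j (f i) y. rel t (y j)}})"
proof -
  obtain g where g: "uniform I (Suc (Suc j)) g"
      "\<And>i y. i \<in> I \<Longrightarrow> fib (Suc j) (g i) y = {t \<in> fib j (f i) y. rel t (y j)}"
    using uniform_fib_rel[OF assms] by blast
  show ?thesis using uniform_atleast[OF g(1), of n] g(2) unfolding uniform_def by auto
qed

section \<open>Labels and vertical cells\<close>

text \<open>In the application \<open>S1\<close>, \<open>S3\<close> and \<open>T1\<close>,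
  \<open>T3\<close> are the fibres of two sets over two lines, and \<open>a\<close>,
  \<open>b\<close> are points on these lines. By \<open>nb\<close> the last point of
  \<open>S1\<close> below \<open>a\<close> has all points of \<open>S3\<close> below
  \<open>a\<close> on its left. Its rank is expressed by two lower bounds that add up to all other
  points of \<open>S1\<close>; as \<open>T1\<close> has the same size, they pin down the rank of the
  point to which the statement is transferred. An abstract linear order is used so that the mirror
  image follows by passing to the dual order.\<close>

lemma (in linorder) neighbour_count:
  assumes fin: "finite S1" "finite S3" "finite T1" "finite T3"
    and card1: "card S1 = card T1" "card {s \<in> S1. s < a} = card {t \<in> T1. t < b}"
    and ab: "a \<notin> S1" "b \<notin> T1"
    and nb: "\<And>s. s \<in> S3 \<Longrightarrow> s < a \<Longrightarrow> \<exists>u\<in>S1. s \<le> u \<and> u < a"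
    and tr: "\<And>r s l. r \<le> card S1 \<Longrightarrow> s \<le> card S1 \<Longrightarrow> l \<le> card S3 \<Longrightarrow>
      \<exists>u\<in>S1. r \<le> card {x \<in> S1. x < u} \<and> s \<le> card {x \<in> S1. u < x} \<and> l \<le> card {x \<in> S3. x \<le> u} \<Longrightarrow>
      \<exists>u\<in>T1. r \<le> card {x \<in> T1. x < u} \<and> s \<le> card {x \<in> T1. u < x} \<and> l \<le> card {x \<in> T3. x \<le> u}"
  shows "card {s \<in> S3. s < a} \<le> card {t \<in> T3. t < b}"
proof (cases "{s \<in> S1. s < a} = {}")
  case True
  then have "{s \<in> S3. s < a} = {}" using nb by blast
  then show ?thesis by (metis card.empty le0)
next
  case False
  define i where "i = card {s \<in> S1. s < a}"
  define n where "n = card S1"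
  define u1 where "u1 = Max {s \<in> S1. s < a}"
  have f: "finite {s \<in> S1. s < a}" using fin by simp
  have u1: "u1 \<in> S1" "u1 < a" "\<And>s. s \<in> S1 \<Longrightarrow> s < a \<Longrightarrow> s \<le> u1"
    using Max_in[OF f False] Max_ge[OF f] unfolding u1_def by auto
  have "i > 0" unfolding i_def using False f by (simp add: card_gt_0_iff)
  have tot: "i + card {s \<in> S1. a < s} = n"
  proof -
    have "S1 = {s \<in> S1. s < a} \<union> {s \<in> S1. a < s}" using ab neq_iff by blast
    moreover have "{s \<in> S1. s < a} \<inter> {s \<in> S1. a < s} = {}" by auto
    ultimately show ?thesis unfolding i_def n_def using fin by (metis card_Un_disjoint finite_Un)
  qed
  have "{x \<in> S1. x < u1} = {s \<in> S1. s < a} - {u1}" using u1 by (auto simp: le_less)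
  then have r: "card {x \<in> S1. x < u1} = i - 1" unfolding i_def using u1 f by simp
  have "{x \<in> S1. u1 < x} = {x \<in> S1. a < x}"
  proof (rule Collect_cong)
    fix x show "x \<in> S1 \<and> u1 < x \<longleftrightarrow> x \<in> S1 \<and> a < x"
      using u1(2) u1(3)[of x] ab(1) by (metis less_trans neq_iff not_le)
  qed
  then have s: "card {x \<in> S1. u1 < x} = n - i" using tot by simp
  have "{x \<in> S3. x \<le> u1} = {x \<in> S3. x < a}"
  proof (rule Collect_cong)
    fix x show "x \<in> S3 \<and> x \<le> u1 \<longleftrightarrow> x \<in> S3 \<and> x < a"
      using u1 nb[of x] by (meson le_less_trans order_trans)
  qed
  then have l: "card {x \<in> S3. x \<le> u1} = card {x \<in> S3. x < a}" by simp
  have "card {x \<in> S3. x < a} \<le> card S3" using fin by (intro card_mono) auto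
  moreover have "i \<le> n" using tot by simp
  moreover have "i - 1 \<le> n" "n - i \<le> n" using tot by linarith+
  moreover have "\<exists>u\<in>S1. i - 1 \<le> card {x \<in> S1. x < u} \<and> n - i \<le> card {x \<in> S1. u < x} \<and>
      card {x \<in> S3. x < a} \<le> card {x \<in> S3. x \<le> u}"
    using u1(1) r s l by (intro bexI[of _ u1]) auto
  ultimately obtain u where u: "u \<in> T1" "i - 1 \<le> card {x \<in> T1. x < u}" "n - i \<le> card {x \<in> T1. u < x}"
    "card {x \<in> S3. x < a} \<le> card {x \<in> T3. x \<le> u}"
    using tr[of "i - 1" "n - i" "card {x \<in> S3. x < a}"] unfolding n_def by auto
  \<comment> \<open>A point of \<open>T1\<close> above \<open>b\<close> would have at least
    \<open>i\<close> points below it and \<open>n - i\<close> above it, which together with the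
    point itself is more than \<open>n\<close>.\<close>
  have "u < b"
  proof (rule ccontr)
    assume "\<not> u < b"
    then have "b < u" using ab(2) u(1) by (metis neqE)
    then have "{t \<in> T1. t < b} \<subseteq> {x \<in> T1. x < u}" by auto
    then have "i \<le> card {x \<in> T1. x < u}"
      unfolding i_def card1(2) using fin by (intro card_mono) auto
    moreover have "card {x \<in> T1. x < u} + card {x \<in> T1. u < x} + 1 = n"
    proof -
      have "T1 = insert u ({x \<in> T1. x < u} \<union> {x \<in> T1. u < x})" using u(1) by auto
      then have "card T1 = card (insert u ({x \<in> T1. x < u} \<union> {x \<in> T1. u < x}))" by simp
      also have "\<dots> = Suc (card ({x \<in> T1. x < u} \<union> {x \<in> T1. u < x}))"
        using fin by (subst card_insert_disjoint) auto
      also have "card ({x \<in> T1. x < u} \<union> {x \<in> T1. u < x}) = card {x \<in> T1. x < u} + card {x \<in> T1. u < x}"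
        using fin by (intro card_Un_disjoint) auto
      finally show ?thesis unfolding n_def card1 by simp
    qed
    ultimately show False using u(3) \<open>i \<le> n\<close> by linarith
  qed
  then have "{x \<in> T3. x \<le> u} \<subseteq> {t \<in> T3. t < b}" by auto
  then have "card {x \<in> T3. x \<le> u} \<le> card {t \<in> T3. t < b}" using fin by (intro card_mono) auto
  then show ?thesis using u(4) by simp
qed

text \<open>The maximum of all points below \<open>a\<close> lies in one of the sets; if there are
  no such points, any member of \<open>S\<close> will do.\<close>

lemma (in linorder) exists_neighbour:
  assumes "finite S" "S \<noteq> {}" "\<And>A. A \<in> S \<Longrightarrow> finite (f A)"
  shows "\<exists>A1\<in>S. \<forall>A\<in>S. \<forall>t\<in>f A. t < a \<longrightarrow> (\<exists>u\<in>f A1. t \<le> u \<and> u < a)"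
proof (cases "{t \<in> (\<Union>A\<in>S. f A). t < a} = {}")
  case True
  then show ?thesis using assms(2) by blast
next
  case False
  have fin: "finite {t \<in> (\<Union>A\<in>S. f A). t < a}" using assms by auto
  define m where "m = Max {t \<in> (\<Union>A\<in>S. f A). t < a}"
  have "m \<in> {t \<in> (\<Union>A\<in>S. f A). t < a}" unfolding m_def using Max_in[OF fin False] .
  then obtain A1 where "A1 \<in> S" "m \<in> f A1" "m < a" by auto
  moreover have "t \<le> m" if "A \<in> S" "t \<in> f A" "t < a" for A t
    unfolding m_def using Max_ge[OF fin] that by auto
  ultimately show ?thesis by blast
qed

lemma neighbour_count_dual:
  fixes a b :: "'a::linorder"
  assumes "finite S1" "finite S3" "finite T1" "finite T3"
    "card S1 = card T1" "card {s \<in> S1. a < s} = card {t \<in> T1. b < t}" "a \<notin> S1" "b \<notin> T1"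
    "\<And>s. s \<in> S3 \<Longrightarrow> a < s \<Longrightarrow> \<exists>u\<in>S1. u \<le> s \<and> a < u"
    "\<And>r s l. r \<le> card S1 \<Longrightarrow> s \<le> card S1 \<Longrightarrow> l \<le> card S3 \<Longrightarrow>
      \<exists>u\<in>S1. r \<le> card {x \<in> S1. u < x} \<and> s \<le> card {x \<in> S1. x < u} \<and> l \<le> card {x \<in> S3. u \<le> x} \<Longrightarrow>
      \<exists>u\<in>T1. r \<le> card {x \<in> T1. u < x} \<and> s \<le> card {x \<in> T1. x < u} \<and> l \<le> card {x \<in> T3. u \<le> x}"
  shows "card {s \<in> S3. a < s} \<le> card {t \<in> T3. b < t}"
  by (rule linorder.neighbour_count[OF dual_linorder assms])

lemma exists_neighbour_dual:
  fixes a :: "'a::linorder"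
  assumes "finite S" "S \<noteq> {}" "\<And>A. A \<in> S \<Longrightarrow> finite (f A)"
  shows "\<exists>A1\<in>S. \<forall>A\<in>S. \<forall>t\<in>f A. a < t \<longrightarrow> (\<exists>u\<in>f A1. u \<le> t \<and> a < u)"
  by (rule linorder.exists_neighbour[OF dual_linorder assms])

section \<open>Labels of lines\<close>

definition cntset :: "nat \<Rightarrow> (nat \<Rightarrow> real) set \<Rightarrow> nat \<Rightarrow> (nat \<Rightarrow> real) set" where
  "cntset j B n = {x. atleast n (fib j B x)}"

definition relset :: "nat \<Rightarrow> (nat \<Rightarrow> real) set \<Rightarrow> (nat \<Rightarrow> real) set \<Rightarrow> nat \<Rightarrow> nat \<Rightarrow>
    (real \<Rightarrow> real \<Rightarrow> bool) \<Rightarrow> (nat \<Rightarrow> real) set \<Rightarrow> nat \<Rightarrow> (nat \<Rightarrow> real) set" where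
  "relset j A B r s rel C l = {x. \<exists>u\<in>fib j A x. atleast r {t \<in> fib j B x. t < u} \<and>
     atleast s {t \<in> fib j B x. u < t} \<and> atleast l {t \<in> fib j C x. rel t u}}"

lemma uniform_if:
  "uniform I j f \<Longrightarrow> uniform I j g \<Longrightarrow> uniform I j (\<lambda>i. if b then f i else g i)"
  by (cases b) simp_all

lemma uniform_cntset:
  "uniform I (Suc j) f \<Longrightarrow> uniform I j (\<lambda>i. cntset j (f i) n)"
  unfolding cntset_def by (rule uniform_atleast)

lemma uniform_relset:
  assumes "uniform I (Suc j) f" "uniform I (Suc j) g" "uniform I (Suc j) h"
    and rel: "rel = (\<le>) \<or> rel = (\<ge>)"
  shows "uniform I j (\<lambda>i. relset j (f i) (g i) r s rel (h i) l)"
proof -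
  have r: "uniform I (Suc (Suc j)) (\<lambda>i. {w. rel (w (Suc j)) (w j)})"
    using rel uniform_le[of "Suc j" "Suc (Suc j)" j I] uniform_le[of j "Suc (Suc j)" "Suc j" I] by auto
  have 1: "uniform I (Suc j) (\<lambda>i. {y. atleast r {t \<in> fib j (g i) y. t < y j}})"
    by (rule uniform_atleast_rel[OF assms(2), of "(<)"]) (rule uniform_less; simp)
  have 2: "uniform I (Suc j) (\<lambda>i. {y. atleast s {t \<in> fib j (g i) y. y j < t}})"
    by (rule uniform_atleast_rel[OF assms(2), of "\<lambda>a b. b < a"]) (rule uniform_less; simp)
  have 3: "uniform I (Suc j) (\<lambda>i. {y. atleast l {t \<in> fib j (h i) y. rel t (y j)}})"
    by (rule uniform_atleast_rel[OF assms(3) r])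
  have "uniform I (Suc j) (\<lambda>i. (f i \<inter> {y. atleast r {t \<in> fib j (g i) y. t < y j}}) \<inter>
     ({y. atleast s {t \<in> fib j (g i) y. y j < t}} \<inter> {y. atleast l {t \<in> fib j (h i) y. rel t (y j)}}))"
    by (intro uniform_binop(1) assms(1) 1 2 3)
  from uniform_proj[OF this] show ?thesis
    unfolding relset_def fib_def by (simp add: conj_assoc Bex_def)
qed

text \<open>What has to be known about the fibres over a line, as sets that do not involve
  coordinate \<open>j\<close>. Labels 0, 1, 2 give the sizes of the three fibres. Labels 3 and 4
  place the third fibre relative to the points of the lower neighbour \<open>B1\<close> and of the
  upper neighbour \<open>B2\<close>. Label 5, with \<open>r\<close> and \<open>s\<close> adding up
  to the size of the fibre of \<open>B3\<close>, says that a certain gap of this fibre contains a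
  point of \<open>A\<close>; the bound 0 there is always met.\<close>

definition labset :: "nat \<Rightarrow> nat \<times> nat \<times> nat \<times> nat \<Rightarrow> (nat \<Rightarrow> real) set \<Rightarrow> (nat \<Rightarrow> real) set \<Rightarrow>
    (nat \<Rightarrow> real) set \<Rightarrow> (nat \<Rightarrow> real) set \<Rightarrow> (nat \<Rightarrow> real) set" where
  "labset j = (\<lambda>(c, r, s, l) B1 B2 B3 A.
     if c = 0 then cntset j B1 r else if c = 1 then cntset j B2 r else if c = 2 then cntset j B3 r
     else if c = 3 then relset j B1 B1 r s (\<le>) B3 l
     else if c = 4 then relset j B2 B2 r s (\<ge>) B3 l
     else relset j A B3 r s (\<le>) A 0)"

definition lab_idx :: "nat \<Rightarrow> (nat \<times> nat \<times> nat \<times> nat) set" where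
  "lab_idx N = {..<6} \<times> {..Suc N} \<times> {..Suc N} \<times> {..Suc N}"

lemma uniform_labset:
  fixes I :: "(nat \<Rightarrow> real) set set"
  assumes "I = exsets (Suc j) K D"
  shows "\<exists>K' D'. \<forall>c\<in>lab_idx N. \<forall>B1\<in>I. \<forall>B2\<in>I. \<forall>B3\<in>I. \<forall>A\<in>I. labset j c B1 B2 B3 A \<in> exsets j K' D'"
proof -
  define J where "J = I \<times> I \<times> I \<times> I"
  have u: "uniform J (Suc j) (\<lambda>i. fst i)" "uniform J (Suc j) (\<lambda>i. fst (snd i))"
    "uniform J (Suc j) (\<lambda>i. fst (snd (snd i)))" "uniform J (Suc j) (\<lambda>i. snd (snd (snd i)))"
    unfolding uniform_def J_def assms by auto
  have "uniform J j (\<lambda>i. labset j c (fst i) (fst (snd i)) (fst (snd (snd i))) (snd (snd (snd i))))" for c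
  proof (cases c)
    case (fields a r s l)
    show ?thesis unfolding labset_def fields prod.case
      by (intro uniform_if uniform_cntset uniform_relset u) auto
  qed
  then have "\<exists>K D. \<forall>i\<in>J. labset j c (fst i) (fst (snd i)) (fst (snd (snd i))) (snd (snd (snd i))) \<in> exsets j K D" for c
    unfolding uniform_def by blast
  then obtain K D where KD: "\<And>c i. i \<in> J \<Longrightarrow>
      labset j c (fst i) (fst (snd i)) (fst (snd (snd i))) (snd (snd (snd i))) \<in> exsets j (K c) (D c)"
    by metis
  have fin: "finite (lab_idx N)" unfolding lab_idx_def by simp
  have "labset j c B1 B2 B3 A \<in> exsets j (Max (K ` lab_idx N)) (Max (D ` lab_idx N))"
    if "c \<in> lab_idx N" "B1 \<in> I" "B2 \<in> I" "B3 \<in> I" "A \<in> I" for c B1 B2 B3 A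
    using exsets_mono[OF KD[of "(B1, B2, B3, A)" c]] that fin by (auto simp: J_def)
  then show ?thesis by blast
qed

definition idx :: "nat \<Rightarrow> (nat \<Rightarrow> real) set \<Rightarrow> (nat \<Rightarrow> real) \<Rightarrow> nat" where
  "idx j B x = card {t \<in> fib j B x. t < x j}"

definition upx :: "nat \<Rightarrow> (nat \<Rightarrow> real) set \<Rightarrow> (nat \<Rightarrow> real) \<Rightarrow> nat" where
  "upx j B x = card {t \<in> fib j B x. x j < t}"

definition fib_ok :: "nat \<Rightarrow> nat \<Rightarrow> (nat \<Rightarrow> real) set \<Rightarrow> (nat \<Rightarrow> real) \<Rightarrow> bool" where
  "fib_ok j N B x \<longleftrightarrow> finite (fib j B x) \<and> card (fib j B x) \<le> N \<and> x j \<notin> fib j B x"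

definition same_labels where
  "same_labels j N B1 B2 B3 A p q \<longleftrightarrow>
     (\<forall>c\<in>lab_idx N. p \<in> labset j c B1 B2 B3 A \<longleftrightarrow> q \<in> labset j c B1 B2 B3 A)"

lemma idx_upx: "fib_ok j N B x \<Longrightarrow> idx j B x + upx j B x = card (fib j B x)"
proof -
  assume ok: "fib_ok j N B x"
  then have "fib j B x = {t \<in> fib j B x. t < x j} \<union> {t \<in> fib j B x. x j < t}"
    unfolding fib_ok_def using neq_iff by blast
  moreover have "{t \<in> fib j B x. t < x j} \<inter> {t \<in> fib j B x. x j < t} = {}" by auto
  ultimately show ?thesis using ok unfolding idx_def upx_def fib_ok_def
    by (metis (no_types, lifting) card_Un_disjoint finite_Un)
qed

lemma idx_le: "fib_ok j N B x \<Longrightarrow> idx j B x \<le> N"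
  using idx_upx[of j N B x] unfolding fib_ok_def by linarith

lemma same_labels_sym: "same_labels j N B1 B2 B3 A p q \<Longrightarrow> same_labels j N B1 B2 B3 A q p"
  unfolding same_labels_def by blast

lemma same_labelsD:
  assumes "same_labels j N B1 B2 B3 A p q" "r \<le> Suc N" "s \<le> N" "l \<le> N"
  shows "p \<in> cntset j B1 r \<longleftrightarrow> q \<in> cntset j B1 r" "p \<in> cntset j B2 r \<longleftrightarrow> q \<in> cntset j B2 r"
    "p \<in> cntset j B3 r \<longleftrightarrow> q \<in> cntset j B3 r"
    "p \<in> relset j B1 B1 r s (\<le>) B3 l \<longleftrightarrow> q \<in> relset j B1 B1 r s (\<le>) B3 l"
    "p \<in> relset j B2 B2 r s (\<ge>) B3 l \<longleftrightarrow> q \<in> relset j B2 B2 r s (\<ge>) B3 l"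
    "p \<in> relset j A B3 r s (\<le>) A 0 \<longleftrightarrow> q \<in> relset j A B3 r s (\<le>) A 0"
proof -
  have *: "p \<in> labset j (c, r, s, l) B1 B2 B3 A \<longleftrightarrow> q \<in> labset j (c, r, s, l) B1 B2 B3 A" if "c < 6" for c
    using assms that unfolding same_labels_def lab_idx_def by auto
  show "p \<in> cntset j B1 r \<longleftrightarrow> q \<in> cntset j B1 r" "p \<in> cntset j B2 r \<longleftrightarrow> q \<in> cntset j B2 r"
    "p \<in> cntset j B3 r \<longleftrightarrow> q \<in> cntset j B3 r"
    "p \<in> relset j B1 B1 r s (\<le>) B3 l \<longleftrightarrow> q \<in> relset j B1 B1 r s (\<le>) B3 l"
    "p \<in> relset j B2 B2 r s (\<ge>) B3 l \<longleftrightarrow> q \<in> relset j B2 B2 r s (\<ge>) B3 l"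
    "p \<in> relset j A B3 r s (\<le>) A 0 \<longleftrightarrow> q \<in> relset j A B3 r s (\<le>) A 0"
    using *[of 0] *[of 1] *[of 2] *[of 3] *[of 4] *[of 5] unfolding labset_def by simp_all
qed

lemma cntset_card_eq:
  assumes "\<And>r. r \<le> Suc N \<Longrightarrow> p \<in> cntset j B r \<longleftrightarrow> q \<in> cntset j B r" "fib_ok j N B p" "fib_ok j N B q"
  shows "card (fib j B p) = card (fib j B q)"
proof -
  have le: "r \<le> card (fib j B p) \<longleftrightarrow> r \<le> card (fib j B q)" if "r \<le> Suc N" for r
    using assms(1)[OF that] assms(2,3) unfolding cntset_def fib_ok_def by (simp add: atleast_finite)
  have "card (fib j B p) \<le> N" "card (fib j B q) \<le> N" using assms(2,3) unfolding fib_ok_def by auto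
  then show ?thesis using le[of "card (fib j B p)"] le[of "card (fib j B q)"] by linarith
qed

lemma relset_iff:
  assumes "fib_ok j N B x" "fib_ok j N C x"
  shows "x \<in> relset j A B r s rel C l \<longleftrightarrow> (\<exists>u\<in>fib j A x. r \<le> card {t \<in> fib j B x. t < u} \<and>
     s \<le> card {t \<in> fib j B x. u < t} \<and> l \<le> card {t \<in> fib j C x. rel t u})"
  using assms unfolding relset_def fib_ok_def by (simp add: atleast_finite)

text \<open>The lower neighbour gives \<open>idx j B3 p \<le> idx j B3 q\<close>, the upper one
  \<open>upx j B3 p \<le> upx j B3 q\<close>. Both sums equal the common size of the fibres, so both
  are equalities.\<close>

lemma idx_eq:
  assumes sl: "same_labels j N B1 B2 B3 A p q"
    and p: "fib_ok j N B1 p" "fib_ok j N B2 p" "fib_ok j N B3 p"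
    and q: "fib_ok j N B1 q" "fib_ok j N B2 q" "fib_ok j N B3 q"
    and eq: "idx j B1 p = idx j B1 q" "idx j B2 p = idx j B2 q"
    and lo: "\<And>t. t \<in> fib j B3 p \<Longrightarrow> t < p j \<Longrightarrow> \<exists>u\<in>fib j B1 p. t \<le> u \<and> u < p j"
    and hi: "\<And>t. t \<in> fib j B3 p \<Longrightarrow> p j < t \<Longrightarrow> \<exists>u\<in>fib j B2 p. u \<le> t \<and> p j < u"
  shows "idx j B3 p = idx j B3 q" "upx j B3 p = upx j B3 q"
proof -
  note D = same_labelsD[OF sl]
  have c1: "card (fib j B1 p) = card (fib j B1 q)"
    by (rule cntset_card_eq[OF D(1)[of _ 0 0] p(1) q(1)]) auto
  have c2: "card (fib j B2 p) = card (fib j B2 q)"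
    by (rule cntset_card_eq[OF D(2)[of _ 0 0] p(2) q(2)]) auto
  have c3: "card (fib j B3 p) = card (fib j B3 q)"
    by (rule cntset_card_eq[OF D(3)[of _ 0 0] p(3) q(3)]) auto
  have fp: "finite (fib j B1 p)" "finite (fib j B2 p)" "finite (fib j B3 p)" "p j \<notin> fib j B1 p" "p j \<notin> fib j B2 p"
    "card (fib j B1 p) \<le> N" "card (fib j B2 p) \<le> N" "card (fib j B3 p) \<le> N"
    using p unfolding fib_ok_def by auto
  have fq: "finite (fib j B1 q)" "finite (fib j B2 q)" "finite (fib j B3 q)" "q j \<notin> fib j B1 q" "q j \<notin> fib j B2 q"
    using q unfolding fib_ok_def by auto
  have up2: "upx j B2 p = upx j B2 q" using idx_upx[OF p(2)] idx_upx[OF q(2)] c2 eq(2) by linarith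
  have "idx j B3 p \<le> idx j B3 q"
    unfolding idx_def
  proof (rule neighbour_count[OF fp(1,3) fq(1,3) c1 eq(1)[unfolded idx_def] fp(4) fq(4) lo])
    fix r s l assume "r \<le> card (fib j B1 p)" "s \<le> card (fib j B1 p)" "l \<le> card (fib j B3 p)"
      and ex: "\<exists>u\<in>fib j B1 p. r \<le> card {x \<in> fib j B1 p. x < u} \<and> s \<le> card {x \<in> fib j B1 p. u < x} \<and> l \<le> card {x \<in> fib j B3 p. x \<le> u}"
    then have "r \<le> Suc N" "s \<le> N" "l \<le> N" using fp by auto
    from D(4)[OF this] ex
    show "\<exists>u\<in>fib j B1 q. r \<le> card {x \<in> fib j B1 q. x < u} \<and> s \<le> card {x \<in> fib j B1 q. u < x} \<and> l \<le> card {x \<in> fib j B3 q. x \<le> u}"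
      unfolding relset_iff[OF p(1,3)] relset_iff[OF q(1,3)] by blast
  qed
  moreover have "upx j B3 p \<le> upx j B3 q"
    unfolding upx_def
  proof (rule neighbour_count_dual[OF fp(2,3) fq(2,3) c2 up2[unfolded upx_def] fp(5) fq(5) hi])
    fix r s l assume "r \<le> card (fib j B2 p)" "s \<le> card (fib j B2 p)" "l \<le> card (fib j B3 p)"
      and ex: "\<exists>u\<in>fib j B2 p. r \<le> card {x \<in> fib j B2 p. u < x} \<and> s \<le> card {x \<in> fib j B2 p. x < u} \<and> l \<le> card {x \<in> fib j B3 p. u \<le> x}"
    then have "s \<le> Suc N" "r \<le> N" "l \<le> N" using fp by auto
    from D(5)[OF this] ex
    show "\<exists>u\<in>fib j B2 q. r \<le> card {x \<in> fib j B2 q. u < x} \<and> s \<le> card {x \<in> fib j B2 q. x < u} \<and> l \<le> card {x \<in> fib j B3 q. u \<le> x}"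
      unfolding relset_iff[OF p(2,3)] relset_iff[OF q(2,3)] by blast
  qed
  ultimately show "idx j B3 p = idx j B3 q" "upx j B3 p = upx j B3 q"
    using idx_upx[OF p(3)] idx_upx[OF q(3)] c3 by linarith+
qed

text \<open>Label 5 holds at \<open>p\<close> with \<open>p j\<close> as the witness, and its
  transfer to \<open>q\<close> puts a point \<open>u\<close> of \<open>A\<close> into the gap of
  \<open>B3\<close> that contains \<open>q j\<close>. If \<open>q\<close> were not in
  \<open>A\<close>, the fibre of \<open>B3\<close> would have a point between \<open>u\<close> and
  \<open>q j\<close>.\<close>

lemma in_set_transfer:
  assumes sl: "same_labels j N B1 B2 B3 A p q" and p: "fib_ok j N B3 p" and q: "fib_ok j N B3 q"
    and eq: "idx j B3 p = idx j B3 q" "upx j B3 p = upx j B3 q"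
    and cross: "\<And>s t. q(j := s) \<in> A \<Longrightarrow> q(j := t) \<notin> A \<Longrightarrow> \<exists>b\<in>closed_segment s t. b \<in> fib j B3 q"
    and "p \<in> A"
  shows "q \<in> A"
proof (rule ccontr)
  assume qA: "q \<notin> A"
  have "idx j B3 p \<le> Suc N" "upx j B3 p \<le> N"
    using idx_upx[OF p] p unfolding fib_ok_def by linarith+
  note D = same_labelsD(6)[OF sl this le0]
  have "p j \<in> fib j A p" using \<open>p \<in> A\<close> unfolding fib_def by simp
  moreover have "atleast 0 S" for S unfolding atleast_def by auto
  moreover have "atleast (idx j B3 p) {t \<in> fib j B3 p. t < p j}" "atleast (upx j B3 p) {t \<in> fib j B3 p. p j < t}"
    using p unfolding fib_ok_def idx_def upx_def by (simp_all add: atleast_finite)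
  ultimately have "p \<in> relset j A B3 (idx j B3 p) (upx j B3 p) (\<le>) A 0"
    unfolding relset_def by blast
  then have "q \<in> relset j A B3 (idx j B3 p) (upx j B3 p) (\<le>) A 0" using D by blast
  then obtain u where u: "u \<in> fib j A q" "atleast (idx j B3 q) {t \<in> fib j B3 q. t < u}"
    "atleast (upx j B3 q) {t \<in> fib j B3 q. u < t}"
    unfolding relset_def eq by blast
  have fin: "finite (fib j B3 q)" "q j \<notin> fib j B3 q" using q unfolding fib_ok_def by auto
  have c: "idx j B3 q \<le> card {t \<in> fib j B3 q. t < u}" "upx j B3 q \<le> card {t \<in> fib j B3 q. u < t}"
    using u(2,3) fin by (simp_all add: atleast_finite)
  have "q(j := q j) \<notin> A" using qA by simp
  then obtain b where b: "b \<in> closed_segment u (q j)" "b \<in> fib j B3 q"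
    using cross[of u "q j"] u(1) unfolding fib_def by blast
  have "b \<noteq> q j" using b(2) fin(2) by blast
  show False
  proof (cases "u \<le> q j")
    case True
    then have "u \<le> b" "b < q j" using b(1) \<open>b \<noteq> q j\<close> by (auto simp: closed_segment_eq_real_ivl)
    then have "b \<in> {t \<in> fib j B3 q. t < q j}" "b \<notin> {t \<in> fib j B3 q. t < u}" using b(2) by auto
    moreover have "{t \<in> fib j B3 q. t < u} \<subseteq> {t \<in> fib j B3 q. t < q j}" using True by auto
    ultimately have "{t \<in> fib j B3 q. t < u} \<subset> {t \<in> fib j B3 q. t < q j}" by blast
    then have "card {t \<in> fib j B3 q. t < u} < idx j B3 q"
      unfolding idx_def using fin by (intro psubset_card_mono) auto
    then show False using c by simp
  next
    case False
    then have "b \<le> u" "q j < b" using b(1) \<open>b \<noteq> q j\<close> by (auto simp: closed_segment_eq_real_ivl split: if_splits)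
    then have "b \<in> {t \<in> fib j B3 q. q j < t}" "b \<notin> {t \<in> fib j B3 q. u < t}" using b(2) by auto
    moreover have "{t \<in> fib j B3 q. u < t} \<subseteq> {t \<in> fib j B3 q. q j < t}" using False by auto
    ultimately have "{t \<in> fib j B3 q. u < t} \<subset> {t \<in> fib j B3 q. q j < t}" by blast
    then have "card {t \<in> fib j B3 q. u < t} < upx j B3 q"
      unfolding upx_def using fin by (intro psubset_card_mono) auto
    then show False using c by simp
  qed
qed

section \<open>Uncrossed cells from neighbours and labels\<close>

definition uncrossed_cover :: "nat \<Rightarrow> nat \<Rightarrow> 'p set \<Rightarrow> 'p set set \<Rightarrow> 'p set set \<Rightarrow> bool" where
  "uncrossed_cover C t P S \<T> \<longleftrightarrow> P \<subseteq> \<Union>\<T> \<and> card \<T> \<le> C * card S ^ t \<and>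
     (\<forall>\<Delta>\<in>\<T>. \<forall>A\<in>S. \<Delta> \<inter> P \<subseteq> A \<or> \<Delta> \<inter> P \<inter> A = {})"

text \<open>The covers for all \<open>S\<close> are taken from one family fixed in advance, as the
  construction of cuttings requires. The exponent \<open>t\<close> enters the final bound, whereas
  \<open>k\<close> contributes only to a logarithm.\<close>

definition is_cell_decomp :: "nat \<Rightarrow> nat \<Rightarrow> nat \<Rightarrow> 'p set \<Rightarrow> 'p set set \<Rightarrow> 'p set set \<Rightarrow> bool" where
  "is_cell_decomp C k t P Q \<C> \<longleftrightarrow> finite \<C> \<and> card \<C> \<le> C * card Q ^ k \<and>
     (\<forall>S. S \<subseteq> Q \<longrightarrow> S \<noteq> {} \<longrightarrow> (\<exists>\<T>\<subseteq>\<C>. uncrossed_cover C t P S \<T>))"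

definition cell_decomp :: "nat \<Rightarrow> nat \<Rightarrow> nat \<Rightarrow> 'p set \<Rightarrow> 'p set set \<Rightarrow> bool" where
  "cell_decomp C k t P Q \<longleftrightarrow> (\<exists>\<C>. is_cell_decomp C k t P Q \<C>)"

definition approximates where
  "approximates j N P A A' B \<longleftrightarrow> (\<forall>p\<in>P. (p \<in> A \<longleftrightarrow> p \<in> A') \<and> fib_ok j N B p \<and>
     (\<forall>s t. p(j := s) \<in> A' \<longrightarrow> p(j := t) \<notin> A' \<longrightarrow> (\<exists>b\<in>closed_segment s t. b \<in> fib j B p)))"

lemma exsets_approx:
  "\<exists>N K' D'. \<forall>P Q. finite P \<longrightarrow> Q \<subseteq> exsets (Suc j) K D \<longrightarrow>
     (\<exists>ap bp. \<forall>A\<in>Q. ap A \<in> exsets (Suc j) K' D' \<and> bp A \<in> exsets (Suc j) K' D' \<and> approximates j N P A (ap A) (bp A))"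
proof -
  \<comment> \<open>The number of variables is raised to \<open>j + Suc K\<close>, so that there is
    at least one variable from index \<open>j\<close> on even if \<open>K \<le> j\<close>.\<close>
  have fs: "fibre_step (Suc K)" by (rule fibre_step_all) simp
  from fibre_step_def[THEN iffD1, OF fs, THEN spec[of _ j], THEN spec[of _ "j + Suc K"], THEN spec[of _ D], THEN mp, OF refl]
  obtain N K' D' where *: "\<forall>A\<in>exsets (Suc j) (j + Suc K) D. \<forall>P. finite P \<longrightarrow>
     (\<exists>A'\<in>exsets (Suc j) K' D'. \<exists>B\<in>exsets (Suc j) K' D'. \<forall>p\<in>P.
        (p \<in> A \<longleftrightarrow> p \<in> A') \<and> finite {t. p(j := t) \<in> B} \<and> card {t. p(j := t) \<in> B} \<le> N \<and> p \<notin> B \<and>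
        (\<forall>s t. p(j := s) \<in> A' \<longrightarrow> p(j := t) \<notin> A' \<longrightarrow> (\<exists>b\<in>closed_segment s t. p(j := b) \<in> B)))"
    by (elim exE)
  show ?thesis
  proof (rule exI[of _ N], rule exI[of _ K'], rule exI[of _ D'], intro allI impI)
    fix P :: "(nat \<Rightarrow> real) set" and Q assume P: "finite P" and Q: "Q \<subseteq> exsets (Suc j) K D"
    have "\<exists>A' B. A' \<in> exsets (Suc j) K' D' \<and> B \<in> exsets (Suc j) K' D' \<and> approximates j N P A A' B" if "A \<in> Q" for A
    proof -
      have "A \<in> exsets (Suc j) (j + Suc K) D" by (rule exsets_mono[OF subsetD[OF Q that]]) simp_all
      from *[THEN bspec, OF this, THEN spec[of _ P], THEN mp, OF P] obtain A' B
        where A'B: "A' \<in> exsets (Suc j) K' D'" "B \<in> exsets (Suc j) K' D'" and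
         main: "\<forall>p\<in>P. (p \<in> A \<longleftrightarrow> p \<in> A') \<and> finite {t. p(j := t) \<in> B} \<and> card {t. p(j := t) \<in> B} \<le> N \<and> p \<notin> B \<and>
        (\<forall>s t. p(j := s) \<in> A' \<longrightarrow> p(j := t) \<notin> A' \<longrightarrow> (\<exists>b\<in>closed_segment s t. p(j := b) \<in> B))"
        by (elim bexE)
      have "approximates j N P A A' B"
        unfolding approximates_def fib_ok_def fib_def mem_Collect_eq fun_upd_triv using main by blast
      then show ?thesis using A'B by blast
    qed
    then show "\<exists>ap bp. \<forall>A\<in>Q. ap A \<in> exsets (Suc j) K' D' \<and> bp A \<in> exsets (Suc j) K' D' \<and> approximates j N P A (ap A) (bp A)"
      by metis
  qed
qed

definition neighbours where
  "neighbours j bp S p A1 A2 \<longleftrightarrow> (\<forall>A\<in>S. \<forall>t\<in>fib j (bp A) p.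
     (t < p j \<longrightarrow> (\<exists>u\<in>fib j (bp A1) p. t \<le> u \<and> u < p j)) \<and>
     (p j < t \<longrightarrow> (\<exists>u\<in>fib j (bp A2) p. u \<le> t \<and> p j < u)))"

lemma exists_neighbours:
  assumes "finite S" "S \<noteq> {}" "\<And>A. A \<in> S \<Longrightarrow> finite (fib j (bp A) p)"
  shows "\<exists>A1\<in>S. \<exists>A2\<in>S. neighbours j bp S p A1 A2"
proof -
  obtain A1 where "A1 \<in> S" "\<forall>A\<in>S. \<forall>t\<in>fib j (bp A) p. t < p j \<longrightarrow> (\<exists>u\<in>fib j (bp A1) p. t \<le> u \<and> u < p j)"
    using exists_neighbour[of S "\<lambda>A. fib j (bp A) p" "p j", OF assms] by blast
  moreover obtain A2 where "A2 \<in> S" "\<forall>A\<in>S. \<forall>t\<in>fib j (bp A) p. p j < t \<longrightarrow> (\<exists>u\<in>fib j (bp A2) p. u \<le> t \<and> p j < u)"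
    using exists_neighbour_dual[of S "\<lambda>A. fib j (bp A) p" "p j", OF assms] by blast
  ultimately show ?thesis unfolding neighbours_def by blast
qed

text \<open>Equal positions relative to the two neighbours of \<open>p\<close>, together with equal
  labels, give equal positions relative to every fibre, hence equal membership in the sets
  \<open>ap A\<close>, which agree with the given ones on \<open>P\<close>.\<close>

lemma cell_uncrossed:
  assumes ap: "\<And>A. A \<in> S \<Longrightarrow> approximates j N P A (ap A) (bp A)"
    and pq: "p \<in> P" "q \<in> P" and A12: "A1 \<in> S" "A2 \<in> S"
    and nb: "neighbours j bp S p A1 A2"
    and eq: "idx j (bp A1) p = idx j (bp A1) q" "idx j (bp A2) p = idx j (bp A2) q"
    and sl: "\<And>A. A \<in> S \<Longrightarrow> same_labels j N (bp A1) (bp A2) (bp A) (ap A) p q"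
    and A: "A \<in> S"
  shows "p \<in> A \<longleftrightarrow> q \<in> A"
proof -
  have ok: "fib_ok j N (bp A) x" if "A \<in> S" "x \<in> P" for A x
    using ap[OF that(1)] that(2) unfolding approximates_def by blast
  have e: "idx j (bp A) p = idx j (bp A) q" "upx j (bp A) p = upx j (bp A) q"
    using idx_eq[OF sl[OF A] ok[OF A12(1) pq(1)] ok[OF A12(2) pq(1)] ok[OF A pq(1)]
        ok[OF A12(1) pq(2)] ok[OF A12(2) pq(2)] ok[OF A pq(2)] eq] nb A
    unfolding neighbours_def by blast+
  have cross: "\<exists>b\<in>closed_segment s t. b \<in> fib j (bp A) x" if "x \<in> P" "x(j := s) \<in> ap A" "x(j := t) \<notin> ap A" for x s t
    using ap[OF A] that unfolding approximates_def by blast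
  have "p \<in> ap A \<longleftrightarrow> q \<in> ap A"
    using in_set_transfer[OF sl[OF A] ok[OF A pq(1)] ok[OF A pq(2)] e cross[OF pq(2)]]
      in_set_transfer[OF same_labels_sym[OF sl[OF A]] ok[OF A pq(2)] ok[OF A pq(1)] e[symmetric] cross[OF pq(1)]]
    by blast
  then show ?thesis using ap[OF A] pq unfolding approximates_def by blast
qed

section \<open>Cell decompositions\<close>

lemma fib_0:
  assumes "B \<in> exsets (Suc 0) K D"
  shows "fib 0 B x = fib 0 B y"
  unfolding fib_def using exsets_cong[OF assms, of "x(0 := _)" "y(0 := _)"] by auto

lemma card_initial_segments:
  fixes V :: "'a::linorder set"
  assumes "finite V"
  shows "finite ((\<lambda>a. {t \<in> V. t < a}) ` P) \<and> card ((\<lambda>a. {t \<in> V. t < a}) ` P) \<le> card V + 1"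
proof -
  have fin: "finite ((\<lambda>a. {t \<in> V. t < a}) ` P)"
    by (rule finite_subset[of _ "Pow V"]) (use assms in auto)
  have "card ((\<lambda>a. {t \<in> V. t < a}) ` P) \<le> card {..card V}"
  proof (rule card_inj_on_le[of card])
    show "inj_on card ((\<lambda>a. {t \<in> V. t < a}) ` P)"
    proof (rule inj_onI)
      fix X Y assume X: "X \<in> (\<lambda>a. {t \<in> V. t < a}) ` P" and Y: "Y \<in> (\<lambda>a. {t \<in> V. t < a}) ` P"
        and c: "card X = card Y"
      obtain a b where ab: "X = {t \<in> V. t < a}" "Y = {t \<in> V. t < b}" using X Y by auto
      have "X \<subseteq> Y \<or> Y \<subseteq> X" unfolding ab by (cases "a \<le> b") auto
      moreover have "finite X" "finite Y" unfolding ab using assms by auto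
      ultimately show "X = Y" using c card_subset_eq by metis
    qed
    show "card ` ((\<lambda>a. {t \<in> V. t < a}) ` P) \<subseteq> {..card V}"
      using assms by (auto intro: card_mono)
  qed simp
  then show ?thesis using fin by simp
qed

text \<open>In dimension one there is only one line, so labels and fibres are the same for all
  points. The cells correspond to the gaps between \<open>O(card S)\<close> fibre points, whence the
  exponent 1; the exponent 2 of the whole family comes from the two parameters that name a
  cell.\<close>

lemma cell_decomp_base:
  "\<exists>C k. \<forall>P Q. finite P \<longrightarrow> finite Q \<longrightarrow> Q \<subseteq> exsets (Suc 0) K D \<longrightarrow> cell_decomp C k 1 P Q"
proof -
  obtain N K' D' where N: "\<And>P Q. finite P \<Longrightarrow> Q \<subseteq> exsets (Suc 0) K D \<Longrightarrow>
     \<exists>ap bp. \<forall>A\<in>Q. ap A \<in> exsets (Suc 0) K' D' \<and> bp A \<in> exsets (Suc 0) K' D' \<and> approximates 0 N P A (ap A) (bp A)"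
    using exsets_approx[of 0 K D] by metis
  obtain K1 D1 where lab: "\<forall>c\<in>lab_idx N. \<forall>B1\<in>exsets (Suc 0) K' D'. \<forall>B2\<in>exsets (Suc 0) K' D'.
     \<forall>B3\<in>exsets (Suc 0) K' D'. \<forall>A\<in>exsets (Suc 0) K' D'. labset 0 c B1 B2 B3 A \<in> exsets 0 K1 D1"
    using uniform_labset[OF refl, where j = 0 and K = K' and D = D' and N = N] by blast
  show ?thesis
  proof (rule exI[of _ "(N + 1)\<^sup>2"], rule exI[of _ 2], intro allI impI)
    fix P :: "(nat \<Rightarrow> real) set" and Q assume P: "finite P" and Q: "finite Q" "Q \<subseteq> exsets (Suc 0) K D"
    obtain ap bp where ab: "\<And>A. A \<in> Q \<Longrightarrow> ap A \<in> exsets (Suc 0) K' D'" "\<And>A. A \<in> Q \<Longrightarrow> bp A \<in> exsets (Suc 0) K' D'"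
      and appr: "\<And>A. A \<in> Q \<Longrightarrow> approximates 0 N P A (ap A) (bp A)"
      using N[OF P Q(2)] by blast
    have ok: "fib_ok 0 N (bp A) p" if "A \<in> Q" "p \<in> P" for A p
      using appr[OF that(1)] that(2) unfolding approximates_def by blast
    have sl: "same_labels 0 N (bp A1) (bp A2) (bp A) (ap A) p q" if "A1 \<in> Q" "A2 \<in> Q" "A \<in> Q" for A1 A2 A p q
      unfolding same_labels_def
    proof
      fix c assume "c \<in> lab_idx N"
      then have "labset 0 c (bp A1) (bp A2) (bp A) (ap A) \<in> exsets 0 K1 D1" using lab ab that by blast
      then show "p \<in> labset 0 c (bp A1) (bp A2) (bp A) (ap A) \<longleftrightarrow> q \<in> labset 0 c (bp A1) (bp A2) (bp A) (ap A)"
        by (rule exsets_cong) simp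
    qed
    define cell where "cell = (\<lambda>(A1, A2, i1, i2). {q \<in> P. idx 0 (bp A1) q = i1 \<and> idx 0 (bp A2) q = i2})"
    define X where "X = Q \<times> Q \<times> {..N} \<times> {..N}"
    show "cell_decomp ((N + 1)\<^sup>2) 2 1 P Q"
      unfolding cell_decomp_def is_cell_decomp_def uncrossed_cover_def
    proof (rule exI[of _ "cell ` X"], intro conjI allI impI)
      show "finite (cell ` X)" unfolding X_def using Q(1) by simp
      have "card (cell ` X) \<le> card X" by (rule card_image_le) (simp add: X_def Q(1))
      also have "\<dots> = (N + 1)\<^sup>2 * card Q ^ 2" unfolding X_def by (simp add: card_cartesian_product power2_eq_square algebra_simps)
      finally show "card (cell ` X) \<le> (N + 1)\<^sup>2 * card Q ^ 2" .
      fix S assume S: "S \<subseteq> Q" "S \<noteq> {}"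
      have finS: "finite S" using S(1) Q(1) finite_subset by blast
      have "\<exists>A1 A2. p \<in> P \<longrightarrow> A1 \<in> S \<and> A2 \<in> S \<and> neighbours 0 bp S p A1 A2" for p
        using exists_neighbours[OF finS S(2), of 0 bp p] ok S(1) unfolding fib_ok_def by blast
      then obtain a1 a2 where a: "\<And>p. p \<in> P \<Longrightarrow> a1 p \<in> S \<and> a2 p \<in> S \<and> neighbours 0 bp S p (a1 p) (a2 p)"
        by metis
      define V where "V = (\<Union>A\<in>S. fib 0 (bp A) (\<lambda>_. 0))"
      have fibV: "fib 0 (bp A) p = fib 0 (bp A) (\<lambda>_. 0)" if "A \<in> S" for A p
        using fib_0[OF ab(2)] that S(1) by blast
      define U where "U p = {t \<in> V. t < p 0}" for p :: "nat \<Rightarrow> real"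
      \<comment> \<open>One representative per gap: points with the same part of \<open>V\<close>
        below them have equal positions relative to every fibre.\<close>
      obtain R where R: "R \<subseteq> P" "inj_on U R" "U ` P = U ` R"
        using subset_image_inj[of "U ` P" U P] by auto
      define g where "g p = (a1 p, a2 p, idx 0 (bp (a1 p)) p, idx 0 (bp (a2 p)) p)" for p
      have idxU: "idx 0 (bp A) p = idx 0 (bp A) q" if "A \<in> S" "U p = U q" for A p q
      proof -
        have "{t \<in> fib 0 (bp A) x. t < x 0} = fib 0 (bp A) (\<lambda>_. 0) \<inter> U x" for x
          using that(1) fibV[OF that(1), of x] unfolding U_def V_def by auto
        then show ?thesis unfolding idx_def using that(2) by simp
      qed
      show "\<exists>\<T>\<subseteq>cell ` X. P \<subseteq> \<Union>\<T> \<and> card \<T> \<le> (N + 1)\<^sup>2 * card S ^ 1 \<and>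
         (\<forall>\<Delta>\<in>\<T>. \<forall>A\<in>S. \<Delta> \<inter> P \<subseteq> A \<or> \<Delta> \<inter> P \<inter> A = {})"
      proof (intro exI[of _ "(\<lambda>p. cell (g p)) ` R"] conjI ballI)
        show "(\<lambda>p. cell (g p)) ` R \<subseteq> cell ` X"
        proof (clarify, rule imageI)
          fix p assume "p \<in> R"
          then have "p \<in> P" using R by blast
          then show "g p \<in> X" using a S(1) idx_le[OF ok] unfolding g_def X_def by blast
        qed
        show "P \<subseteq> \<Union> ((\<lambda>p. cell (g p)) ` R)"
        proof
          fix p assume p: "p \<in> P"
          then have "U p \<in> U ` R" using R(3) by blast
          then obtain r where r: "r \<in> R" "U p = U r" by blast
          then have "r \<in> P" using R(1) by blast
          then have "idx 0 (bp (a1 r)) p = idx 0 (bp (a1 r)) r" "idx 0 (bp (a2 r)) p = idx 0 (bp (a2 r)) r"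
            using idxU[OF _ r(2)] a[of r] by simp_all
          then have "p \<in> cell (g r)" using p unfolding cell_def g_def by simp
          then show "p \<in> \<Union> ((\<lambda>p. cell (g p)) ` R)" using r(1) by blast
        qed
        show "card ((\<lambda>p. cell (g p)) ` R) \<le> (N + 1)\<^sup>2 * card S ^ 1"
        proof (cases "P = {}")
          case True then show ?thesis using R(1) by simp
        next
          case False
          then obtain p where p: "p \<in> P" by blast
          have f: "finite (fib 0 (bp A) (\<lambda>_. 0)) \<and> card (fib 0 (bp A) (\<lambda>_. 0)) \<le> N" if "A \<in> S" for A
            using ok[of A p] p that S(1) unfolding fib_ok_def fibV[OF that, of p] by blast
          have finV: "finite V" unfolding V_def using finS f by blast
          have "card V \<le> (\<Sum>A\<in>S. card (fib 0 (bp A) (\<lambda>_. 0)))" unfolding V_def by (rule card_UN_le[OF finS])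
          also have "\<dots> \<le> card S * N" using sum_bounded_above[of S "\<lambda>A. card (fib 0 (bp A) (\<lambda>_. 0))" N] f by simp
          finally have cV: "card V \<le> card S * N" .
          have "card ((\<lambda>p. cell (g p)) ` R) \<le> card R" using R(1) P finite_subset by (intro card_image_le) blast
          also have "\<dots> = card (U ` P)" using card_image[OF R(2)] R(3) by simp
          also have "\<dots> \<le> card V + 1"
          proof -
            have "U ` P = (\<lambda>a. {t \<in> V. t < a}) ` ((\<lambda>p. p 0) ` P)" unfolding U_def by (simp add: image_image)
            then show ?thesis using card_initial_segments[OF finV] by simp
          qed
          also have "\<dots> \<le> card S * N + card S" using cV S(2) finS card_gt_0_iff[of S] by simp
          also have "\<dots> \<le> (N + 1)\<^sup>2 * card S ^ 1" by (simp add: power2_eq_square algebra_simps)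
          finally show ?thesis .
        qed
        fix \<Delta> A assume "\<Delta> \<in> (\<lambda>p. cell (g p)) ` R" and A: "A \<in> S"
        then obtain r where r: "r \<in> R" "\<Delta> = cell (g r)" by blast
        then have rP: "r \<in> P" using R by blast
        have "r \<in> A \<longleftrightarrow> q \<in> A" if "q \<in> \<Delta>" for q
        proof (rule cell_uncrossed[of S 0 N P ap bp r q "a1 r" "a2 r"])
          show "approximates 0 N P A (ap A) (bp A)" if "A \<in> S" for A using appr S(1) that by blast
          show "same_labels 0 N (bp (a1 r)) (bp (a2 r)) (bp A) (ap A) r q" if "A \<in> S" for A
            using sl a[OF rP] S(1) that by blast
        qed (use a[OF rP] rP that r(2) A in \<open>auto simp: cell_def g_def\<close>)
        then show "\<Delta> \<inter> P \<subseteq> A \<or> \<Delta> \<inter> P \<inter> A = {}" by blast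
      qed
    qed
  qed
qed

text \<open>A cell is given by the positions of its points with respect to the fibres of two parameters,
  and by a cell of the decomposition one dimension lower that controls the relative positions of
  these two fibres and a third one.\<close>

lemma cell_decomp_step:
  assumes IH: "\<And>K D. \<exists>C k. \<forall>P Q. finite P \<longrightarrow> finite Q \<longrightarrow> Q \<subseteq> exsets j K D \<longrightarrow> cell_decomp C k t P Q"
  shows "\<exists>C k. \<forall>P Q. finite P \<longrightarrow> finite Q \<longrightarrow> Q \<subseteq> exsets (Suc j) K D \<longrightarrow> cell_decomp C k (t + 2) P Q"
proof -
  obtain N K' D' where N: "\<And>P Q. finite P \<Longrightarrow> Q \<subseteq> exsets (Suc j) K D \<Longrightarrow>
     \<exists>ap bp. \<forall>A\<in>Q. ap A \<in> exsets (Suc j) K' D' \<and> bp A \<in> exsets (Suc j) K' D' \<and> approximates j N P A (ap A) (bp A)"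
    using exsets_approx[of j K D] by metis
  obtain K1 D1 where lab: "\<forall>c\<in>lab_idx N. \<forall>B1\<in>exsets (Suc j) K' D'. \<forall>B2\<in>exsets (Suc j) K' D'.
     \<forall>B3\<in>exsets (Suc j) K' D'. \<forall>A\<in>exsets (Suc j) K' D'. labset j c B1 B2 B3 A \<in> exsets j K1 D1"
    using uniform_labset[OF refl, where j = j and K = K' and D = D' and N = N] by blast
  obtain C0 k0 where IH0: "\<And>P Q. finite P \<Longrightarrow> finite Q \<Longrightarrow> Q \<subseteq> exsets j K1 D1 \<Longrightarrow> cell_decomp C0 k0 t P Q"
    using IH[of K1 D1] by blast
  define L where "L = card (lab_idx N)"
  have finL: "finite (lab_idx N)" unfolding lab_idx_def by simp
  \<comment> \<open>One constant for both estimates: \<open>L ^ k0\<close> serves the family,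
    \<open>L ^ t\<close> the covers.\<close>
  define C where "C = C0 * (L ^ k0 + L ^ t) * (N + 1)\<^sup>2"
  show ?thesis
  proof (rule exI[of _ C], rule exI[of _ "k0 + 2"], intro allI impI)
    fix P :: "(nat \<Rightarrow> real) set" and Q assume P: "finite P" and Q: "finite Q" "Q \<subseteq> exsets (Suc j) K D"
    obtain ap bp where ab: "\<And>A. A \<in> Q \<Longrightarrow> ap A \<in> exsets (Suc j) K' D'" "\<And>A. A \<in> Q \<Longrightarrow> bp A \<in> exsets (Suc j) K' D'"
      and appr: "\<And>A. A \<in> Q \<Longrightarrow> approximates j N P A (ap A) (bp A)"
      using N[OF P Q(2)] by blast
    have ok: "fib_ok j N (bp A) p" if "A \<in> Q" "p \<in> P" for A p
      using appr[OF that(1)] that(2) unfolding approximates_def by blast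
    define Lab where "Lab A1 A2 A3 = (\<lambda>c. labset j c (bp A1) (bp A2) (bp A3) (ap A3)) ` lab_idx N" for A1 A2 A3
    define Q' where "Q' A1 A2 S = (\<Union>A3\<in>S. Lab A1 A2 A3)" for A1 A2 S
    have finQ': "finite (Q' A1 A2 S)" "card (Q' A1 A2 S) \<le> L * card S" if "S \<subseteq> Q" for A1 A2 S
    proof -
      have finS: "finite S" using that Q(1) finite_subset by blast
      show "finite (Q' A1 A2 S)" unfolding Q'_def Lab_def using finS finL by simp
      have "card (Q' A1 A2 S) \<le> (\<Sum>A3\<in>S. card (Lab A1 A2 A3))" unfolding Q'_def by (rule card_UN_le[OF finS])
      also have "\<dots> \<le> card S * L"
      proof -
        have "card (Lab A1 A2 A3) \<le> L" for A3 unfolding Lab_def L_def by (rule card_image_le[OF finL])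
        then show ?thesis using sum_bounded_above[of S "\<lambda>A3. card (Lab A1 A2 A3)" L] by simp
      qed
      finally show "card (Q' A1 A2 S) \<le> L * card S" by (simp add: mult.commute)
    qed
    have "cell_decomp C0 k0 t P (Q' A1 A2 Q)" if "A1 \<in> Q" "A2 \<in> Q" for A1 A2
    proof (rule IH0[OF P finQ'(1)[OF subset_refl]])
      show "Q' A1 A2 Q \<subseteq> exsets j K1 D1" unfolding Q'_def Lab_def using lab ab that by blast
    qed
    then obtain \<C>0 where \<C>0: "\<And>A1 A2. A1 \<in> Q \<Longrightarrow> A2 \<in> Q \<Longrightarrow> is_cell_decomp C0 k0 t P (Q' A1 A2 Q) (\<C>0 A1 A2)"
      unfolding cell_decomp_def by metis
    have \<C>1: "finite (\<C>0 A1 A2)" "card (\<C>0 A1 A2) \<le> C0 * card (Q' A1 A2 Q) ^ k0"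
      "S \<subseteq> Q' A1 A2 Q \<Longrightarrow> S \<noteq> {} \<Longrightarrow> \<exists>\<T>\<subseteq>\<C>0 A1 A2. uncrossed_cover C0 t P S \<T>"
      if "A1 \<in> Q" "A2 \<in> Q" for A1 A2 S
      using \<C>0[OF that] unfolding is_cell_decomp_def by blast+
    define cell where "cell = (\<lambda>(A1, A2, \<Delta>, i1, i2). {q \<in> P. q \<in> \<Delta> \<and> idx j (bp A1) q = i1 \<and> idx j (bp A2) q = i2})"
    define X where "X S \<T> = (SIGMA A1:S. SIGMA A2:S. \<T> A1 A2 \<times> {..N} \<times> {..N})"
      for S :: "(nat \<Rightarrow> real) set set" and \<T> :: "(nat \<Rightarrow> real) set \<Rightarrow> (nat \<Rightarrow> real) set \<Rightarrow> (nat \<Rightarrow> real) set set"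
    have cardX: "finite (X S \<T>) \<and> card (X S \<T>) \<le> card S ^ 2 * M * (N + 1)\<^sup>2"
      if "S \<subseteq> Q" "\<And>A1 A2. A1 \<in> S \<Longrightarrow> A2 \<in> S \<Longrightarrow> finite (\<T> A1 A2) \<and> card (\<T> A1 A2) \<le> M" for S \<T> M
    proof -
      have finS: "finite S" using that(1) Q(1) finite_subset by blast
      have fin: "finite (X S \<T>)" unfolding X_def using finS that(2) by (intro finite_SigmaI) auto
      have "card (X S \<T>) = (\<Sum>A1\<in>S. \<Sum>A2\<in>S. card (\<T> A1 A2) * ((N + 1) * (N + 1)))"
        unfolding X_def using finS that(2)
        by (subst card_SigmaI) (auto simp: card_cartesian_product intro!: sum.cong finite_SigmaI card_SigmaI)
      also have "\<dots> \<le> (\<Sum>A1\<in>S. \<Sum>A2\<in>S. M * ((N + 1) * (N + 1)))"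
        using that(2) by (intro sum_mono mult_le_mono1) auto
      also have "\<dots> = card S ^ 2 * M * (N + 1)\<^sup>2" by (simp add: power2_eq_square algebra_simps)
      finally show ?thesis using fin by blast
    qed
    show "cell_decomp C (k0 + 2) (t + 2) P Q"
      unfolding cell_decomp_def is_cell_decomp_def uncrossed_cover_def
    proof (rule exI[of _ "cell ` X Q \<C>0"], intro conjI allI impI)
      have "card (\<C>0 A1 A2) \<le> C0 * (L * card Q) ^ k0" if "A1 \<in> Q" "A2 \<in> Q" for A1 A2
      proof -
        have "card (Q' A1 A2 Q) ^ k0 \<le> (L * card Q) ^ k0" by (intro power_mono finQ') auto
        then show ?thesis using \<C>1(2)[OF that] by (meson le_trans mult_le_mono2)
      qed
      then have cX: "finite (X Q \<C>0)" "card (X Q \<C>0) \<le> card Q ^ 2 * (C0 * (L * card Q) ^ k0) * (N + 1)\<^sup>2"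
        using cardX[of Q \<C>0 "C0 * (L * card Q) ^ k0"] \<C>1(1) by blast+
      show "finite (cell ` X Q \<C>0)" using cX by simp
      have "card (cell ` X Q \<C>0) \<le> card (X Q \<C>0)" by (rule card_image_le[OF cX(1)])
      also have "\<dots> \<le> (C0 * L ^ k0 * (N + 1)\<^sup>2) * card Q ^ (k0 + 2)"
        using cX(2) unfolding power_mult_distrib power_add by (simp only: mult_ac)
      also have "\<dots> \<le> C * card Q ^ (k0 + 2)" unfolding C_def by (intro mult_le_mono1) (simp add: algebra_simps)
      finally show "card (cell ` X Q \<C>0) \<le> C * card Q ^ (k0 + 2)" .
      fix S assume S: "S \<subseteq> Q" "S \<noteq> {}"
      have finS: "finite S" using S(1) Q(1) finite_subset by blast
      have "\<exists>\<T>\<subseteq>\<C>0 A1 A2. uncrossed_cover C0 t P (Q' A1 A2 S) \<T>" if "A1 \<in> S" "A2 \<in> S" for A1 A2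
      proof (rule \<C>1(3))
        show "A1 \<in> Q" "A2 \<in> Q" using that S(1) by auto
        show "Q' A1 A2 S \<subseteq> Q' A1 A2 Q" unfolding Q'_def using S(1) by blast
        have "(0, 0, 0, 0) \<in> lab_idx N" unfolding lab_idx_def by auto
        then show "Q' A1 A2 S \<noteq> {}" unfolding Q'_def Lab_def using S(2) by blast
      qed
      then obtain \<T>0 where \<T>1: "\<And>A1 A2. A1 \<in> S \<Longrightarrow> A2 \<in> S \<Longrightarrow> \<T>0 A1 A2 \<subseteq> \<C>0 A1 A2"
        "\<And>A1 A2. A1 \<in> S \<Longrightarrow> A2 \<in> S \<Longrightarrow> uncrossed_cover C0 t P (Q' A1 A2 S) (\<T>0 A1 A2)"
        by metis
      have \<T>0: "\<T>0 A1 A2 \<subseteq> \<C>0 A1 A2" "P \<subseteq> \<Union>(\<T>0 A1 A2)" "card (\<T>0 A1 A2) \<le> C0 * card (Q' A1 A2 S) ^ t"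
        "\<And>\<Delta> A. \<Delta> \<in> \<T>0 A1 A2 \<Longrightarrow> A \<in> Q' A1 A2 S \<Longrightarrow> \<Delta> \<inter> P \<subseteq> A \<or> \<Delta> \<inter> P \<inter> A = {}"
        if "A1 \<in> S" "A2 \<in> S" for A1 A2
        using \<T>1[OF that] unfolding uncrossed_cover_def by blast+
      \<comment> \<open>Cells containing a point whose neighbours are the two parameters of the
        cell. Such cells are uncrossed, and they still cover \<open>P\<close>.\<close>
      define good where "good = {x \<in> X S \<T>0. case x of (A1, A2, \<Delta>, i1, i2) \<Rightarrow>
          \<exists>p\<in>cell x. neighbours j bp S p A1 A2}"
      have "finite (\<T>0 A1 A2) \<and> card (\<T>0 A1 A2) \<le> C0 * (L * card S) ^ t" if "A1 \<in> S" "A2 \<in> S" for A1 A2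
      proof -
        have "card (Q' A1 A2 S) ^ t \<le> (L * card S) ^ t" by (intro power_mono finQ' S) auto
        then have "card (\<T>0 A1 A2) \<le> C0 * (L * card S) ^ t"
          using \<T>0(3)[OF that] by (meson le_trans mult_le_mono2)
        moreover have "finite (\<T>0 A1 A2)"
          using \<T>0(1)[OF that] \<C>1(1)[of A1 A2] that S(1) finite_subset by blast
        ultimately show ?thesis by blast
      qed
      then have XS: "finite (X S \<T>0)" "card (X S \<T>0) \<le> card S ^ 2 * (C0 * (L * card S) ^ t) * (N + 1)\<^sup>2"
        using cardX[OF S(1), of \<T>0 "C0 * (L * card S) ^ t"] by blast+
      show "\<exists>\<T>\<subseteq>cell ` X Q \<C>0. P \<subseteq> \<Union>\<T> \<and> card \<T> \<le> C * card S ^ (t + 2) \<and>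
         (\<forall>\<Delta>\<in>\<T>. \<forall>A\<in>S. \<Delta> \<inter> P \<subseteq> A \<or> \<Delta> \<inter> P \<inter> A = {})"
      proof (rule exI[of _ "cell ` good"], intro conjI ballI)
        have "X S \<T>0 \<subseteq> X Q \<C>0" unfolding X_def using S(1) \<T>0(1) by (intro Sigma_mono) auto
        then show "cell ` good \<subseteq> cell ` X Q \<C>0" unfolding good_def by blast
        show "P \<subseteq> \<Union> (cell ` good)"
        proof
          fix p assume p: "p \<in> P"
          obtain A1 A2 where A12: "A1 \<in> S" "A2 \<in> S" "neighbours j bp S p A1 A2"
            using exists_neighbours[OF finS S(2), of j bp p] ok p S(1) unfolding fib_ok_def by blast
          obtain \<Delta> where \<Delta>: "\<Delta> \<in> \<T>0 A1 A2" "p \<in> \<Delta>" using \<T>0(2)[OF A12(1,2)] p by blast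
          define x where "x = (A1, A2, \<Delta>, idx j (bp A1) p, idx j (bp A2) p)"
          have "p \<in> cell x" unfolding cell_def x_def using p \<Delta> by simp
          moreover have "idx j (bp A1) p \<le> N" "idx j (bp A2) p \<le> N" using idx_le ok A12 S(1) p by blast+
          then have "x \<in> X S \<T>0" unfolding X_def x_def using A12 \<Delta> by simp
          ultimately have "x \<in> good" unfolding good_def using A12(3) by (auto simp: x_def)
          then show "p \<in> \<Union> (cell ` good)" using \<open>p \<in> cell x\<close> by blast
        qed
        have "card (cell ` good) \<le> card good" using XS(1) unfolding good_def by (intro card_image_le) simp
        also have "\<dots> \<le> card (X S \<T>0)" using XS(1) unfolding good_def by (intro card_mono) auto
        also have "\<dots> \<le> (C0 * L ^ t * (N + 1)\<^sup>2) * card S ^ (t + 2)"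
          using XS(2) unfolding power_mult_distrib power_add by (simp only: mult_ac)
        also have "\<dots> \<le> C * card S ^ (t + 2)" unfolding C_def by (intro mult_le_mono1) (simp add: algebra_simps)
        finally show "card (cell ` good) \<le> C * card S ^ (t + 2)" .
        fix \<Delta> A assume "\<Delta> \<in> cell ` good" and A: "A \<in> S"
        then obtain A1 A2 \<Delta>' i1 i2 where x: "(A1, A2, \<Delta>', i1, i2) \<in> good" "\<Delta> = cell (A1, A2, \<Delta>', i1, i2)" by auto
        then obtain r where r: "r \<in> \<Delta>" "neighbours j bp S r A1 A2" unfolding good_def by auto
        have A12: "A1 \<in> S" "A2 \<in> S" "\<Delta>' \<in> \<T>0 A1 A2" using x(1) unfolding good_def X_def by auto
        have "r \<in> A \<longleftrightarrow> q \<in> A" if q: "q \<in> \<Delta>" for q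
        proof (rule cell_uncrossed[of S j N P ap bp r q A1 A2])
          have rq: "r \<in> P" "q \<in> P" "r \<in> \<Delta>'" "q \<in> \<Delta>'" "idx j (bp A1) r = i1" "idx j (bp A2) r = i2"
             "idx j (bp A1) q = i1" "idx j (bp A2) q = i2"
            using r(1) q x(2) unfolding cell_def by auto
          show "r \<in> P" "q \<in> P" "idx j (bp A1) r = idx j (bp A1) q" "idx j (bp A2) r = idx j (bp A2) q"
            using rq by simp_all
          show "approximates j N P A (ap A) (bp A)" if "A \<in> S" for A using appr S(1) that by blast
          show "same_labels j N (bp A1) (bp A2) (bp A3) (ap A3) r q" if "A3 \<in> S" for A3
            unfolding same_labels_def
          proof
            fix c assume "c \<in> lab_idx N"
            then have "labset j c (bp A1) (bp A2) (bp A3) (ap A3) \<in> Q' A1 A2 S"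
              using that unfolding Q'_def Lab_def by blast
            then have "\<Delta>' \<inter> P \<subseteq> labset j c (bp A1) (bp A2) (bp A3) (ap A3) \<or>
                \<Delta>' \<inter> P \<inter> labset j c (bp A1) (bp A2) (bp A3) (ap A3) = {}"
              by (rule \<T>0(4)[OF A12])
            then show "r \<in> labset j c (bp A1) (bp A2) (bp A3) (ap A3) \<longleftrightarrow>
                q \<in> labset j c (bp A1) (bp A2) (bp A3) (ap A3)" using rq by blast
          qed
        qed (use A12 A r in blast)+
        then show "\<Delta> \<inter> P \<subseteq> A \<or> \<Delta> \<inter> P \<inter> A = {}" by blast
      qed
    qed
  qed
qed

theorem exsets_cell_decomp:
  "\<exists>C k. \<forall>P Q. finite P \<longrightarrow> finite Q \<longrightarrow> Q \<subseteq> exsets (Suc j) K D \<longrightarrow> cell_decomp C k (2 * j + 1) P Q"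
proof (induction j arbitrary: K D)
  case 0 then show ?case using cell_decomp_base by simp
next
  case (Suc j)
  show ?case using cell_decomp_step[OF Suc.IH, of K D] by simp
qed

section \<open>Cuttings and forbidden bipartite subgraphs\<close>

text \<open>By double counting, some element lies in at least a proportion \<open>\<delta>\<close>
  of the sets that are not yet hit; adding it leaves at most a proportion
  \<open>1 - \<delta>\<close> of them.\<close>

lemma greedy_hitting:
  fixes \<F> :: "'a set set" and \<delta> :: real
  assumes Q: "finite Q" and F: "finite \<F>" "\<And>F. F \<in> \<F> \<Longrightarrow> F \<subseteq> Q \<and> \<delta> * card Q < card F" and "\<delta> \<le> 1"
  shows "\<exists>H\<subseteq>Q. card H \<le> j \<and> card {F \<in> \<F>. F \<inter> H = {}} \<le> (1 - \<delta>) ^ j * card \<F>"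
proof (induction j)
  case 0
  show ?case by (intro exI[of _ "{}"]) simp
next
  case (Suc j)
  then obtain H where H: "H \<subseteq> Q" "card H \<le> j" "card {F \<in> \<F>. F \<inter> H = {}} \<le> (1 - \<delta>) ^ j * card \<F>" by blast
  define R where "R = {F \<in> \<F>. F \<inter> H = {}}"
  have finR: "finite R" unfolding R_def using F by simp
  show ?case
  proof (cases "R = {}")
    case True
    then have "card {F \<in> \<F>. F \<inter> H = {}} = 0" unfolding R_def by (metis card.empty)
    moreover have "0 \<le> (1 - \<delta>) ^ Suc j * card \<F>" using \<open>\<delta> \<le> 1\<close> by simp
    ultimately show ?thesis using H(1,2) by (intro exI[of _ H]) simp
  next
    case False
    have "\<exists>q\<in>Q. \<delta> * card R \<le> card {F \<in> R. q \<in> F}"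
    proof (rule ccontr)
      assume "\<not> ?thesis"
      then have lt: "\<And>q. q \<in> Q \<Longrightarrow> card {F \<in> R. q \<in> F} < \<delta> * card R" by (auto simp: not_le)
      have "(\<Sum>F\<in>R. card F) = (\<Sum>F\<in>R. \<Sum>q\<in>Q. if q \<in> F then 1 else 0)"
      proof (rule sum.cong[OF refl])
        fix F assume "F \<in> R"
        then have "Q \<inter> F = F" using F(2) unfolding R_def by blast
        then show "card F = (\<Sum>q\<in>Q. if q \<in> F then 1 else 0)" using Q by (simp add: sum.If_cases)
      qed
      also have "\<dots> = (\<Sum>q\<in>Q. \<Sum>F\<in>R. if q \<in> F then 1 else 0)" by (rule sum.swap)
      also have "\<dots> = (\<Sum>q\<in>Q. card {F \<in> R. q \<in> F})"
        using finR by (intro sum.cong) (auto simp: sum.If_cases Int_def)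
      finally have eq: "(\<Sum>F\<in>R. real (card F)) = (\<Sum>q\<in>Q. real (card {F \<in> R. q \<in> F}))"
        by (metis of_nat_sum)
      have "(\<Sum>q\<in>Q. real (card {F \<in> R. q \<in> F})) \<le> (\<Sum>q\<in>Q. \<delta> * card R)"
        using lt by (intro sum_mono) (auto intro: less_imp_le)
      also have "\<dots> = (\<Sum>F\<in>R. \<delta> * card Q)" by simp
      also have "\<dots> < (\<Sum>F\<in>R. real (card F))"
        using F(2) False finR unfolding R_def by (intro sum_strict_mono) auto
      finally show False using eq by simp
    qed
    then obtain q where q: "q \<in> Q" "\<delta> * card R \<le> card {F \<in> R. q \<in> F}" by blast
    have "{F \<in> \<F>. F \<inter> insert q H = {}} = R - {F \<in> R. q \<in> F}" unfolding R_def by auto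
    then have "card {F \<in> \<F>. F \<inter> insert q H = {}} = card R - card {F \<in> R. q \<in> F}"
      using finR by (simp add: card_Diff_subset)
    moreover have "card {F \<in> R. q \<in> F} \<le> card R" using finR by (intro card_mono) auto
    ultimately have "real (card {F \<in> \<F>. F \<inter> insert q H = {}}) \<le> (1 - \<delta>) * card R"
      using q(2) by (simp add: of_nat_diff algebra_simps)
    also have "\<dots> \<le> (1 - \<delta>) * ((1 - \<delta>) ^ j * card \<F>)"
      using H(3) \<open>\<delta> \<le> 1\<close> unfolding R_def by (intro mult_left_mono) auto
    finally have "real (card {F \<in> \<F>. F \<inter> insert q H = {}}) \<le> (1 - \<delta>) ^ Suc j * card \<F>" by simp
    moreover have "card (insert q H) \<le> Suc j" using H(2) card_insert_le_m1[of "Suc j" H q] by simp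
    ultimately show ?thesis using H(1) q(1) by (intro exI[of _ "insert q H"]) simp
  qed
qed

text \<open>After more than \<open>ln M / \<delta>\<close> greedy steps fewer than one set is
  left.\<close>

lemma hitting_set:
  fixes \<F> :: "'a set set" and \<delta> M :: real
  assumes Q: "finite Q" and F: "finite \<F>" "\<And>F. F \<in> \<F> \<Longrightarrow> F \<subseteq> Q \<and> \<delta> * card Q < card F"
    and \<delta>: "0 < \<delta>" "\<delta> \<le> 1" and M: "card \<F> \<le> M" "1 \<le> M"
  shows "\<exists>H\<subseteq>Q. card H \<le> ln M / \<delta> + 1 \<and> (\<forall>F\<in>\<F>. F \<inter> H \<noteq> {})"
proof -
  define j where "j = nat \<lfloor>ln M / \<delta>\<rfloor> + 1"
  have lnM: "ln M / \<delta> \<ge> 0" using M \<delta> by simp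
  have j: "real j \<le> ln M / \<delta> + 1" "ln M / \<delta> < j" unfolding j_def using lnM by linarith+
  obtain H where H: "H \<subseteq> Q" "card H \<le> j" "card {F \<in> \<F>. F \<inter> H = {}} \<le> (1 - \<delta>) ^ j * card \<F>"
    using greedy_hitting[OF Q F \<delta>(2), of j] by blast
  have "(1 - \<delta>) ^ j \<le> exp (- \<delta>) ^ j" using \<delta> exp_ge_add_one_self[of "- \<delta>"] by (intro power_mono) auto
  also have "\<dots> = exp (- (\<delta> * j))" by (simp add: exp_of_nat_mult[symmetric] mult.commute)
  also have "\<dots> < exp (- ln M)" using j(2) \<delta>(1) by (simp add: field_simps)
  also have "\<dots> = 1 / M" using M by (simp add: exp_minus inverse_eq_divide)
  finally have "(1 - \<delta>) ^ j * M < 1" using M by (simp add: field_simps)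
  moreover have "(1 - \<delta>) ^ j * card \<F> \<le> (1 - \<delta>) ^ j * M" using M \<delta> by (intro mult_left_mono) auto
  ultimately have "real (card {F \<in> \<F>. F \<inter> H = {}}) < 1" using H(3) by linarith
  then have "{F \<in> \<F>. F \<inter> H = {}} = {}" using F(1) by (simp add: card_eq_0_iff)
  then show ?thesis using H(1,2) j(1) by (intro exI[of _ H]) fastforce
qed

text \<open>Only the points of the given finite set \<open>P\<close> count for crossing, so the cells need not be
  connected or definable.\<close>

definition rel_decomp :: "nat \<Rightarrow> nat \<Rightarrow> nat \<Rightarrow> ('y \<Rightarrow> 'p set) \<Rightarrow> bool" where
  "rel_decomp C k t E \<longleftrightarrow> (\<forall>P Q. finite P \<longrightarrow> finite Q \<longrightarrow> (\<exists>\<C>. finite \<C> \<and> card \<C> \<le> C * card Q ^ k \<and>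
     (\<forall>S. S \<subseteq> Q \<longrightarrow> S \<noteq> {} \<longrightarrow> (\<exists>\<T>\<subseteq>\<C>. P \<subseteq> \<Union>\<T> \<and> card \<T> \<le> C * card S ^ t \<and>
        (\<forall>\<Delta>\<in>\<T>. \<forall>y\<in>S. \<Delta> \<inter> P \<subseteq> E y \<or> \<Delta> \<inter> P \<inter> E y = {})))))"

definition crossing :: "('y \<Rightarrow> 'p set) \<Rightarrow> 'p set \<Rightarrow> 'y set \<Rightarrow> 'p set \<Rightarrow> 'y set" where
  "crossing E P Q \<Delta> = {y \<in> Q. \<not> (\<Delta> \<inter> P \<subseteq> E y \<or> \<Delta> \<inter> P \<inter> E y = {})}"

text \<open>\<open>S\<close> is made to meet every crossing set with more than
  \<open>\<delta> * card Q\<close> elements; a cell that no member of \<open>S\<close> crosses then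
  has a small crossing set. The candidates for cells are known before \<open>S\<close> is chosen,
  and their number enters only through its logarithm.\<close>

lemma cutting:
  fixes \<delta> :: real
  assumes rd: "rel_decomp C k t E" and P: "finite P" and Q: "finite Q" "Q \<noteq> {}" and C: "1 \<le> C"
    and \<delta>: "0 < \<delta>" "\<delta> \<le> 1"
  shows "\<exists>\<T>. finite \<T> \<and> P \<subseteq> \<Union>\<T> \<and> card \<T> \<le> C * ((ln (C * card Q ^ k) + 2) / \<delta>) ^ t \<and>
     (\<forall>\<Delta>\<in>\<T>. card (crossing E P Q \<Delta>) \<le> \<delta> * card Q)"
proof -
  obtain \<C> where \<C>: "finite \<C>" "card \<C> \<le> C * card Q ^ k"
    "\<And>S. S \<subseteq> Q \<Longrightarrow> S \<noteq> {} \<Longrightarrow> \<exists>\<T>\<subseteq>\<C>. P \<subseteq> \<Union>\<T> \<and> card \<T> \<le> C * card S ^ t \<and>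
        (\<forall>\<Delta>\<in>\<T>. \<forall>y\<in>S. \<Delta> \<inter> P \<subseteq> E y \<or> \<Delta> \<inter> P \<inter> E y = {})"
    using rd P Q(1) unfolding rel_decomp_def by metis
  define \<F> where "\<F> = crossing E P Q ` {\<Delta> \<in> \<C>. \<delta> * card Q < card (crossing E P Q \<Delta>)}"
  define M where "M = real (C * card Q ^ k)"
  have "card Q \<ge> 1" using Q by (simp add: Suc_leI card_gt_0_iff)
  then have "1 \<le> C * card Q ^ k" using C by simp
  then have M1: "1 \<le> M" unfolding M_def by (simp only: real_of_nat_ge_one_iff)
  have "card \<F> \<le> card {\<Delta> \<in> \<C>. \<delta> * card Q < card (crossing E P Q \<Delta>)}"
    unfolding \<F>_def using \<C>(1) by (intro card_image_le) simp
  also have "\<dots> \<le> card \<C>" using \<C>(1) by (intro card_mono) auto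
  finally have "card \<F> \<le> card \<C>" .
  then have cM: "real (card \<F>) \<le> M" unfolding M_def using \<C>(2) by linarith
  have finF: "finite \<F>" unfolding \<F>_def using \<C>(1) by simp
  have Fp: "F \<subseteq> Q \<and> \<delta> * card Q < card F" if "F \<in> \<F>" for F
    using that unfolding \<F>_def crossing_def by auto
  obtain H where H: "H \<subseteq> Q" "card H \<le> ln M / \<delta> + 1" "\<And>F. F \<in> \<F> \<Longrightarrow> F \<inter> H \<noteq> {}"
    using hitting_set[OF Q(1) finF Fp \<delta> cM M1] by blast
  obtain y0 where y0: "y0 \<in> Q" using Q(2) by blast
  \<comment> \<open>\<open>y0\<close> makes \<open>S\<close> nonempty, as the decomposition
    requires. It accounts for one of the two units in \<open>ln M + 2\<close>, the rounding of the
    number of steps for the other.\<close>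
  define S where "S = insert y0 H"
  have finH: "finite H" using H(1) Q(1) finite_subset by blast
  have S: "S \<subseteq> Q" "S \<noteq> {}" unfolding S_def using H(1) y0 by auto
  obtain \<T> where T: "\<T> \<subseteq> \<C>" "P \<subseteq> \<Union>\<T>" "card \<T> \<le> C * card S ^ t"
     "\<forall>\<Delta>\<in>\<T>. \<forall>y\<in>S. \<Delta> \<inter> P \<subseteq> E y \<or> \<Delta> \<inter> P \<inter> E y = {}"
    using \<C>(3)[OF S] by (elim exE conjE)
  have "card S \<le> card H + 1" unfolding S_def using finH by (simp add: card_insert_if)
  then have "real (card S) \<le> ln M / \<delta> + 2" using H(2) by linarith
  also have "\<dots> \<le> (ln M + 2) / \<delta>" using \<delta> by (simp add: field_simps)
  finally have "real (card S) ^ t \<le> ((ln M + 2) / \<delta>) ^ t" by (intro power_mono) auto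
  then have "real C * real (card S) ^ t \<le> C * ((ln M + 2) / \<delta>) ^ t" by (intro mult_left_mono) auto
  moreover have "real (card \<T>) \<le> real C * real (card S) ^ t" using T(3) by (metis of_nat_le_iff of_nat_mult of_nat_power)
  ultimately have "card \<T> \<le> C * ((ln M + 2) / \<delta>) ^ t" by linarith
  moreover have "card (crossing E P Q \<Delta>) \<le> \<delta> * card Q" if "\<Delta> \<in> \<T>" for \<Delta>
  proof (rule ccontr)
    assume "\<not> ?thesis"
    then have "crossing E P Q \<Delta> \<in> \<F>" unfolding \<F>_def using that T(1) by auto
    from H(3)[OF this] obtain y where "y \<in> H" "y \<in> crossing E P Q \<Delta>" by blast
    then show False using bspec[OF bspec[OF T(4) that], of y] unfolding crossing_def S_def by blast
  qed
  moreover have "finite \<T>" using T(1) \<C>(1) finite_subset by blast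
  ultimately show ?thesis using T(2) unfolding M_def by blast
qed

section \<open>Graphs without a complete bipartite subgraph\<close>

definition edges :: "('y \<Rightarrow> 'p set) \<Rightarrow> 'p set \<Rightarrow> 'y set \<Rightarrow> ('p \<times> 'y) set" where
  "edges E P Q = {(p, y). p \<in> P \<and> y \<in> Q \<and> p \<in> E y}"

definition K_free :: "('y \<Rightarrow> 'p set) \<Rightarrow> nat \<Rightarrow> nat \<Rightarrow> bool" where
  "K_free E s u \<longleftrightarrow> \<not> (\<exists>A B. finite A \<and> card A = s \<and> finite B \<and> card B = u \<and> (\<forall>a\<in>A. \<forall>b\<in>B. a \<in> E b))"

lemma edges_finite: "finite P \<Longrightarrow> finite Q \<Longrightarrow> finite (edges E P Q)"
  unfolding edges_def by (rule finite_subset[of _ "P \<times> Q"]) auto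

lemma K_free_few_common:
  assumes "K_free E s u" "finite A" "s \<le> card A" "finite B" "\<And>a b. a \<in> A \<Longrightarrow> b \<in> B \<Longrightarrow> a \<in> E b"
  shows "card B < u"
proof (rule ccontr)
  assume "\<not> card B < u"
  then obtain B' where "B' \<subseteq> B" "card B' = u" "finite B'"
    by (metis obtain_subset_with_card_n not_less)
  moreover obtain A' where "A' \<subseteq> A" "card A' = s" "finite A'"
    using obtain_subset_with_card_n[OF assms(3)] by blast
  ultimately show False using assms(1,5) unfolding K_free_def by blast
qed

lemma card_edges: "finite P \<Longrightarrow> finite Q \<Longrightarrow> card (edges E P Q) = (\<Sum>y\<in>Q. card {p \<in> P. p \<in> E y})"
proof -
  assume "finite P" "finite Q"
  have "edges E P Q = (\<lambda>(y, p). (p, y)) ` (SIGMA y:Q. {p \<in> P. p \<in> E y})"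
    unfolding edges_def by (auto simp: image_iff)
  moreover have "inj_on (\<lambda>(y, p). (p, y)) (SIGMA y:Q. {p \<in> P. p \<in> E y})" by (auto simp: inj_on_def)
  ultimately have "card (edges E P Q) = card (SIGMA y:Q. {p \<in> P. p \<in> E y})" by (simp add: card_image)
  then show ?thesis using \<open>finite P\<close> \<open>finite Q\<close> by (simp add: card_SigmaI)
qed

text \<open>Double counting of the pairs of an \<open>s\<close>-subset of \<open>P\<close> and a
  parameter \<open>y\<close> with this subset inside \<open>E y\<close>.\<close>

lemma KST_binomial:
  assumes free: "K_free E s u" and P: "finite P" and Q: "finite Q"
  shows "(\<Sum>y\<in>Q. card {p \<in> P. p \<in> E y} choose s) \<le> u * (card P choose s)"
proof -
  define \<A> where "\<A> = {A. A \<subseteq> P \<and> card A = s}"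
  have fin: "finite \<A>" unfolding \<A>_def using P by simp
  have "(\<Sum>y\<in>Q. card {p \<in> P. p \<in> E y} choose s) = (\<Sum>y\<in>Q. card {A \<in> \<A>. A \<subseteq> E y})"
  proof (rule sum.cong[OF refl])
    fix y
    have "card {A. A \<subseteq> {p \<in> P. p \<in> E y} \<and> card A = s} = card {p \<in> P. p \<in> E y} choose s"
      using P by (intro n_subsets) simp
    moreover have "{A. A \<subseteq> {p \<in> P. p \<in> E y} \<and> card A = s} = {A \<in> \<A>. A \<subseteq> E y}" unfolding \<A>_def by auto
    ultimately show "card {p \<in> P. p \<in> E y} choose s = card {A \<in> \<A>. A \<subseteq> E y}" by simp
  qed
  also have "\<dots> = (\<Sum>y\<in>Q. \<Sum>A\<in>\<A>. if A \<subseteq> E y then 1 else 0)"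
    using fin by (simp add: sum.If_cases Int_def)
  also have "\<dots> = (\<Sum>A\<in>\<A>. \<Sum>y\<in>Q. if A \<subseteq> E y then 1 else 0)" by (rule sum.swap)
  also have "\<dots> = (\<Sum>A\<in>\<A>. card {y \<in> Q. A \<subseteq> E y})" using Q by (simp add: sum.If_cases Int_def)
  also have "\<dots> \<le> (\<Sum>A\<in>\<A>. u)"
  proof (rule sum_mono)
    fix A assume "A \<in> \<A>"
    then have "finite A" "s \<le> card A" unfolding \<A>_def using P finite_subset by auto
    from K_free_few_common[OF free this, of "{y \<in> Q. A \<subseteq> E y}"] Q
    show "card {y \<in> Q. A \<subseteq> E y} \<le> u" by fastforce
  qed
  also have "\<dots> = u * (card P choose s)" unfolding \<A>_def by (simp add: n_subsets[OF P])
  finally show ?thesis .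
qed

text \<open>A threshold \<open>\<theta>\<close> for the degrees takes the place of convexity:
  degrees up to \<open>\<theta>\<close> or \<open>s\<close> are counted as they are, and a larger
  degree \<open>d\<close> satisfies \<open>d \<le> d ^ s / \<theta> ^ (s - 1)\<close>, which is
  controlled by the binomial coefficients. With \<open>\<theta> = m * n powr (- 1 / s)\<close> both
  contributions have the order \<open>m * n powr (1 - 1 / s)\<close>.\<close>

lemma KST_bound:
  assumes free: "K_free E s u" and P: "finite P" and Q: "finite Q" and s: "s \<ge> 1"
  shows "card (edges E P Q) \<le> (1 + s ^ s * u) * (real (card P) * real (card Q) powr (1 - 1 / s)) + s * card Q"
proof (cases "P = {} \<or> Q = {}")
  case True
  then have "edges E P Q = {}" unfolding edges_def by auto
  then show ?thesis by simp
next
  case False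
  define m n where "m = real (card P)" and "n = real (card Q)"
  have mn: "m \<ge> 1" "n \<ge> 1" unfolding m_def n_def using False P Q by (simp_all add: Suc_leI card_gt_0_iff)
  define \<theta> where "\<theta> = m * n powr (- 1 / s)"
  have \<theta>: "\<theta> > 0" unfolding \<theta>_def using mn by simp
  define d where "d y = card {p \<in> P. p \<in> E y}" for y
  have dy: "real (d y) \<le> s + \<theta> + s ^ s * real (d y choose s) / \<theta> ^ (s - 1)" for y
  proof (cases "d y \<le> s \<or> d y \<le> \<theta>")
    case True
    have "s ^ s * real (d y choose s) / \<theta> ^ (s - 1) \<ge> 0" using \<theta> by simp
    then show ?thesis using True \<theta> by (auto simp: add_increasing2 add_increasing)
  next
    case False
    then have sd: "s \<le> d y" and \<theta>d: "\<theta> \<le> d y" "d y > 0" using s by linarith+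
    have "real (d y) ^ s / real s ^ s \<le> real (d y choose s)"
      using binomial_ge_n_over_k_pow_k[OF sd, where 'a = real] by (simp add: power_divide)
    then have "real (d y) ^ s \<le> s ^ s * real (d y choose s)" using s by (simp add: field_simps)
    then have "real (d y) ^ s / \<theta> ^ (s - 1) \<le> s ^ s * real (d y choose s) / \<theta> ^ (s - 1)"
      using \<theta> by (intro divide_right_mono) auto
    moreover have "real (d y) \<le> real (d y) ^ s / \<theta> ^ (s - 1)"
    proof -
      have "real (d y) * \<theta> ^ (s - 1) \<le> real (d y) * real (d y) ^ (s - 1)"
        using \<theta> \<theta>d by (intro mult_left_mono power_mono) auto
      also have "\<dots> = real (d y) ^ s" using s by (metis Suc_diff_1 Suc_le_eq One_nat_def power_Suc)
      finally show ?thesis using \<theta> by (simp add: field_simps)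
    qed
    ultimately show ?thesis using \<theta> by linarith
  qed
  have "real (card (edges E P Q)) = (\<Sum>y\<in>Q. real (d y))" unfolding card_edges[OF P Q] d_def by simp
  also have "\<dots> \<le> (\<Sum>y\<in>Q. s + \<theta> + s ^ s * real (d y choose s) / \<theta> ^ (s - 1))" by (intro sum_mono dy)
  also have "\<dots> = (s + \<theta>) * n + s ^ s / \<theta> ^ (s - 1) * (\<Sum>y\<in>Q. real (d y choose s))"
    unfolding n_def by (simp add: sum.distrib sum_distrib_left sum_divide_distrib algebra_simps)
  also have "\<dots> \<le> (s + \<theta>) * n + s ^ s / \<theta> ^ (s - 1) * (u * m ^ s)"
  proof -
    have "(\<Sum>y\<in>Q. real (d y choose s)) \<le> real (u * (card P choose s))"
      using KST_binomial[OF free P Q] unfolding d_def by (metis of_nat_mono of_nat_sum)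
    also have "\<dots> \<le> u * m ^ s"
    proof -
      have "card P choose s \<le> card P ^ s"
        using binomial_le_pow[of s "card P"] by (cases "s \<le> card P") (auto simp: binomial_eq_0)
      then have "real (card P choose s) \<le> m ^ s" unfolding m_def by (metis of_nat_le_iff of_nat_power)
      then show ?thesis by (simp add: mult_left_mono)
    qed
    finally show ?thesis using \<theta> by (intro add_left_mono mult_left_mono) auto
  qed
  also have "\<theta> * n = m * n powr (1 - 1 / s)"
  proof -
    have "n powr (- 1 / s) * n powr 1 = n powr (- 1 / s + 1)" by (rule powr_add[symmetric])
    moreover have "n powr 1 = n" using mn by simp
    moreover have "- 1 / s + 1 = 1 - 1 / real s" by simp
    ultimately have "n powr (- 1 / s) * n = n powr (1 - 1 / s)" by metis
    then show ?thesis unfolding \<theta>_def by (simp add: algebra_simps)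
  qed
  then have "(s + \<theta>) * n = s * n + m * n powr (1 - 1 / s)" by (simp add: algebra_simps)
  also have "s ^ s / \<theta> ^ (s - 1) * (u * m ^ s) = s ^ s * u * (m * n powr (1 - 1 / s))"
  proof -
    have "\<theta> ^ (s - 1) * (n powr (1 - 1 / s)) = m ^ (s - 1)"
    proof -
      have "(n powr (- 1 / s)) ^ (s - 1) = n powr (- 1 / s * (s - 1))"
        using s mn by (simp add: powr_power of_nat_diff mult.commute)
      moreover have "- 1 / s * (real s - 1) + (1 - 1 / s) = 0" using s by (simp add: field_simps)
      ultimately show ?thesis unfolding \<theta>_def power_mult_distrib using mn s
        by (simp add: mult.assoc powr_add[symmetric] of_nat_diff)
    qed
    moreover have "m ^ s = m * m ^ (s - 1)" using s by (metis Suc_diff_1 Suc_le_eq One_nat_def power_Suc)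
    ultimately have "m ^ s = \<theta> ^ (s - 1) * (m * n powr (1 - 1 / s))" by (simp add: mult_ac)
    then show ?thesis using \<theta> by simp
  qed
  finally show ?thesis unfolding m_def n_def by (simp add: algebra_simps)
qed

section \<open>The edge bound\<close>

text \<open>Each point is assigned to one cell that contains it. A class of at least
  \<open>s\<close> points is contained in fewer than \<open>u\<close> of the sets
  \<open>E y\<close>; any other parameter with an edge to it crosses the cell, and the
  Kovari--Sos--Turan bound applies to those. The classes with fewer than \<open>s\<close> points go
  into \<open>P'\<close>.\<close>

lemma class_step:
  fixes \<nu> :: real
  assumes free: "K_free E s u" and P: "finite P" and Q: "finite Q" and s: "s \<ge> 1"
    and T: "finite \<T>" "P \<subseteq> \<Union>\<T>" and cr: "\<And>\<Delta>. \<Delta> \<in> \<T> \<Longrightarrow> card (crossing E P Q \<Delta>) \<le> \<nu>"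
  shows "\<exists>P'\<subseteq>P. card P' \<le> s * card \<T> \<and> card (edges E P Q) \<le> card (edges E P' Q) + u * card P
    + (1 + s ^ s * u) * (card P * \<nu> powr (1 - 1 / s)) + s * \<nu> * card \<T>"
proof -
  have "\<forall>p\<in>P. \<exists>\<Delta>. \<Delta> \<in> \<T> \<and> p \<in> \<Delta>" using T(2) by blast
  from bchoice[OF this] obtain f where f: "\<And>p. p \<in> P \<Longrightarrow> f p \<in> \<T> \<and> p \<in> f p" by blast
  define cl where "cl \<Delta> = {p \<in> P. f p = \<Delta>}" for \<Delta>
  define \<B> where "\<B> = {\<Delta> \<in> \<T>. s \<le> card (cl \<Delta>)}"
  define P' where "P' = (\<Union>\<Delta>\<in>\<T> - \<B>. cl \<Delta>)"
  have fcl: "finite (cl \<Delta>)" for \<Delta> unfolding cl_def using P by simp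
  have fB: "finite \<B>" unfolding \<B>_def using T(1) by simp
  have P'P: "P' \<subseteq> P" unfolding P'_def cl_def by auto
  have "card P' \<le> (\<Sum>\<Delta>\<in>\<T> - \<B>. card (cl \<Delta>))" unfolding P'_def using T(1) by (intro card_UN_le) simp
  also have "\<dots> \<le> (\<Sum>\<Delta>\<in>\<T> - \<B>. s)" unfolding \<B>_def by (intro sum_mono) auto
  also have "\<dots> \<le> s * card \<T>" using T(1) by (simp add: card_mono)
  finally have cP': "card P' \<le> s * card \<T>" .
  have sub: "edges E P Q \<subseteq> edges E P' Q \<union> (\<Union>\<Delta>\<in>\<B>. edges E (cl \<Delta>) Q)"
  proof
    fix z assume z: "z \<in> edges E P Q"
    obtain p y where py: "z = (p, y)" "p \<in> P" "y \<in> Q" "p \<in> E y" using z unfolding edges_def by auto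
    have pc: "p \<in> cl (f p)" unfolding cl_def using py by simp
    show "z \<in> edges E P' Q \<union> (\<Union>\<Delta>\<in>\<B>. edges E (cl \<Delta>) Q)"
    proof (cases "f p \<in> \<B>")
      case True
      then show ?thesis using pc py unfolding edges_def by auto
    next
      case False
      then have "p \<in> P'" unfolding P'_def using pc f[OF py(2)] by blast
      then show ?thesis using py unfolding edges_def by auto
    qed
  qed
  define B where "B \<Delta> = u * card (cl \<Delta>) + (1 + s ^ s * u) * (card (cl \<Delta>) * \<nu> powr (1 - 1 / s)) + s * \<nu>" for \<Delta>
  have cls: "card (edges E (cl \<Delta>) Q) \<le> B \<Delta>" if D: "\<Delta> \<in> \<B>" for \<Delta>
  proof -
    have DT: "\<Delta> \<in> \<T>" "s \<le> card (cl \<Delta>)" using D unfolding \<B>_def by auto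
    define X where "X = crossing E P Q \<Delta>"
    define Y where "Y = {y \<in> Q. cl \<Delta> \<subseteq> E y}"
    have fX: "finite X" "finite Y" unfolding X_def Y_def crossing_def using Q by auto
    have "cl \<Delta> \<subseteq> \<Delta> \<inter> P" unfolding cl_def using f by auto
    then have "edges E (cl \<Delta>) Q \<subseteq> edges E (cl \<Delta>) X \<union> cl \<Delta> \<times> Y"
      unfolding edges_def X_def Y_def crossing_def by blast
    then have "card (edges E (cl \<Delta>) Q) \<le> card (edges E (cl \<Delta>) X \<union> cl \<Delta> \<times> Y)"
      using fX fcl by (intro card_mono) (auto intro: edges_finite)
    also have "\<dots> \<le> card (edges E (cl \<Delta>) X) + card (cl \<Delta>) * card Y"
      using card_Un_le[of "edges E (cl \<Delta>) X" "cl \<Delta> \<times> Y"] by (simp add: card_cartesian_product)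
    finally have 1: "real (card (edges E (cl \<Delta>) Q)) \<le> real (card (edges E (cl \<Delta>) X)) + real (card (cl \<Delta>)) * real (card Y)"
      by (metis of_nat_add of_nat_le_iff of_nat_mult)
    have "card Y < u" using K_free_few_common[OF free fcl DT(2) fX(2)] unfolding Y_def by auto
    then have 2: "real (card (cl \<Delta>)) * real (card Y) \<le> real (card (cl \<Delta>)) * u" by (intro mult_left_mono) auto
    have 3: "real (card (edges E (cl \<Delta>) X)) \<le> (1 + s ^ s * u) * (real (card (cl \<Delta>)) * real (card X) powr (1 - 1 / s)) + s * card X"
      using KST_bound[OF free fcl fX(1) s] by simp
    have Xn: "real (card X) \<le> \<nu>" unfolding X_def using cr[OF DT(1)] .
    have "real (card X) powr (1 - 1 / s) \<le> \<nu> powr (1 - 1 / s)" using Xn s by (intro powr_mono2) auto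
    then have 4: "(1 + s ^ s * u) * (real (card (cl \<Delta>)) * real (card X) powr (1 - 1 / s))
      \<le> (1 + s ^ s * u) * (real (card (cl \<Delta>)) * \<nu> powr (1 - 1 / s))"
      by (intro mult_left_mono) auto
    have "real s * card X \<le> s * \<nu>" using Xn by (intro mult_left_mono) auto
    then show ?thesis unfolding B_def using 1 2 3 4 by (simp add: mult.commute)
  qed
  have tot: "(\<Sum>\<Delta>\<in>\<B>. card (cl \<Delta>)) \<le> card P"
  proof -
    have "(\<Sum>\<Delta>\<in>\<B>. card (cl \<Delta>)) = card (\<Union>\<Delta>\<in>\<B>. cl \<Delta>)"
      using fB fcl unfolding cl_def by (intro card_UN_disjoint[symmetric]) auto
    also have "\<dots> \<le> card P" using P unfolding cl_def by (intro card_mono) auto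
    finally show ?thesis .
  qed
  have "card (edges E P Q) \<le> card (edges E P' Q) + (\<Sum>\<Delta>\<in>\<B>. card (edges E (cl \<Delta>) Q))"
  proof -
    have fP': "finite P'" using P'P P finite_subset by blast
    have "card (edges E P Q) \<le> card (edges E P' Q \<union> (\<Union>\<Delta>\<in>\<B>. edges E (cl \<Delta>) Q))"
      using sub fB fP' fcl Q by (intro card_mono) (auto intro: edges_finite)
    also have "\<dots> \<le> card (edges E P' Q) + card (\<Union>\<Delta>\<in>\<B>. edges E (cl \<Delta>) Q)" by (rule card_Un_le)
    also have "\<dots> \<le> card (edges E P' Q) + (\<Sum>\<Delta>\<in>\<B>. card (edges E (cl \<Delta>) Q))"
      using card_UN_le[OF fB, of "\<lambda>\<Delta>. edges E (cl \<Delta>) Q"] by simp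
    finally show ?thesis .
  qed
  then have "real (card (edges E P Q)) \<le> card (edges E P' Q) + (\<Sum>\<Delta>\<in>\<B>. real (card (edges E (cl \<Delta>) Q)))"
    by (metis of_nat_add of_nat_le_iff of_nat_sum)
  also have "(\<Sum>\<Delta>\<in>\<B>. real (card (edges E (cl \<Delta>) Q))) \<le> (\<Sum>\<Delta>\<in>\<B>. B \<Delta>)" by (intro sum_mono cls)
  also have "(\<Sum>\<Delta>\<in>\<B>. B \<Delta>) = (u + (1 + s ^ s * u) * \<nu> powr (1 - 1 / s)) * (\<Sum>\<Delta>\<in>\<B>. card (cl \<Delta>)) + s * \<nu> * card \<B>"
  proof -
    have "B \<Delta> = (u + (1 + s ^ s * u) * \<nu> powr (1 - 1 / s)) * card (cl \<Delta>) + s * \<nu>" for \<Delta>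
      unfolding B_def by (simp add: algebra_simps)
    then show ?thesis by (simp add: sum.distrib sum_distrib_left)
  qed
  also have "\<dots> \<le> (u + (1 + s ^ s * u) * \<nu> powr (1 - 1 / s)) * card P + s * \<nu> * card \<T>"
  proof (rule add_mono)
    show "(u + (1 + s ^ s * u) * \<nu> powr (1 - 1 / s)) * (\<Sum>\<Delta>\<in>\<B>. card (cl \<Delta>)) \<le> (u + (1 + s ^ s * u) * \<nu> powr (1 - 1 / s)) * card P"
      by (rule mult_left_mono[OF of_nat_mono[OF tot]]) simp
    have "card \<B> \<le> card \<T>" unfolding \<B>_def using T(1) by (intro card_mono) auto
    moreover have "0 \<le> \<nu>" if "\<T> \<noteq> {}"
    proof -
      obtain \<Delta> where "\<Delta> \<in> \<T>" using \<open>\<T> \<noteq> {}\<close> by blast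
      from cr[OF this] show ?thesis by linarith
    qed
    ultimately show "s * \<nu> * card \<B> \<le> s * \<nu> * card \<T>"
      unfolding \<B>_def by (cases "\<T> = {}") (auto intro!: mult_left_mono)
  qed
  finally show ?thesis using cP' P'P by (intro exI[of _ P']) (simp add: algebra_simps)
qed

text \<open>With a cutting into about \<open>r\<^bsup>t\<^esup>\<close> cells of crossing number \<open>n / r\<close>, the crossing pairs contribute
  about \<open>m (n / r)\<^bsup>1 - 1/s\<^esup> + r\<^bsup>t-1\<^esup> n\<close>. The number \<open>balance s t m n\<close> is the \<open>r\<close> for which both terms
  agree, and \<open>wt s t m n\<close> is their common value.\<close>

definition wt :: "nat \<Rightarrow> nat \<Rightarrow> real \<Rightarrow> real \<Rightarrow> real" where
  "wt s t m n = m powr ((real t - 1) * s / (real t * s - 1)) * n powr (real t * (real s - 1) / (real t * s - 1))"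

definition balance :: "nat \<Rightarrow> nat \<Rightarrow> real \<Rightarrow> real \<Rightarrow> real" where
  "balance s t m n = m powr (s / (real t * s - 1)) * n powr (- 1 / (real t * s - 1))"

text \<open>The first two identities say that at \<open>r = balance s t m n\<close> both
  \<open>m * (n / r) powr (1 - 1 / s)\<close> and \<open>r ^ (t - 1) * n\<close> equal
  \<open>wt s t m n\<close>. By the third, for \<open>m = O(n^t)\<close> this \<open>r\<close> has a
  \<open>t\<close>-th power of order at most \<open>m\<close>, so that the leftover points can be
  made at most half of all.\<close>

lemma balance_identities:
  fixes m n :: real
  assumes s: "s \<ge> 2" and t: "t \<ge> 1" and mn: "m \<ge> 1" "n \<ge> 1"
  shows "m * n powr (1 - 1 / s) = wt s t m n * balance s t m n powr (1 - 1 / s)"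
    and "balance s t m n ^ (t - 1) * n = wt s t m n"
    and "\<kappa> \<ge> 1 \<Longrightarrow> m \<le> \<kappa> * n ^ t \<Longrightarrow> balance s t m n ^ t \<le> \<kappa> * m"
proof -
  define D where "D = real t * s - 1"
  have "real t * s \<ge> 1 * 2" using s t by (intro mult_mono) auto
  then have D: "D \<ge> 1" unfolding D_def by simp
  have pw: "(m powr x1 * n powr x2) powr z = m powr (x1 * z) * n powr (x2 * z)" for x1 x2 z
    by (simp add: powr_mult powr_powr)
  have cmb: "(m powr x1 * n powr x2) * (m powr y1 * n powr y2) = m powr (x1 + y1) * n powr (x2 + y2)" for x1 x2 y1 y2
    by (simp add: powr_add)
  have e1: "(real t - 1) * s / D + s / D * (1 - 1 / s) = 1"
  proof -
    have "(real t - 1) * s / D + s / D * (1 - 1 / s) = ((real t - 1) * s + s * (1 - 1 / s)) / D" by (simp add: add_divide_distrib)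
    also have "(real t - 1) * s + s * (1 - 1 / s) = D" unfolding D_def using s by (simp add: field_simps)
    finally show ?thesis using D by simp
  qed
  have e2: "real t * (real s - 1) / D + (- 1 / D) * (1 - 1 / s) = 1 - 1 / s"
  proof -
    have "real t * (real s - 1) / D + (- 1 / D) * (1 - 1 / s) = (real t * (real s - 1) - (1 - 1 / s)) / D" by (simp add: diff_divide_distrib)
    also have "real t * (real s - 1) - (1 - 1 / s) = D * (1 - 1 / s)" unfolding D_def using s by (simp add: field_simps)
    finally show ?thesis using D by simp
  qed
  show "m * n powr (1 - 1 / s) = wt s t m n * balance s t m n powr (1 - 1 / s)"
    unfolding wt_def balance_def D_def[symmetric] pw cmb e1 e2 using mn by simp
  have bp: "balance s t m n ^ j = m powr (s / D * j) * n powr (- 1 / D * j)" for j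
  proof -
    have "balance s t m n > 0" unfolding balance_def using mn by simp
    then have "balance s t m n ^ j = balance s t m n powr j" by (simp add: powr_realpow)
    then show ?thesis unfolding balance_def D_def[symmetric] pw .
  qed
  have f1: "s / D * real (t - 1) + 0 = (real t - 1) * s / D" using t by (simp add: of_nat_diff)
  have f2: "- 1 / D * real (t - 1) + 1 = real t * (real s - 1) / D"
  proof -
    have "- 1 / D * real (t - 1) + 1 = (D - (real t - 1)) / D" using t D by (simp add: of_nat_diff diff_divide_distrib)
    also have "D - (real t - 1) = real t * (real s - 1)" unfolding D_def by (simp add: algebra_simps)
    finally show ?thesis .
  qed
  have "balance s t m n ^ (t - 1) * n = (m powr (s / D * real (t - 1)) * n powr (- 1 / D * real (t - 1))) * (m powr 0 * n powr 1)"
    unfolding bp using mn by simp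
  also have "\<dots> = wt s t m n" unfolding cmb f1 f2 wt_def D_def[symmetric] ..
  finally show "balance s t m n ^ (t - 1) * n = wt s t m n" .
  show "balance s t m n ^ t \<le> \<kappa> * m" if \<kappa>: "\<kappa> \<ge> 1" "m \<le> \<kappa> * n ^ t"
  proof -
    have g1: "s / D * t = 1 + 1 / D" using D unfolding D_def by (simp add: field_simps)
    have "balance s t m n ^ t = m * (m powr (1 / D) * n powr (- 1 / D * t))"
      unfolding bp g1 powr_add using mn by simp
    also have "\<dots> \<le> m * ((\<kappa> * n ^ t) powr (1 / D) * n powr (- 1 / D * t))"
      using \<kappa> mn D by (intro mult_left_mono mult_right_mono powr_mono2) auto
    also have "(\<kappa> * n ^ t) powr (1 / D) = \<kappa> powr (1 / D) * n powr (t * (1 / D))"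
      using \<kappa> mn by (simp add: powr_mult powr_realpow[symmetric] powr_powr)
    also have "m * (\<kappa> powr (1 / D) * n powr (t * (1 / D)) * n powr (- 1 / D * t)) = m * \<kappa> powr (1 / D)"
      using mn by (simp add: mult.assoc powr_add[symmetric])
    also have "\<dots> \<le> m * \<kappa> powr 1" using \<kappa> mn D by (intro mult_left_mono powr_mono) auto
    finally show ?thesis using \<kappa> by (simp add: mult.commute)
  qed
qed

lemma wt_mono: "0 \<le> m \<Longrightarrow> m \<le> m' \<Longrightarrow> s \<ge> 2 \<Longrightarrow> t \<ge> 1 \<Longrightarrow> wt s t m n \<le> wt s t m' n"
proof -
  assume a: "0 \<le> m" "m \<le> m'" "s \<ge> 2" "t \<ge> 1"
  have "real t * s \<ge> 1 * 2" using a by (intro mult_mono) auto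
  then show ?thesis unfolding wt_def using a by (intro mult_right_mono powr_mono2) auto
qed

lemma wt_nonneg: "0 \<le> wt s t m n"
  unfolding wt_def by simp

lemma edges_empty [simp]: "edges E {} Q = {}"
  unfolding edges_def by simp

text \<open>The points in cells with fewer than \<open>s\<close> points form \<open>P'\<close>. If \<open>balance\<close> is too small for a
  cutting, then the bound for \<open>K\<^bsub>s,u\<^esub>\<close>-free graphs applies to all of \<open>P\<close>, and \<open>P'\<close> is empty.\<close>

lemma halving_step:
  fixes \<Lambda> :: real
  assumes rd: "rel_decomp C k t E" and free: "K_free E s u" and s: "s \<ge> 2" and t: "t \<ge> 1" and C: "C \<ge> 1"
    and P: "finite P" "P \<noteq> {}" and Q: "finite Q" "Q \<noteq> {}"
    and \<Lambda>: "\<Lambda> = C * (ln (C * card Q ^ k) + 2) ^ t"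
    and \<kappa>: "\<kappa> = real (s * C)" and Pb: "card P \<le> \<kappa> * real (card Q) ^ t"
    and c: "c = real (1 + s ^ s * u)"
  shows "\<exists>P'\<subseteq>P. 2 * card P' \<le> card P \<and> card (edges E P Q) \<le> card (edges E P' Q) + u * card P
      + (2 * c * s * \<kappa> + s) * \<Lambda> * wt s t (card P) (card Q) + (if P' = {} then s * card Q else 0)"
proof -
  define m n where "m = real (card P)" and "n = real (card Q)"
  have mn: "m \<ge> 1" "n \<ge> 1" unfolding m_def n_def using P Q by (simp_all add: Suc_leI card_gt_0_iff)
  have s1: "s \<ge> 1" "s > 0" using s by auto
  have "1 * 1 \<le> s * C" using s C by (intro mult_mono) auto
  then have \<kappa>1: "\<kappa> \<ge> 1" unfolding \<kappa> by (simp only: real_of_nat_ge_one_iff)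
  have "card Q ^ k \<ge> 1" using Q by (simp add: card_gt_0_iff Suc_leI)
  then have "C * card Q ^ k \<ge> 1" using C by simp
  then have lnn: "ln (C * card Q ^ k) \<ge> 0" by (simp only: ln_ge_zero real_of_nat_ge_one_iff)
  have "1 ^ t \<le> (ln (C * card Q ^ k) + 2) ^ t" using lnn by (intro power_mono) auto
  then have "1 * 1 \<le> real C * (ln (C * card Q ^ k) + 2) ^ t" using C by (intro mult_mono) auto
  then have \<Lambda>1: "\<Lambda> \<ge> 1" unfolding \<Lambda> by simp
  define W where "W = wt s t m n"
  define r0 where "r0 = balance s t m n"
  \<comment> \<open>With \<open>r = r0 / \<tau>\<close> and \<open>\<tau> ^ t = T\<close>, the
    points left over by the cutting number at most
    \<open>s * \<Lambda> * r ^ t = r0 ^ t / (2 * \<kappa>)\<close>, which is at most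
    \<open>m / 2\<close>.\<close>
  define T where "T = 2 * s * \<kappa> * \<Lambda>"
  have "1 * 1 * 1 \<le> 2 * s * \<kappa> * \<Lambda>" using \<kappa>1 \<Lambda>1 s1 by (intro mult_mono) auto
  then have T1: "T \<ge> 1" unfolding T_def by simp
  define \<tau> where "\<tau> = T powr (1 / t)"
  have \<tau>: "\<tau> \<ge> 1" unfolding \<tau>_def using T1 by (simp add: ge_one_powr_ge_zero)
  have \<tau>t: "\<tau> ^ t = T" unfolding \<tau>_def using T1 t by (simp add: powr_power)
  have r0: "r0 > 0" unfolding r0_def balance_def using mn by simp
  have W: "W \<ge> 0" unfolding W_def by (rule wt_nonneg)
  have c1: "c \<ge> 0" unfolding c by simp
  have \<tau>T: "\<tau> powr (1 - 1 / s) \<le> T"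
  proof -
    have "\<tau> powr (1 - 1 / s) \<le> \<tau> powr 1" using \<tau> s1 by (intro powr_mono) auto
    also have "\<dots> \<le> \<tau> ^ t" using \<tau> t power_increasing[of 1 t \<tau>] by simp
    finally show ?thesis using \<tau>t by simp
  qed
  note id = balance_identities[OF s t mn, folded W_def r0_def]
  have cT: "c * (W * T) = 2 * c * s * \<kappa> * \<Lambda> * W" unfolding T_def by simp
  show ?thesis
  proof (cases "r0 < \<tau>")
    case True
    have "r0 powr (1 - 1 / s) \<le> \<tau> powr (1 - 1 / s)" using True r0 s1 by (intro powr_mono2) auto
    then have "W * r0 powr (1 - 1 / s) \<le> W * T" using W \<tau>T by (intro mult_left_mono) auto
    then have "c * (m * n powr (1 - 1 / s)) \<le> c * (W * T)" using id(1) c1 by (simp add: mult_left_mono)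
    moreover have "card (edges E P Q) \<le> c * (m * n powr (1 - 1 / s)) + s * n"
      using KST_bound[OF free P(1) Q(1) s1(1)] unfolding c m_def n_def by simp
    moreover have "0 \<le> s * \<Lambda> * W" using \<Lambda>1 W by simp
    ultimately have "card (edges E P Q) \<le> c * (W * T) + s * \<Lambda> * W + s * n" by linarith
    then have "card (edges E P Q) \<le> (2 * c * s * \<kappa> + s) * \<Lambda> * W + s * n"
      unfolding cT by (simp add: distrib_right)
    moreover have "0 \<le> u * m" using mn by simp
    ultimately have "card (edges E P Q) \<le> card (edges E {} Q) + u * m + (2 * c * s * \<kappa> + s) * \<Lambda> * W + s * n"
      by linarith
    then show ?thesis unfolding m_def n_def W_def by (intro exI[of _ "{}"]) simp
  next
    case False
    define r where "r = r0 / \<tau>"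
    have r: "r \<ge> 1" "r \<le> r0" unfolding r_def using False \<tau> r0 by (simp_all add: field_simps)
    have "0 < 1 / r" "1 / r \<le> 1" using r by auto
    from cutting[OF rd P(1) Q C this] obtain \<T> where T: "finite \<T>" "P \<subseteq> \<Union>\<T>"
      "card \<T> \<le> C * ((ln (C * card Q ^ k) + 2) / (1 / r)) ^ t"
      "\<forall>\<Delta>\<in>\<T>. card (crossing E P Q \<Delta>) \<le> 1 / r * card Q" by (elim exE conjE)
    have cT': "card \<T> \<le> \<Lambda> * r ^ t" using T(3) unfolding \<Lambda> by (simp add: power_mult_distrib)
    have cr: "card (crossing E P Q \<Delta>) \<le> n / r" if "\<Delta> \<in> \<T>" for \<Delta> using T(4) that unfolding n_def by simp
    from class_step[OF free P(1) Q(1) s1(1) T(1,2) cr] obtain P' where P': "P' \<subseteq> P" "card P' \<le> s * card \<T>"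
      "card (edges E P Q) \<le> card (edges E P' Q) + u * card P
        + c * (card P * (n / r) powr (1 - 1 / s)) + s * (n / r) * card \<T>" unfolding c by auto
    have "2 * real (card P') \<le> 2 * (s * (\<Lambda> * r ^ t))"
    proof -
      have "real (card P') \<le> s * real (card \<T>)" using P'(2) by (metis of_nat_le_iff of_nat_mult)
      also have "\<dots> \<le> s * (\<Lambda> * r ^ t)" using cT' by (intro mult_left_mono) auto
      finally show ?thesis by simp
    qed
    also have "\<dots> = r0 ^ t / \<kappa>"
      unfolding r_def power_divide \<tau>t T_def using \<kappa>1 \<Lambda>1 s1 by (simp add: field_simps)
    also have "\<dots> \<le> m" using id(3)[OF \<kappa>1] Pb \<kappa>1 unfolding m_def n_def by (simp add: field_simps)
    finally have half: "2 * card P' \<le> card P" unfolding m_def by linarith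
    have "m * (n / r) powr (1 - 1 / s) \<le> W * T"
    proof -
      have "m * (n / r) powr (1 - 1 / s) = W * r0 powr (1 - 1 / s) / r powr (1 - 1 / s)"
        using id(1) mn r by (simp add: powr_divide)
      also have "\<dots> = W * (r0 / r) powr (1 - 1 / s)" using r r0 by (simp add: powr_divide)
      also have "r0 / r = \<tau>" unfolding r_def using \<tau> r0 by simp
      finally show ?thesis using \<tau>T W by (simp add: mult_left_mono)
    qed
    then have 1: "c * (m * (n / r) powr (1 - 1 / s)) \<le> 2 * c * s * \<kappa> * \<Lambda> * W"
      using c1 mult_left_mono[of _ _ c] cT by metis
    have 2: "s * (n / r) * card \<T> \<le> s * \<Lambda> * W"
    proof -
      have "s * (n / r) * card \<T> \<le> s * (n / r) * (\<Lambda> * r ^ t)" using cT' r mn by (intro mult_left_mono) auto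
      also have "r ^ t = r * r ^ (t - 1)" using t by (metis Suc_diff_1 Suc_le_eq One_nat_def power_Suc)
      also have "s * (n / r) * (\<Lambda> * (r * r ^ (t - 1))) = s * \<Lambda> * (r ^ (t - 1) * n)" using r by simp
      also have "\<dots> \<le> s * \<Lambda> * (r0 ^ (t - 1) * n)"
        using r mn \<Lambda>1 by (intro mult_left_mono mult_right_mono power_mono) auto
      finally show ?thesis using id(2) by simp
    qed
    have "card (edges E P Q) \<le> card (edges E P' Q) + u * card P + (2 * c * s * \<kappa> + s) * \<Lambda> * W"
      using P'(3) 1 2 unfolding m_def[symmetric] by (simp add: algebra_simps)
    moreover have "0 \<le> (if P' = {} then s * card Q else 0)" by simp
    ultimately have "card (edges E P Q) \<le> card (edges E P' Q) + u * card P
      + (2 * c * s * \<kappa> + s) * \<Lambda> * wt s t (card P) (card Q) + (if P' = {} then s * card Q else 0)"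
      unfolding W_def m_def n_def by simp
    then show ?thesis using P'(1) half by blast
  qed
qed

text \<open>The terms \<open>u * card P\<close> add up like a geometric series, each
  \<open>wt\<close> is bounded by the first one, and \<open>s * card Q\<close> is paid only once, in
  the step that leaves no point.\<close>

lemma halving_iterate:
  fixes \<Lambda> :: real
  assumes rd: "rel_decomp C k t E" and free: "K_free E s u" and s: "s \<ge> 2" and t: "t \<ge> 1" and C: "C \<ge> 1"
    and Q: "finite Q" "Q \<noteq> {}"
    and \<Lambda>: "\<Lambda> = C * (ln (C * card Q ^ k) + 2) ^ t"
    and \<kappa>: "\<kappa> = real (s * C)" and c: "c = real (1 + s ^ s * u)"
    and L: "L = (2 * c * s * \<kappa> + s) * \<Lambda>" and L0: "L \<ge> 0"
    and P: "finite P" "card P < 2 ^ i" "card P \<le> \<kappa> * real (card Q) ^ t"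
  shows "card (edges E P Q) \<le> 2 * real u * card P + i * L * wt s t (card P) (card Q) + s * card Q"
  using P
proof (induction i arbitrary: P)
  case 0
  then show ?case by simp
next
  case (Suc i)
  show ?case
  proof (cases "P = {}")
    case True
    then show ?thesis using L0 wt_nonneg by simp
  next
    case False
    obtain P' where P': "P' \<subseteq> P" "2 * card P' \<le> card P" "card (edges E P Q) \<le> card (edges E P' Q) + u * card P
      + L * wt s t (card P) (card Q) + (if P' = {} then s * card Q else 0)"
      using halving_step[OF rd free s t C Suc.prems(1) False Q \<Lambda> \<kappa> Suc.prems(3) c] unfolding L[symmetric] by blast
    have Suci: "Suc i * L * wt s t (card P) (card Q) = i * L * wt s t (card P) (card Q) + L * wt s t (card P) (card Q)"
      by (simp add: algebra_simps)
    have nn: "0 \<le> i * L * wt s t (card P) (card Q)" using L0 wt_nonneg by simp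
    show ?thesis
    proof (cases "P' = {}")
      case True
      have e: "card (edges E P Q) \<le> real u * card P + L * wt s t (card P) (card Q) + s * card Q"
        using P'(3) True by simp
      have "real u * card P \<ge> 0" by simp
      with e nn show ?thesis unfolding Suci by linarith
    next
      case False
      have "finite P'" using P'(1) Suc.prems(1) finite_subset by blast
      moreover have "card P' < 2 ^ i" using P'(2) Suc.prems(2) by simp
      moreover have "card P' \<le> \<kappa> * real (card Q) ^ t" using P'(2) Suc.prems(3) by linarith
      ultimately have "card (edges E P' Q) \<le> 2 * real u * card P' + i * L * wt s t (card P') (card Q) + s * card Q"
        by (rule Suc.IH)
      moreover have "i * L * wt s t (card P') (card Q) \<le> i * L * wt s t (card P) (card Q)"
        using P'(2) s t L0 by (intro mult_left_mono wt_mono) auto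
      moreover have "2 * real u * card P' \<le> real u * card P"
      proof -
        have "real u * real (2 * card P') \<le> real u * card P" using P'(2) by (intro mult_left_mono) auto
        then show ?thesis by simp
      qed
      moreover have "card (edges E P Q) \<le> card (edges E P' Q) + real u * card P + L * wt s t (card P) (card Q)"
        using P'(3) False by simp
      ultimately show ?thesis unfolding Suci by linarith
    qed
  qed
qed

lemma polylog_bound:
  fixes C \<kappa> \<epsilon> :: real
  assumes C: "C \<ge> 1" and \<kappa>: "\<kappa> \<ge> 1" and \<epsilon>: "\<epsilon> > 0"
  shows "\<exists>A\<ge>0. \<forall>n\<ge>1. (2 * ln (\<kappa> * n ^ t) + 1) * (C * (ln (C * n ^ k) + 2) ^ t) \<le> A * n powr \<epsilon>"
proof -
  \<comment> \<open>There are \<open>t + 1\<close> logarithmic factors, each of which is allowed a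
    power \<open>\<eta>\<close> of \<open>n\<close>.\<close>
  define \<eta> where "\<eta> = \<epsilon> / (t + 1)"
  have \<eta>: "\<eta> > 0" unfolding \<eta>_def using \<epsilon> by simp
  define A1 where "A1 = 2 * ln \<kappa> + 2 * t / \<eta> + 1"
  define A2 where "A2 = ln C + k / \<eta> + 2"
  have lnC: "ln C \<ge> 0" "ln \<kappa> \<ge> 0" using C \<kappa> by auto
  have A: "A1 \<ge> 0" "A2 \<ge> 0" unfolding A1_def A2_def using \<eta> lnC by auto
  have "(2 * ln (\<kappa> * n ^ t) + 1) * (C * (ln (C * n ^ k) + 2) ^ t) \<le> (A1 * (C * A2 ^ t)) * n powr \<epsilon>" if n: "n \<ge> 1" for n
  proof -
    define N where "N = n powr \<eta>"
    have N: "N \<ge> 1" unfolding N_def using n \<eta> by (simp add: ge_one_powr_ge_zero)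
    have ln: "0 \<le> ln n" "ln n \<le> N / \<eta>" unfolding N_def using n \<eta> ln_powr_bound[of n \<eta>] by auto
    have up: "x \<le> x * N" if "x \<ge> 0" for x using mult_left_mono[OF N that] by simp
    have "2 * ln (\<kappa> * n ^ t) + 1 = 2 * ln \<kappa> + 2 * t * ln n + 1" using n \<kappa> by (simp add: ln_mult ln_realpow)
    also have "\<dots> \<le> 2 * ln \<kappa> * N + 2 * t * (N / \<eta>) + N"
      using N lnC up[of "2 * ln \<kappa>"] ln by (intro add_mono mult_left_mono) auto
    also have "\<dots> = A1 * N" unfolding A1_def by (simp add: algebra_simps)
    finally have 1: "2 * ln (\<kappa> * n ^ t) + 1 \<le> A1 * N" .
    have eq: "ln (C * n ^ k) + 2 = ln C + k * ln n + 2" using n C by (simp add: ln_mult ln_realpow)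
    also have "\<dots> \<le> ln C * N + k * (N / \<eta>) + 2 * N"
      using N lnC up[of "ln C"] ln by (intro add_mono mult_left_mono) auto
    also have "\<dots> = A2 * N" unfolding A2_def by (simp add: algebra_simps)
    finally have 2: "ln (C * n ^ k) + 2 \<le> A2 * N" .
    have nn: "0 \<le> ln (C * n ^ k) + 2" unfolding eq using lnC ln by simp
    have "(2 * ln (\<kappa> * n ^ t) + 1) * (C * (ln (C * n ^ k) + 2) ^ t) \<le> (A1 * N) * (C * (A2 * N) ^ t)"
      using 1 2 nn A N C by (intro mult_mono mult_left_mono power_mono) auto
    also have "\<dots> = (A1 * (C * A2 ^ t)) * N ^ (t + 1)" by (simp add: power_mult_distrib algebra_simps)
    also have "N ^ (t + 1) = n powr \<epsilon>"
    proof -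
      have "N ^ (t + 1) = n powr (real (t + 1) * \<eta>)" unfolding N_def using n by (subst powr_power) auto
      moreover have "real (t + 1) * \<eta> = \<epsilon>" unfolding \<eta>_def by simp
      ultimately show ?thesis by simp
    qed
    finally show ?thesis .
  qed
  then show ?thesis using A C by (intro exI[of _ "A1 * (C * A2 ^ t)"]) auto
qed

lemma rel_decomp_mono:
  fixes E :: "'y \<Rightarrow> 'p set"
  assumes "rel_decomp C k t E" "C \<le> C'"
  shows "rel_decomp C' k t E"
  unfolding rel_decomp_def
proof (intro allI impI)
  fix P :: "'p set" and Q :: "'y set"
  assume "finite P" "finite Q"
  then obtain \<C> where c: "finite \<C>" "card \<C> \<le> C * card Q ^ k"
    "\<And>S. S \<subseteq> Q \<Longrightarrow> S \<noteq> {} \<Longrightarrow> \<exists>\<T>\<subseteq>\<C>. P \<subseteq> \<Union>\<T> \<and> card \<T> \<le> C * card S ^ t \<and>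
        (\<forall>\<Delta>\<in>\<T>. \<forall>y\<in>S. \<Delta> \<inter> P \<subseteq> E y \<or> \<Delta> \<inter> P \<inter> E y = {})"
    using assms(1) unfolding rel_decomp_def by metis
  have le: "C * x \<le> C' * x" for x using assms(2) by simp
  show "\<exists>\<C>. finite \<C> \<and> card \<C> \<le> C' * card Q ^ k \<and>
     (\<forall>S. S \<subseteq> Q \<longrightarrow> S \<noteq> {} \<longrightarrow> (\<exists>\<T>\<subseteq>\<C>. P \<subseteq> \<Union>\<T> \<and> card \<T> \<le> C' * card S ^ t \<and>
        (\<forall>\<Delta>\<in>\<T>. \<forall>y\<in>S. \<Delta> \<inter> P \<subseteq> E y \<or> \<Delta> \<inter> P \<inter> E y = {})))"
  proof (rule exI[of _ \<C>], intro conjI allI impI)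
    show "card \<C> \<le> C' * card Q ^ k" using c(2) le order_trans by blast
    fix S assume "S \<subseteq> Q" "S \<noteq> {}"
    from c(3)[OF this] obtain \<T> where T: "\<T> \<subseteq> \<C>" "P \<subseteq> \<Union>\<T>" "card \<T> \<le> C * card S ^ t"
      "\<forall>\<Delta>\<in>\<T>. \<forall>y\<in>S. \<Delta> \<inter> P \<subseteq> E y \<or> \<Delta> \<inter> P \<inter> E y = {}" by (elim exE conjE)
    have "card \<T> \<le> C' * card S ^ t" using T(3) le order_trans by blast
    then show "\<exists>\<T>\<subseteq>\<C>. P \<subseteq> \<Union>\<T> \<and> card \<T> \<le> C' * card S ^ t \<and>
        (\<forall>\<Delta>\<in>\<T>. \<forall>y\<in>S. \<Delta> \<inter> P \<subseteq> E y \<or> \<Delta> \<inter> P \<inter> E y = {})"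
      using T by (intro exI[of _ \<T>] conjI)
  qed (rule c(1))
qed

text \<open>A cover for \<open>S = Q\<close> has no crossings at all, so a class of at least
  \<open>s\<close> points contributes only edges to fewer than \<open>u\<close> common neighbours.
  Only \<open>O(n^t)\<close> points remain, which makes the number of halvings logarithmic in
  \<open>n\<close> and provides the hypothesis for balancing.\<close>

lemma reduce_to_few:
  assumes rd: "rel_decomp C k t E" and free: "K_free E s u" and s: "s \<ge> 2"
    and P: "finite P" and Q: "finite Q" "Q \<noteq> {}"
  shows "\<exists>P'\<subseteq>P. card P' \<le> s * (C * card Q ^ t) \<and> card (edges E P Q) \<le> card (edges E P' Q) + u * card P"
proof -
  obtain \<C> where c: "finite \<C>"
    "\<And>S. S \<subseteq> Q \<Longrightarrow> S \<noteq> {} \<Longrightarrow> \<exists>\<T>\<subseteq>\<C>. P \<subseteq> \<Union>\<T> \<and> card \<T> \<le> C * card S ^ t \<and>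
        (\<forall>\<Delta>\<in>\<T>. \<forall>y\<in>S. \<Delta> \<inter> P \<subseteq> E y \<or> \<Delta> \<inter> P \<inter> E y = {})"
    using rd P Q unfolding rel_decomp_def by metis
  from c(2)[OF order.refl Q(2)] obtain \<T> where T: "\<T> \<subseteq> \<C>" "P \<subseteq> \<Union>\<T>" "card \<T> \<le> C * card Q ^ t"
      "\<forall>\<Delta>\<in>\<T>. \<forall>y\<in>Q. \<Delta> \<inter> P \<subseteq> E y \<or> \<Delta> \<inter> P \<inter> E y = {}" by (elim exE conjE)
  have fT: "finite \<T>" using T(1) c(1) finite_subset by blast
  have cr: "card (crossing E P Q \<Delta>) \<le> (0::real)" if "\<Delta> \<in> \<T>" for \<Delta>
  proof -
    have "crossing E P Q \<Delta> = {}" unfolding crossing_def using T(4) that by blast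
    then show ?thesis by simp
  qed
  have "s \<ge> 1" using s by simp
  from class_step[OF free P Q(1) this fT T(2) cr] obtain P' where P': "P' \<subseteq> P" "card P' \<le> s * card \<T>"
    "real (card (edges E P Q)) \<le> card (edges E P' Q) + u * card P" by auto
  have "s * card \<T> \<le> s * (C * card Q ^ t)" using T(3) by (rule mult_le_mono2)
  then have "card P' \<le> s * (C * card Q ^ t)" using P'(2) by linarith
  moreover have "card (edges E P Q) \<le> card (edges E P' Q) + u * card P" using P'(3) by linarith
  ultimately show ?thesis using P'(1) by blast
qed

theorem rel_decomp_edges:
  fixes \<epsilon> :: real
  assumes rd: "rel_decomp C k t E" and free: "K_free E s u" and s: "s \<ge> 2" and t: "t \<ge> 1" and C: "C \<ge> 1"
    and \<epsilon>: "\<epsilon> > 0"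
  shows "\<exists>\<alpha>\<ge>0. \<forall>P Q. finite P \<longrightarrow> finite Q \<longrightarrow>
    card (edges E P Q) \<le> \<alpha> * (wt s t (card P) (card Q) * real (card Q) powr \<epsilon> + card P + card Q)"
proof -
  define \<kappa> where "\<kappa> = real (s * C)"
  define c where "c = real (1 + s ^ s * u)"
  have "1 * 1 \<le> s * C" using s C by (intro mult_mono) auto
  then have \<kappa>1: "\<kappa> \<ge> 1" unfolding \<kappa>_def by (simp only: real_of_nat_ge_one_iff)
  have C1: "real C \<ge> 1" using C by simp
  obtain A where A: "A \<ge> 0" "\<forall>n::real. n \<ge> 1 \<longrightarrow>
      (2 * ln (\<kappa> * n ^ t) + 1) * (C * (ln (C * n ^ k) + 2) ^ t) \<le> A * n powr \<epsilon>"
    using polylog_bound[OF C1 \<kappa>1 \<epsilon>, of t k] by (elim exE conjE)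
  define c2 where "c2 = 2 * c * s * \<kappa> + s"
  have c2: "c2 \<ge> 0" unfolding c2_def c_def \<kappa>_def by simp
  \<comment> \<open>Of \<open>3 * u\<close>, a part \<open>2 * u\<close> comes from the halvings and
    \<open>u\<close> from the reduction to few points.\<close>
  define \<alpha> where "\<alpha> = c2 * A + 3 * real u + s"
  have \<alpha>0: "0 \<le> c2 * A" using c2 A by simp
  have "card (edges E P Q) \<le> \<alpha> * (wt s t (card P) (card Q) * real (card Q) powr \<epsilon> + card P + card Q)"
    if P: "finite P" and Q: "finite Q" for P Q
  proof (cases "Q = {}")
    case True
    then have "edges E P Q = {}" unfolding edges_def by auto
    moreover have "0 \<le> \<alpha> * (wt s t (card P) (card Q) * real (card Q) powr \<epsilon> + card P + card Q)"
      unfolding \<alpha>_def using c2 A(1) by (intro mult_nonneg_nonneg add_nonneg_nonneg wt_nonneg) auto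
    ultimately show ?thesis by simp
  next
    case False
    define n where "n = real (card Q)"
    have n: "n \<ge> 1" unfolding n_def using Q False by (simp add: Suc_leI card_gt_0_iff)
    obtain P' where P': "P' \<subseteq> P" "card P' \<le> s * (C * card Q ^ t)" "card (edges E P Q) \<le> card (edges E P' Q) + u * card P"
      using reduce_to_few[OF rd free s P Q False] by blast
    have Pb: "card P' \<le> \<kappa> * real (card Q) ^ t"
    proof -
      have "real (card P') \<le> real (s * (C * card Q ^ t))" using P'(2) by (rule of_nat_mono)
      then show ?thesis unfolding \<kappa>_def by simp
    qed
    define X where "X = \<kappa> * n ^ t"
    have "1 * 1 \<le> \<kappa> * n ^ t" using \<kappa>1 n by (intro mult_mono) auto
    then have X: "X \<ge> 1" unfolding X_def by simp
    \<comment> \<open>The number of halvings, chosen so that \<open>card P' < 2 ^ i\<close>.\<close>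
    define i where "i = nat \<lfloor>log 2 X\<rfloor> + 1"
    have lX: "log 2 X \<ge> 0" using X by simp
    have i: "real i \<le> log 2 X + 1" "log 2 X < i" unfolding i_def using lX by linarith+
    have "X < 2 ^ i"
      using i(2) X by (simp add: log_less_iff powr_realpow)
    then have "real (card P') < 2 ^ i" using Pb unfolding X_def n_def by linarith
    then have cP: "card P' < 2 ^ i" by (metis of_nat_less_iff of_nat_numeral of_nat_power)
    have "log 2 X \<le> 2 * ln X"
    proof -
      have "ln X * 1 \<le> ln X * (2 * ln 2)" using X ln2_ge_two_thirds by (intro mult_left_mono) auto
      then show ?thesis unfolding log_def by (simp add: field_simps)
    qed
    then have i2: "real i \<le> 2 * ln (\<kappa> * n ^ t) + 1" using i(1) unfolding X_def by simp
    define \<Lambda> where "\<Lambda> = C * (ln (C * card Q ^ k) + 2) ^ t"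
    define L where "L = (2 * c * s * \<kappa> + s) * \<Lambda>"
    have "card Q ^ k \<ge> 1" using Q False by (simp add: card_gt_0_iff Suc_leI)
    then have "C * card Q ^ k \<ge> 1" using C by simp
    then have "ln (real (C * card Q ^ k)) \<ge> 0" by (simp only: ln_ge_zero real_of_nat_ge_one_iff)
    then have \<Lambda>0: "\<Lambda> \<ge> 0" unfolding \<Lambda>_def by simp
    then have L0: "L \<ge> 0" unfolding L_def using c2 unfolding c2_def by simp
    have fP': "finite P'" using P'(1) P finite_subset by blast
    have cPP: "card P' \<le> card P" using P'(1) P by (rule card_mono[rotated])
    have W: "wt s t (card P') n \<le> wt s t (card P) n" using cPP s t by (intro wt_mono) auto
    have iL: "i * L \<le> c2 * A * n powr \<epsilon>"
    proof -
      have "i * \<Lambda> \<le> (2 * ln (\<kappa> * n ^ t) + 1) * \<Lambda>" using i2 \<Lambda>0 by (intro mult_right_mono)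
      also have "\<dots> \<le> A * n powr \<epsilon>" using A(2)[rule_format, OF n] unfolding \<Lambda>_def n_def by simp
      finally have "c2 * (i * \<Lambda>) \<le> c2 * (A * n powr \<epsilon>)" using c2 by (intro mult_left_mono)
      then show ?thesis unfolding L_def c2_def by (simp add: mult_ac)
    qed
    have "card (edges E P' Q) \<le> 2 * real u * card P' + i * L * wt s t (card P') n + s * n"
      using halving_iterate[OF rd free s t C Q False \<Lambda>_def \<kappa>_def c_def L_def L0 fP' cP Pb] unfolding n_def by simp
    also have "\<dots> \<le> 2 * real u * card P + c2 * A * n powr \<epsilon> * wt s t (card P) n + s * n"
    proof -
      have "i * L * wt s t (card P') n \<le> c2 * A * n powr \<epsilon> * wt s t (card P) n"
        using \<alpha>0 by (intro mult_mono[OF iL W] wt_nonneg) simp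
      moreover have "2 * real u * card P' \<le> 2 * real u * card P" using cPP by (intro mult_left_mono) auto
      ultimately show ?thesis by linarith
    qed
    finally have "card (edges E P' Q) \<le> 2 * real u * card P + c2 * A * n powr \<epsilon> * wt s t (card P) n + s * n" .
    moreover have "real (card (edges E P Q)) \<le> card (edges E P' Q) + real u * card P"
      using P'(3) by (metis of_nat_add of_nat_le_iff of_nat_mult)
    ultimately have "card (edges E P Q) \<le> c2 * A * (wt s t (card P) n * n powr \<epsilon>) + 3 * real u * card P + s * n"
      by (simp add: mult_ac)
    also have "\<dots> \<le> \<alpha> * (wt s t (card P) n * n powr \<epsilon>) + \<alpha> * card P + \<alpha> * n"
      unfolding \<alpha>_def using \<alpha>0 n by (intro add_mono mult_right_mono mult_nonneg_nonneg wt_nonneg) auto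
    finally show ?thesis unfolding n_def by (simp add: algebra_simps)
  qed
  moreover have "\<alpha> \<ge> 0" unfolding \<alpha>_def using \<alpha>0 by simp
  ultimately show ?thesis by blast
qed

section \<open>Exponential-polynomial relations\<close>

text \<open>For fixed \<open>y\<close> the coordinates and exponentials of \<open>y\<close> become
  real coefficients, so the degree bound is the same for all \<open>y\<close>.\<close>

lemma exp_polynomial_fibre:
  fixes h :: "'a::finite \<Rightarrow> nat"
  assumes "exp_polynomial (f :: real ^ ('a + 'b::finite) \<Rightarrow> real)" and h: "\<And>i. h i < d"
  shows "\<exists>D. \<forall>y. bdpoly (nvars d) D (\<lambda>z. f (concat_vec (\<chi> i. z (h i)) y))"
  using assms(1)
proof (induction rule: exp_polynomial.induct)
  case (const c)
  show ?case by (auto intro: bdpoly.const)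
next
  case (coord i)
  show ?case
    by (cases i) (auto simp: concat_vec_def intro!: exI[of _ 1] bdpoly_nvars_coord h bdpoly.const)
next
  case (exp_coord i)
  show ?case
    by (cases i) (auto simp: concat_vec_def intro!: exI[of _ 1] bdpoly_nvars_exp h bdpoly.const)
next
  case (add f g)
  then obtain D D' where "\<forall>y. bdpoly (nvars d) D (\<lambda>z. f (concat_vec (\<chi> i. z (h i)) y))"
    "\<forall>y. bdpoly (nvars d) D' (\<lambda>z. g (concat_vec (\<chi> i. z (h i)) y))" by (elim exE)
  then have "\<forall>y. bdpoly (nvars d) (max D D') (\<lambda>z. f (concat_vec (\<chi> i. z (h i)) y) + g (concat_vec (\<chi> i. z (h i)) y))"
    by (intro allI bdpoly.add) (auto intro: bdpoly_mono)
  then show ?case by (rule exI)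
next
  case (mult f g)
  then obtain D D' where "\<forall>y. bdpoly (nvars d) D (\<lambda>z. f (concat_vec (\<chi> i. z (h i)) y))"
    "\<forall>y. bdpoly (nvars d) D' (\<lambda>z. g (concat_vec (\<chi> i. z (h i)) y))" by (elim exE)
  then have "\<forall>y. bdpoly (nvars d) (D + D') (\<lambda>z. f (concat_vec (\<chi> i. z (h i)) y) * g (concat_vec (\<chi> i. z (h i)) y))"
    by (intro allI bdpoly.mult) auto
  then show ?case by (rule exI)
qed

text \<open>In the application \<open>h\<close> enumerates the coordinates as an initial segment of
  the naturals; the values beyond it are arbitrary and invisible to the existential sets
  concerned.\<close>

definition lift_vec :: "('a \<Rightarrow> nat) \<Rightarrow> real ^ 'a \<Rightarrow> nat \<Rightarrow> real" where
  "lift_vec h x k = x $ inv h k"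

lemma lift_vec_inverse: "inj h \<Longrightarrow> (\<chi> i. lift_vec h x (h i)) = x"
  by (simp add: lift_vec_def vec_eq_iff)

text \<open>A condition on \<open>X\<close> that is insensitive to complements, so boolean
  combinations can be treated without complements of existential sets.\<close>

definition determined :: "('a \<Rightarrow> nat) \<Rightarrow> (nat \<Rightarrow> real) set set \<Rightarrow> (real ^ 'a) set \<Rightarrow> bool" where
  "determined h \<A> X \<longleftrightarrow> (\<forall>x x'. (\<forall>A\<in>\<A>. lift_vec h x \<in> A \<longleftrightarrow> lift_vec h x' \<in> A) \<longrightarrow> (x \<in> X \<longleftrightarrow> x' \<in> X))"

text \<open>The bounds \<open>L\<close>, \<open>K\<close>, \<open>D\<close> come before
  \<open>y\<close>, so they hold for all parameters at once. Nonemptiness of \<open>\<A>\<close>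
  ensures that a nonempty set of parameters yields a nonempty set of existential sets, as
  \<open>is_cell_decomp\<close> requires.\<close>

definition traced :: "nat \<Rightarrow> ('a::finite \<Rightarrow> nat) \<Rightarrow> nat \<Rightarrow> nat \<Rightarrow> nat \<Rightarrow> (real ^ ('a + 'b::finite)) set \<Rightarrow> bool" where
  "traced d h L K D S \<longleftrightarrow> (\<forall>y. \<exists>\<A>. finite \<A> \<and> \<A> \<noteq> {} \<and> card \<A> \<le> L \<and> \<A> \<subseteq> exsets d K D \<and>
     determined h \<A> {x. concat_vec x y \<in> S})"

lemma traced_eq:
  fixes f g :: "real ^ ('a::finite + 'b::finite) \<Rightarrow> real"
  assumes f: "exp_polynomial f" and g: "exp_polynomial g" and h: "inj h" "\<And>i. h i < d"
  shows "\<exists>L K D. traced d h L K D {z. f z = g z}"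
proof -
  obtain Df Dg where D: "\<forall>y. bdpoly (nvars d) Df (\<lambda>z. f (concat_vec (\<chi> i. z (h i)) y))"
    "\<forall>y. bdpoly (nvars d) Dg (\<lambda>z. g (concat_vec (\<chi> i. z (h i)) y))"
    using exp_polynomial_fibre[where h = h, OF f h(2)] exp_polynomial_fibre[where h = h, OF g h(2)] by (elim exE)
  have "\<exists>\<A>. finite \<A> \<and> \<A> \<noteq> {} \<and> card \<A> \<le> 1 \<and> \<A> \<subseteq> exsets d d (max Df Dg) \<and>
     determined h \<A> {x. concat_vec x y \<in> {z. f z = g z}}" for y
  proof -
    define F where "F z = f (concat_vec (\<chi> i. z (h i)) y) - g (concat_vec (\<chi> i. z (h i)) y)" for z
    have F: "bdpoly (nvars d) (max Df Dg) F" unfolding F_def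
      using D by (intro bdpoly_diff) (auto intro: bdpoly_mono)
    have ex: "{z. F z = 0} \<in> exsets d d (max Df Dg)"
    proof (rule exsetsI[OF F])
      fix x
      have cong: "F z = F x" if "\<forall>i<d. z i = x i" for z by (rule bdpoly_nvars_cong[OF F]) (use that in auto)
      show "x \<in> {z. F z = 0} \<longleftrightarrow> (\<exists>z. (\<forall>i<d. z i = x i) \<and> F z = 0)"
      proof
        assume "x \<in> {z. F z = 0}"
        then show "\<exists>z. (\<forall>i<d. z i = x i) \<and> F z = 0" by (intro exI[of _ x]) simp
      next
        assume "\<exists>z. (\<forall>i<d. z i = x i) \<and> F z = 0"
        then obtain z where z: "\<forall>i<d. z i = x i" "F z = 0" by blast
        show "x \<in> {z. F z = 0}" using cong[OF z(1)] z(2) by simp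
      qed
    qed
    have "determined h {{z. F z = 0}} {x. concat_vec x y \<in> {z. f z = g z}}"
      unfolding determined_def F_def using h(1) by (simp add: lift_vec_inverse)
    then show ?thesis using ex by (intro exI[of _ "{{z. F z = 0}}"]) simp
  qed
  then show ?thesis unfolding traced_def by blast
qed

lemma traced_less:
  fixes f g :: "real ^ ('a::finite + 'b::finite) \<Rightarrow> real"
  assumes f: "exp_polynomial f" and g: "exp_polynomial g" and h: "inj h" "\<And>i. h i < d"
  shows "\<exists>L K D. traced d h L K D {z. f z < g z}"
proof -
  obtain Df Dg where D: "\<forall>y. bdpoly (nvars d) Df (\<lambda>z. f (concat_vec (\<chi> i. z (h i)) y))"
    "\<forall>y. bdpoly (nvars d) Dg (\<lambda>z. g (concat_vec (\<chi> i. z (h i)) y))"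
    using exp_polynomial_fibre[where h = h, OF f h(2)] exp_polynomial_fibre[where h = h, OF g h(2)] by (elim exE)
  define D' where "D' = Df + Dg + 1"
  have "\<exists>\<A>. finite \<A> \<and> \<A> \<noteq> {} \<and> card \<A> \<le> 1 \<and> \<A> \<subseteq> exsets d (Suc d) D' \<and>
     determined h \<A> {x. concat_vec x y \<in> {z. f z < g z}}" for y
  proof -
    define F where "F z = g (concat_vec (\<chi> i. z (h i)) y) - f (concat_vec (\<chi> i. z (h i)) y)" for z
    have F: "bdpoly (nvars d) D' F" unfolding F_def D'_def
      using D by (intro bdpoly_diff) (auto intro: bdpoly_mono)
    have ex: "{z. 0 < F z} \<in> exsets d (Suc d) D'"
    proof (rule exsetsI)
      show "bdpoly (nvars (Suc d)) D' (\<lambda>z. F z - exp (z d))"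
        by (intro bdpoly_diff bdpoly_nvars_exp bdpoly_nvars_mono[OF F]) (auto simp: D'_def)
      fix x
      have cong: "F z = F x" if "\<forall>i<d. z i = x i" for z by (rule bdpoly_nvars_cong[OF F]) (use that in auto)
      show "x \<in> {z. 0 < F z} \<longleftrightarrow> (\<exists>z. (\<forall>i<d. z i = x i) \<and> F z - exp (z d) = 0)"
      proof
        assume "x \<in> {z. 0 < F z}"
        then have pos: "0 < F x" by simp
        have "F (x(d := ln (F x))) = F x" by (rule cong) simp
        then show "\<exists>z. (\<forall>i<d. z i = x i) \<and> F z - exp (z d) = 0"
          using pos by (intro exI[of _ "x(d := ln (F x))"]) simp
      next
        assume "\<exists>z. (\<forall>i<d. z i = x i) \<and> F z - exp (z d) = 0"
        then obtain z where z: "\<forall>i<d. z i = x i" "F z - exp (z d) = 0" by blast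
        then have "F x = exp (z d)" using cong[OF z(1)] by simp
        then show "x \<in> {z. 0 < F z}" by simp
      qed
    qed
    have "determined h {{z. 0 < F z}} {x. concat_vec x y \<in> {z. f z < g z}}"
      unfolding determined_def F_def using h(1) by (simp add: lift_vec_inverse)
    then show ?thesis using ex by (intro exI[of _ "{{z. 0 < F z}}"]) simp
  qed
  then show ?thesis unfolding traced_def by blast
qed

lemma traced_compl: "traced d h L K D S \<Longrightarrow> traced d h L K D (- S)"
  unfolding traced_def determined_def by simp

lemma traced_combine:
  assumes S: "traced d h L K D S" and T: "traced d h L' K' D' T"
    and U: "\<And>z z'. (z \<in> S \<longleftrightarrow> z' \<in> S) \<Longrightarrow> (z \<in> T \<longleftrightarrow> z' \<in> T) \<Longrightarrow> (z \<in> U \<longleftrightarrow> z' \<in> U)"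
  shows "traced d h (L + L') (max K K') (max D D') U"
  unfolding traced_def
proof
  fix y
  obtain \<A> where A: "finite \<A>" "\<A> \<noteq> {}" "card \<A> \<le> L" "\<A> \<subseteq> exsets d K D" "determined h \<A> {x. concat_vec x y \<in> S}"
    using S[unfolded traced_def, rule_format, of y] by (elim exE conjE)
  obtain \<B> where B: "finite \<B>" "\<B> \<noteq> {}" "card \<B> \<le> L'" "\<B> \<subseteq> exsets d K' D'" "determined h \<B> {x. concat_vec x y \<in> T}"
    using T[unfolded traced_def, rule_format, of y] by (elim exE conjE)
  have "card (\<A> \<union> \<B>) \<le> L + L'" using card_Un_le[of \<A> \<B>] A(3) B(3) by linarith
  moreover have "\<A> \<union> \<B> \<subseteq> exsets d (max K K') (max D D')"
    using A(4) B(4) exsets_mono[of _ d K D "max K K'" "max D D'"] exsets_mono[of _ d K' D' "max K K'" "max D D'"] by auto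
  moreover have "determined h (\<A> \<union> \<B>) {x. concat_vec x y \<in> U}"
    unfolding determined_def
  proof (intro allI impI)
    fix x x' assume eq: "\<forall>A\<in>\<A> \<union> \<B>. lift_vec h x \<in> A \<longleftrightarrow> lift_vec h x' \<in> A"
    have 1: "concat_vec x y \<in> S \<longleftrightarrow> concat_vec x' y \<in> S"
      using A(5)[unfolded determined_def, rule_format, of x x'] eq by simp
    have 2: "concat_vec x y \<in> T \<longleftrightarrow> concat_vec x' y \<in> T"
      using B(5)[unfolded determined_def, rule_format, of x x'] eq by simp
    show "x \<in> {x. concat_vec x y \<in> U} \<longleftrightarrow> x' \<in> {x. concat_vec x y \<in> U}"
      unfolding mem_Collect_eq by (rule U[OF 1 2])
  qed
  ultimately show "\<exists>\<A>. finite \<A> \<and> \<A> \<noteq> {} \<and> card \<A> \<le> L + L' \<and> \<A> \<subseteq> exsets d (max K K') (max D D') \<and>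
     determined h \<A> {x. concat_vec x y \<in> U}"
    using A(1,2) B(1) by (intro exI[of _ "\<A> \<union> \<B>"]) simp
qed

lemma exp_bool_comb_traced:
  assumes "exp_bool_comb (S :: (real ^ ('a::finite + 'b::finite)) set)" and h: "inj h" "\<And>i. h i < d"
  shows "\<exists>L K D. traced d h L K D S"
  using assms(1)
proof (induction rule: exp_bool_comb.induct)
  case (eq f g) then show ?case by (rule traced_eq[where h = h, OF _ _ h])
next
  case (less f g) then show ?case by (rule traced_less[where h = h, OF _ _ h])
next
  case (le f g)
  have "- {z. g z < f z} = {z. f z \<le> g z}" by auto
  moreover obtain L K D where "traced d h L K D {z. g z < f z}" using traced_less[where h = h, OF le(2,1) h] by (elim exE)
  ultimately have "traced d h L K D {z. f z \<le> g z}" using traced_compl by metis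
  then show ?case by (intro exI)
next
  case (compl S)
  then show ?case using traced_compl by blast
next
  case (inter S T)
  then obtain L K D L' K' D' where "traced d h L K D S" "traced d h L' K' D' T" by (elim exE)
  from traced_combine[OF this, of "S \<inter> T"] show ?case by (intro exI) auto
next
  case (union S T)
  then obtain L K D L' K' D' where "traced d h L K D S" "traced d h L' K' D' T" by (elim exE)
  from traced_combine[OF this, of "S \<union> T"] show ?case by (intro exI) auto
qed

text \<open>A parameter \<open>y\<close> is replaced by the at most \<open>L\<close> existential
  sets that determine its fibre, so \<open>n\<close> parameters become at most \<open>L * n\<close>
  sets and only the constant changes. A cell that none of these sets crosses is not crossed by the
  fibre either.\<close>

lemma traced_rel_decomp:
  fixes S :: "(real ^ ('a::finite + 'b::finite)) set"
  assumes tr: "traced (Suc j) h L K D S"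
  shows "\<exists>C k. rel_decomp C k (2 * j + 1) (\<lambda>y. {x. concat_vec x y \<in> S})"
proof -
  obtain C k where Ck: "\<forall>P Q. finite P \<longrightarrow> finite Q \<longrightarrow> Q \<subseteq> exsets (Suc j) K D \<longrightarrow> cell_decomp C k (2 * j + 1) P Q"
    using exsets_cell_decomp by blast
  define t where "t = 2 * j + 1"
  from tr[unfolded traced_def] have "\<exists>\<A>. \<forall>y. finite (\<A> y) \<and> \<A> y \<noteq> {} \<and> card (\<A> y) \<le> L \<and> \<A> y \<subseteq> exsets (Suc j) K D \<and>
     determined h (\<A> y) {x. concat_vec x y \<in> S}" by (rule choice)
  then obtain \<A> where A: "\<And>y. finite (\<A> y)" "\<And>y. \<A> y \<noteq> {}" "\<And>y. card (\<A> y) \<le> L"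
    "\<And>y. \<A> y \<subseteq> exsets (Suc j) K D" "\<And>y. determined h (\<A> y) {x. concat_vec x y \<in> S}" by blast
  define C' where "C' = C * (L ^ k + L ^ t)"
  have cU: "card (\<Union> (\<A> ` Q)) \<le> L * card Q" if "finite Q" for Q
  proof -
    have "card (\<Union> (\<A> ` Q)) \<le> (\<Sum>y\<in>Q. card (\<A> y))" by (rule card_UN_le[OF that])
    also have "\<dots> \<le> (\<Sum>y\<in>Q. L)" by (intro sum_mono A(3))
    finally show ?thesis by (simp add: mult.commute)
  qed
  have "rel_decomp C' k t (\<lambda>y. {x. concat_vec x y \<in> S})"
    unfolding rel_decomp_def
  proof (intro allI impI)
    fix P :: "(real ^ 'a) set" and Q :: "(real ^ 'b) set"
    assume P: "finite P" and Q: "finite Q"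
    define QQ where "QQ = \<Union> (\<A> ` Q)"
    have "finite QQ" unfolding QQ_def using Q A(1) by simp
    moreover have "QQ \<subseteq> exsets (Suc j) K D" unfolding QQ_def using A(4) by (intro UN_least)
    ultimately obtain \<C> where \<C>: "is_cell_decomp C k t (lift_vec h ` P) QQ \<C>"
      using Ck P unfolding t_def cell_decomp_def by blast
    define pull where "pull \<Delta> = lift_vec h -` \<Delta>" for \<Delta>
    have fin: "finite \<C>" and cC: "card \<C> \<le> C * card QQ ^ k" using \<C> unfolding is_cell_decomp_def by auto
    show "\<exists>\<C>. finite \<C> \<and> card \<C> \<le> C' * card Q ^ k \<and>
     (\<forall>S'. S' \<subseteq> Q \<longrightarrow> S' \<noteq> {} \<longrightarrow> (\<exists>\<T>\<subseteq>\<C>. P \<subseteq> \<Union>\<T> \<and> card \<T> \<le> C' * card S' ^ t \<and>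
        (\<forall>\<Delta>\<in>\<T>. \<forall>y\<in>S'. \<Delta> \<inter> P \<subseteq> {x. concat_vec x y \<in> S} \<or> \<Delta> \<inter> P \<inter> {x. concat_vec x y \<in> S} = {})))"
    proof (rule exI[of _ "pull ` \<C>"], intro conjI allI impI)
      show "finite (pull ` \<C>)" using fin by simp
      have "card (pull ` \<C>) \<le> card \<C>" using fin by (rule card_image_le)
      also have "\<dots> \<le> C * card QQ ^ k" by (rule cC)
      also have "\<dots> \<le> C * (L * card Q) ^ k" unfolding QQ_def by (intro mult_le_mono2 power_mono cU Q) simp
      also have "\<dots> \<le> C' * card Q ^ k" unfolding C'_def by (simp add: power_mult_distrib algebra_simps)
      finally show "card (pull ` \<C>) \<le> C' * card Q ^ k" .
      fix S' assume S': "S' \<subseteq> Q" "S' \<noteq> {}"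
      define SS where "SS = \<Union> (\<A> ` S')"
      have "SS \<subseteq> QQ" "SS \<noteq> {}" unfolding SS_def QQ_def using S' A(2) by auto
      with \<C>[unfolded is_cell_decomp_def] obtain \<T> where T: "\<T> \<subseteq> \<C>" "uncrossed_cover C t (lift_vec h ` P) SS \<T>"
        by meson
      note U = T(2)[unfolded uncrossed_cover_def]
      have finT: "finite \<T>" using T(1) fin finite_subset by blast
      have "card (pull ` \<T>) \<le> card \<T>" using finT by (rule card_image_le)
      also have "\<dots> \<le> C * card SS ^ t" using U by blast
      also have "\<dots> \<le> C * (L * card S') ^ t"
        unfolding SS_def using S'(1) Q finite_subset by (intro mult_le_mono2 power_mono cU) auto
      also have "\<dots> \<le> C' * card S' ^ t" unfolding C'_def by (simp add: power_mult_distrib algebra_simps)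
      finally have 1: "card (pull ` \<T>) \<le> C' * card S' ^ t" .
      have "lift_vec h ` P \<subseteq> \<Union>\<T>" using U by blast
      then have 2: "P \<subseteq> \<Union> (pull ` \<T>)" unfolding pull_def by auto
      have 3: "pull \<Delta> \<inter> P \<subseteq> {x. concat_vec x y \<in> S} \<or> pull \<Delta> \<inter> P \<inter> {x. concat_vec x y \<in> S} = {}"
        if D: "\<Delta> \<in> \<T>" and y: "y \<in> S'" for \<Delta> y
      proof -
        have un: "\<Delta> \<inter> lift_vec h ` P \<subseteq> A \<or> \<Delta> \<inter> lift_vec h ` P \<inter> A = {}" if "A \<in> \<A> y" for A
          using U D y that unfolding SS_def by blast
        have "x \<in> {x. concat_vec x y \<in> S} \<longleftrightarrow> x' \<in> {x. concat_vec x y \<in> S}"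
          if x: "x \<in> pull \<Delta> \<inter> P" "x' \<in> pull \<Delta> \<inter> P" for x x'
        proof (rule A(5)[unfolded determined_def, rule_format])
          fix A assume "A \<in> \<A> y"
          from un[OF this] show "lift_vec h x \<in> A \<longleftrightarrow> lift_vec h x' \<in> A" using x unfolding pull_def by blast
        qed
        then show ?thesis by blast
      qed
      show "\<exists>\<T>\<subseteq>pull ` \<C>. P \<subseteq> \<Union>\<T> \<and> card \<T> \<le> C' * card S' ^ t \<and>
        (\<forall>\<Delta>\<in>\<T>. \<forall>y\<in>S'. \<Delta> \<inter> P \<subseteq> {x. concat_vec x y \<in> S} \<or> \<Delta> \<inter> P \<inter> {x. concat_vec x y \<in> S} = {})"
        using T(1) 1 2 3 by (intro exI[of _ "pull ` \<T>"] conjI) auto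
    qed
  qed
  then show ?thesis unfolding t_def by blast
qed

text \<open>Every point has fewer than \<open>u\<close> neighbours in \<open>Q\<close>.\<close>

lemma star_free_edges:
  assumes free: "K_free E 1 u" and P: "finite P" and Q: "finite Q"
  shows "card (edges E P Q) \<le> u * card P"
proof -
  have "edges E P Q = (SIGMA p:P. {y \<in> Q. p \<in> E y})" unfolding edges_def by auto
  then have "card (edges E P Q) = (\<Sum>p\<in>P. card {y \<in> Q. p \<in> E y})" using P Q by (simp add: card_SigmaI)
  also have "\<dots> \<le> (\<Sum>p\<in>P. u)"
  proof (rule sum_mono)
    fix p
    show "card {y \<in> Q. p \<in> E y} \<le> u"
      using K_free_few_common[OF free, of "{p}" "{y \<in> Q. p \<in> E y}"] Q by fastforce
  qed
  finally show ?thesis by (simp add: mult.commute)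
qed

theorem corollary8p9:
  fixes E :: "((real ^ 'a) \<times> (real ^ 'b)) set" and s u :: nat and \<epsilon> :: real
  assumes "s > 0" and "u > 0"
    and "(CARD('a), s) \<noteq> (1, 1)"
    and "exp_relation E"
    and "\<not> contains_K E s u"
    and "\<epsilon> > 0"
  shows "\<exists>\<alpha>::real. \<forall>(P :: (real ^ 'a) set) (Q :: (real ^ 'b) set) (m :: nat) (n :: nat).
    finite P \<and> finite Q \<and> card P = m \<and> card Q = n \<longrightarrow>
      real (card (E \<inter> (P \<times> Q))) \<le>
        \<alpha> * (real m powr
                (((2 * real CARD('a) - 2) * real s) / ((2 * real CARD('a) - 1) * real s - 1))
            * real n powr
                (((2 * real CARD('a) - 1) * (real s - 1)) / ((2 * real CARD('a) - 1) * real s - 1) + \<epsilon>)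
            + real m + real n)"
proof -
  define Ey where "Ey y = {x. (x, y) \<in> E}" for y
  have ed: "E \<inter> (P \<times> Q) = edges Ey P Q" for P Q unfolding Ey_def edges_def by auto
  have free: "K_free Ey s u"
    using assms(5) unfolding K_free_def contains_K_def Ey_def by blast
  show ?thesis
  \<comment> \<open>For \<open>s = 1\<close> all degrees of points are below \<open>u\<close>, and
    the term \<open>m\<close> suffices. For \<open>s \<ge> 2\<close> the denominator
    \<open>t * s - 1\<close> of the exponents, with \<open>t = 2 * CARD('a) - 1\<close>, is at least
    1, which the balancing relies on.\<close>
  proof (cases "s = 1")
    case True
    have "real (card (E \<inter> (P \<times> Q))) \<le> real u * (real m powr x * real n powr y + real m + real n)"
      if "finite P \<and> finite Q \<and> card P = m \<and> card Q = n" for P Q m n x y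
    proof -
      have "card (E \<inter> (P \<times> Q)) \<le> u * card P" unfolding ed
        using star_free_edges[of Ey u P Q] free True that by simp
      then have "real (card (E \<inter> (P \<times> Q))) \<le> real u * m" using that by (metis of_nat_le_iff of_nat_mult)
      also have "\<dots> \<le> real u * (real m powr x * real n powr y + real m + real n)"
        by (intro mult_left_mono) auto
      finally show ?thesis .
    qed
    then show ?thesis by (intro exI[of _ "real u"] allI impI)
  next
    case False
    then have s: "s \<ge> 2" using assms(1) by linarith
    define j where "j = CARD('a) - 1"
    have j: "CARD('a) = Suc j" unfolding j_def using zero_less_card_finite[where 'a = 'a] by simp
    obtain h :: "'a \<Rightarrow> nat" where "bij_betw h UNIV {0..<CARD('a)}"
      using ex_bij_betw_finite_nat[OF finite_class.finite_UNIV] by blast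
    then have h: "inj h" "\<And>i. h i < Suc j" unfolding j bij_betw_def by auto
    obtain S where S: "exp_bool_comb S" "E = {(x, y). concat_vec x y \<in> S}"
      using assms(4) unfolding exp_relation_def by blast
    have Ey: "Ey = (\<lambda>y. {x. concat_vec x y \<in> S})" unfolding Ey_def S(2) by simp
    obtain L K D where "traced (Suc j) h L K D S" using exp_bool_comb_traced[where h = h, OF S(1) h] by (elim exE)
    from traced_rel_decomp[OF this] obtain C k where "rel_decomp C k (2 * j + 1) Ey" unfolding Ey by (elim exE)
    \<comment> \<open>Enlarged to \<open>C + 1\<close> to have a constant that is at least
      1.\<close>
    then have rd: "rel_decomp (C + 1) k (2 * j + 1) Ey" by (rule rel_decomp_mono) simp
    obtain \<alpha> where \<alpha>: "\<forall>P Q. finite P \<longrightarrow> finite Q \<longrightarrow> card (edges Ey P Q)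
        \<le> \<alpha> * (wt s (2 * j + 1) (card P) (card Q) * real (card Q) powr \<epsilon> + card P + card Q)"
      using rel_decomp_edges[OF rd free s _ _ assms(6)] by auto
    have t: "2 * real CARD('a) - 1 = real (2 * j + 1)" "2 * real CARD('a) - 2 = real (2 * j + 1) - 1"
      unfolding j by auto
    show ?thesis
    proof (rule exI[of _ \<alpha>], intro allI impI)
      fix P :: "(real ^ 'a) set" and Q :: "(real ^ 'b) set" and m n
      assume PQ: "finite P \<and> finite Q \<and> card P = m \<and> card Q = n"
      from \<alpha>[rule_format, of P Q] PQ
      have "card (edges Ey P Q) \<le> \<alpha> * (wt s (2 * j + 1) m n * real n powr \<epsilon> + m + n)" by simp
      then show "real (card (E \<inter> (P \<times> Q))) \<le>
        \<alpha> * (real m powr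
                (((2 * real CARD('a) - 2) * real s) / ((2 * real CARD('a) - 1) * real s - 1))
            * real n powr
                (((2 * real CARD('a) - 1) * (real s - 1)) / ((2 * real CARD('a) - 1) * real s - 1) + \<epsilon>)
            + real m + real n)"
        unfolding ed t wt_def powr_add by (simp only: mult.assoc)
    qed
  qed
qed

end
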